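(* Let $1<p<\infty$ and $1/p+1/q=1$. Let $a,b,c,d$ satisfy the basic factorization conditions in $H^p(\mathbb T)$ with indices $n,m\in\mathbb Z$ and factors $c_+,d_+$ (see context). Suppose that $T(a)+H(b)$ is Fredholm on $H^p(\mathbb T)$. Then $T(a)+H(b)$ is invertible on $H^p(\mathbb T)$ if and only if (i) $n=m=0$, or (ii) $n=m>0$ and the matrix $A_{n,n}$ is invertible, where, for $n=m>0$, $$A_{n,n}=\left[\rho_{i-j}+\rho_{i+j}\right]_{i,j=0}^{n-1},\qquad \rho:=t^{-m-n}(1+t)(1+t^{-1})\,\tilde c_+\,\tilde d_+\,b^{-1}\in L^1(\mathbb T),$$ and $\rho_k$ denotes the $k$-th Fourier coefficient of $\rho$.
   Context: $\mathbb T=\{z\in\mathbb C:|z|=1\}$. For $f\in L^1(\mathbb T)$, $f_n=\frac1{2\pi}\int_0^{2\pi}f(e^{i\theta})e^{-in\theta}\,d\theta$. $H^p(\mathbb T)=\{f\in L^p(\mathbb T): f_n=0 \text{ for all } n<0\}$; for $1<p<\infty$, $P:\sum_{n\in\mathbb Z}f_nt^n\mapsto\sum_{n\ge0}f_nt^n$ is the (bounded) Riesz projection of $L^p(\mathbb T)$ onto $H^p(\mathbb T)$, and $(Jf)(t)=t^{-1}f(t^{-1})$. For $a,b\in L^\infty(\mathbb T)$, $T(a)f=P(af)$ and $H(b)f=P(b\cdot Jf)$ on $H^p(\mathbb T)$. For a function $f$ on $\mathbb T$, $\tilde f(t)=f(t^{-1})$. $GL^\infty(\mathbb T)$ is the group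 of invertible elements of $L^\infty(\mathbb T)$. Basic factorization conditions in $H^p(\mathbb T)$ (with indices $n,m$): (i) $a,b\in GL^\infty(\mathbb T)$ satisfy $a\tilde a=b\tilde b$, and $c=\frac ab=\frac{\tilde b}{\tilde a}$, $d=\frac{\tilde a}{b}=\frac{\tilde b}{a}$. (ii) $c$ and $d$ admit factorizations $c(t)=c_+(t)\,t^{2n}\,c_+^{-1}(t^{-1})$, $d(t)=d_+(t)\,t^{2m}\,d_+^{-1}(t^{-1})$ with $n,m\in\mathbb Z$ and $(1+t)c_+(t)\in H^q(\mathbb T)$, $(1-t)c_+^{-1}(t)\in H^p(\mathbb T)$, $(1+t)d_+(t)\in H^p(\mathbb T)$, $(1-t)d_+^{-1}(t)\in H^q(\mathbb T)$, where $c_+^{-1}=1/c_+$, $d_+^{-1}=1/d_+$. *)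

theory Defs
  imports "HOL-Probability.Probability_Measure" "Jordan_Normal_Form.Matrix"
begin

section \<open>Measurable functions on the unit circle modulo null sets\<close>

text \<open>Normalised arc length on the unit circle.\<close>

definition circle :: "complex measure" where
  "circle = distr (uniform_measure lborel {0..2*pi}) (restrict_space borel (sphere 0 1)) cis"

lemma cis_measurable_circle [measurable]:
  "cis \<in> measurable borel (restrict_space borel (sphere 0 1))"
proof (rule measurable_restrict_space2)
  show "cis \<in> space borel \<rightarrow> sphere 0 1" by auto
  have "continuous_on UNIV cis"
    by (intro continuous_intros)
  then show "cis \<in> borel_measurable borel" by (rule borel_measurable_continuous_onI)
qed

lemma sets_circle [simp, measurable_cong]: "sets circle = sets (restrict_space borel (sphere 0 1))"
  by (simp add: circle_def)

lemma space_circle: "space circle = sphere 0 1"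
  by (simp add: circle_def space_restrict_space)

lemma prob_space_circle: "prob_space circle"
proof -
  have "prob_space (uniform_measure lborel {0..2*pi})"
    by (rule prob_space_uniform_measure) auto
  then show ?thesis unfolding circle_def
    by (rule prob_space.prob_space_distr) simp
qed

lemma AE_circle_iff:
  assumes [measurable]: "Measurable.pred circle P"
  shows "(AE t in circle. P t) \<longleftrightarrow> (AE x in lborel. x \<in> {0..2*pi} \<longrightarrow> P (cis x))"
proof -
  have P: "{x \<in> space circle. P x} \<in> sets circle" by measurable
  then have "{x \<in> space (restrict_space borel (sphere 0 1)). P x}
      \<in> sets (restrict_space borel (sphere 0 (1::real) :: complex set))"
    by (simp add: space_circle space_restrict_space)
  then have "(AE t in circle. P t) \<longleftrightarrow> (AE x in uniform_measure lborel {0..2*pi}. P (cis x))"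
    unfolding circle_def by (intro AE_distr_iff) auto
  also have "\<dots> \<longleftrightarrow> (AE x in lborel. x \<in> {0..2*pi} \<longrightarrow> P (cis x))"
    by (rule AE_uniform_measure) auto
  finally show ?thesis .
qed

lemma inverse_measurable_circle [measurable]: "inverse \<in> measurable circle circle"
proof -
  have "(inverse :: complex \<Rightarrow> complex) \<in> measurable (restrict_space borel (sphere 0 1))
          (restrict_space borel (sphere 0 1))"
    by (intro measurable_restrict_space3) (auto simp: norm_inverse)
  then show ?thesis
    by (simp cong: measurable_cong_sets)
qed

lemma AE_circle_inverse:
  assumes "AE t in circle. P t"
  shows "AE t in circle. P (inverse t)"
proof -
  obtain N where N: "N \<in> sets circle" "emeasure circle N = 0" "{t \<in> space circle. \<not> P t} \<subseteq> N"
    using assms by (auto elim: AE_E)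
  note N(1)[measurable]
  have m: "Measurable.pred circle (\<lambda>t. t \<notin> N)" by measurable
  have m': "Measurable.pred circle (\<lambda>t. inverse t \<notin> N)"
    by (rule measurable_compose[OF inverse_measurable_circle m])
  have "AE t in circle. t \<notin> N"
    using N by (intro AE_not_in) auto
  then have "AE x in lborel. x \<in> {0..2*pi} \<longrightarrow> cis x \<notin> N"
    by (simp add: AE_circle_iff[OF m])
  then have "AE x in lborel. 2*pi + (-1) * x \<in> {0..2*pi} \<longrightarrow> cis (2*pi + (-1) * x) \<notin> N"
  proof (rule AE_borel_affine[rotated 2])
    have "Measurable.pred lborel (\<lambda>x. cis x \<notin> N)"
      by (rule measurable_compose[OF _ m]) (simp cong: measurable_cong_sets)
    then show "Measurable.pred borel (\<lambda>x. x \<in> {0..2*pi} \<longrightarrow> cis x \<notin> N)" by simp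
  qed simp
  moreover have "cis (2*pi + (-1) * x) = inverse (cis x)" for x
    using cis_divide[of "2*pi" x] by (simp add: divide_inverse)
  ultimately have "AE x in lborel. x \<in> {0..2*pi} \<longrightarrow> inverse (cis x) \<notin> N"
    by (auto elim!: eventually_mono)
  then have "AE t in circle. inverse t \<notin> N"
    by (simp add: AE_circle_iff[OF m'])
  moreover have "AE t in circle. inverse t \<in> space circle"
    by (rule AE_I2) (auto simp: space_circle norm_inverse)
  ultimately show ?thesis
    using N(3) by (auto elim!: eventually_elim2)
qed

definition circle_ae_eq :: "(complex \<Rightarrow> complex) \<Rightarrow> (complex \<Rightarrow> complex) \<Rightarrow> bool" where
  "circle_ae_eq f g \<longleftrightarrow>
     f \<in> borel_measurable circle \<and> g \<in> borel_measurable circle \<and> (AE t in circle. f t = g t)"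

quotient_type circle_fun = "complex \<Rightarrow> complex" / partial: circle_ae_eq
proof (rule part_equivpI)
  show "\<exists>f. circle_ae_eq f f"
    by (rule exI[of _ "\<lambda>_. 0"]) (simp add: circle_ae_eq_def)
  show "symp circle_ae_eq"
    by (auto simp: symp_def circle_ae_eq_def elim!: eventually_mono)
  show "transp circle_ae_eq"
    unfolding transp_def circle_ae_eq_def by (auto elim!: eventually_elim2)
qed

text \<open>The inverse is taken pointwise, with \<open>inverse 0 = 0\<close>; it is a multiplicative inverse
  of \<open>f\<close> exactly when \<open>f\<close> is nonzero almost everywhere.\<close>

instantiation circle_fun :: "{comm_ring_1, inverse}"
begin

lift_definition zero_circle_fun :: circle_fun is "\<lambda>_. 0"
  by (simp add: circle_ae_eq_def)
lift_definition one_circle_fun :: circle_fun is "\<lambda>_. 1"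
  by (simp add: circle_ae_eq_def)
lift_definition plus_circle_fun :: "circle_fun \<Rightarrow> circle_fun \<Rightarrow> circle_fun" is "\<lambda>f g t. f t + g t"
  by (auto simp: circle_ae_eq_def elim!: eventually_elim2)
lift_definition minus_circle_fun :: "circle_fun \<Rightarrow> circle_fun \<Rightarrow> circle_fun" is "\<lambda>f g t. f t - g t"
  by (auto simp: circle_ae_eq_def elim!: eventually_elim2)
lift_definition uminus_circle_fun :: "circle_fun \<Rightarrow> circle_fun" is "\<lambda>f t. - f t"
  by (auto simp: circle_ae_eq_def elim!: eventually_mono)
lift_definition times_circle_fun :: "circle_fun \<Rightarrow> circle_fun \<Rightarrow> circle_fun" is "\<lambda>f g t. f t * g t"
  by (auto simp: circle_ae_eq_def elim!: eventually_elim2)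
lift_definition inverse_circle_fun :: "circle_fun \<Rightarrow> circle_fun" is "\<lambda>f t. inverse (f t)"
  by (auto simp: circle_ae_eq_def elim!: eventually_mono)
lift_definition divide_circle_fun :: "circle_fun \<Rightarrow> circle_fun \<Rightarrow> circle_fun" is "\<lambda>f g t. f t / g t"
  by (auto simp: circle_ae_eq_def elim!: eventually_elim2)

instance
proof
  show "(0::circle_fun) \<noteq> 1"
    by transfer (simp add: circle_ae_eq_def prob_space.AE_False[OF prob_space_circle])
qed (transfer; auto simp: circle_ae_eq_def algebra_simps)+

end

lift_definition smult_circle_fun :: "complex \<Rightarrow> circle_fun \<Rightarrow> circle_fun" (infixr "*\<^sub>C" 75)
  is "\<lambda>z f t. z * f t"
  by (auto simp: circle_ae_eq_def elim!: eventually_mono)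

global_interpretation circle_fun: vector_space smult_circle_fun
  defines circle_span = circle_fun.span
  by standard (transfer; auto simp: circle_ae_eq_def algebra_simps)+

text \<open>The coordinate function \<open>t\<close>.\<close>

lift_definition tvar :: circle_fun is "\<lambda>t. t"
proof -
  have "(\<lambda>t::complex. t) \<in> borel_measurable circle"
    by (simp cong: measurable_cong_sets add: measurable_restrict_space1)
  then show "circle_ae_eq (\<lambda>t. t) (\<lambda>t. t)" by (simp add: circle_ae_eq_def)
qed

text \<open>\<open>tilde f t = f (1/t)\<close>\<close>

lift_definition tilde :: "circle_fun \<Rightarrow> circle_fun" is "\<lambda>f t. f (inverse t)"
  unfolding circle_ae_eq_def
  by (elim conjE, intro conjI measurable_compose[OF inverse_measurable_circle] AE_circle_inverse)

lift_definition fourier_coeff :: "circle_fun \<Rightarrow> int \<Rightarrow> complex"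
  is "\<lambda>f n. 1 / (2*pi) *
        (LBINT \<theta>:{0..2*pi}. f (exp (\<i> * \<theta>)) * exp (- (\<i> * of_int n * \<theta>)))"
proof -
  fix f g assume fg: "circle_ae_eq f g"
  then have [measurable]: "f \<in> borel_measurable circle" "g \<in> borel_measurable circle"
    by (auto simp: circle_ae_eq_def)
  have c: "cis \<in> measurable lborel circle"
    by (simp cong: measurable_cong_sets)
  have [measurable]: "(\<lambda>x. f (cis x)) \<in> borel_measurable lborel" "(\<lambda>x. g (cis x)) \<in> borel_measurable lborel"
    by (auto intro: measurable_compose[OF c])
  have "AE x in lborel. x \<in> {0..2*pi} \<longrightarrow> f (cis x) = g (cis x)"
    using fg by (subst AE_circle_iff[symmetric]) (auto simp: circle_ae_eq_def)
  moreover have "(\<lambda>x. exp (- (\<i> * of_int n * complex_of_real x))) \<in> borel_measurable borel" for n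
    by (intro borel_measurable_continuous_onI continuous_intros)
  ultimately show "(\<lambda>n. 1 / (2*pi) *
        (LBINT \<theta>:{0..2*pi}. f (exp (\<i> * \<theta>)) * exp (- (\<i> * of_int n * \<theta>)))) =
     (\<lambda>n. 1 / (2*pi) *
        (LBINT \<theta>:{0..2*pi}. g (exp (\<i> * \<theta>)) * exp (- (\<i> * of_int n * \<theta>))))"
    by (intro ext arg_cong2[where f = "(*)"] refl set_lebesgue_integral_cong_AE)
       (auto simp: cis_conv_exp[symmetric] elim!: eventually_mono)
qed


section \<open>Lebesgue and Hardy spaces\<close>

lift_definition in_Lp :: "real \<Rightarrow> circle_fun \<Rightarrow> bool"
  is "\<lambda>p f. integrable circle (\<lambda>t. norm (f t) powr p)"
proof (intro integrable_cong_AE)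
  fix p :: real and f g :: "complex \<Rightarrow> complex"
  assume "circle_ae_eq f g"
  then show "(\<lambda>t. norm (f t) powr p) \<in> borel_measurable circle"
    "(\<lambda>t. norm (g t) powr p) \<in> borel_measurable circle"
    "AE t in circle. norm (f t) powr p = norm (g t) powr p"
    by (auto simp: circle_ae_eq_def elim!: eventually_mono)
qed

definition Lp :: "real \<Rightarrow> circle_fun set" where
  "Lp p = {f. in_Lp p f}"

lift_definition Lp_norm :: "real \<Rightarrow> circle_fun \<Rightarrow> real"
  is "\<lambda>p f. (LINT t|circle. norm (f t) powr p) powr (1/p)"
proof (intro arg_cong2[where f = "(powr)"] refl integral_cong_AE)
  fix p :: real and f g :: "complex \<Rightarrow> complex"
  assume "circle_ae_eq f g"
  then show "(\<lambda>t. norm (f t) powr p) \<in> borel_measurable circle"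
    "(\<lambda>t. norm (g t) powr p) \<in> borel_measurable circle"
    "AE t in circle. norm (f t) powr p = norm (g t) powr p"
    by (auto simp: circle_ae_eq_def elim!: eventually_mono)
qed

lift_definition essentially_bounded :: "circle_fun \<Rightarrow> bool"
  is "\<lambda>f. \<exists>K. AE t in circle. norm (f t) \<le> K"
  by (intro ex_cong1 eventually_cong) (auto simp: circle_ae_eq_def)

definition Linf :: "circle_fun set" where
  "Linf = {f. essentially_bounded f}"

definition GLinf :: "circle_fun set" where
  "GLinf = {a \<in> Linf. \<exists>b\<in>Linf. a * b = 1}"

definition Hp :: "real \<Rightarrow> circle_fun set" where
  "Hp p = {f \<in> Lp p. \<forall>n<0. fourier_coeff f n = 0}"


section \<open>Toeplitz and Hankel operators\<close>

text \<open>The Riesz projection of \<open>\<Sum>n\<in>\<int>. f\<^sub>n t\<^sup>n\<close> is \<open>\<Sum>n\<ge>0. f\<^sub>n t\<^sup>n\<close>. The description determines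
  it uniquely for \<open>1 < p < \<infinity>\<close> and \<open>f \<in> Lp p\<close>; elsewhere its value carries no meaning.\<close>

definition riesz_proj :: "real \<Rightarrow> circle_fun \<Rightarrow> circle_fun" where
  "riesz_proj p f = (THE g. g \<in> Hp p \<and> (\<forall>n\<ge>0. fourier_coeff g n = fourier_coeff f n))"

definition flip :: "circle_fun \<Rightarrow> circle_fun" where
  "flip f = inverse tvar * tilde f"

definition toeplitz :: "real \<Rightarrow> circle_fun \<Rightarrow> circle_fun \<Rightarrow> circle_fun" where
  "toeplitz p a f = riesz_proj p (a * f)"

definition hankel :: "real \<Rightarrow> circle_fun \<Rightarrow> circle_fun \<Rightarrow> circle_fun" where
  "hankel p b f = riesz_proj p (b * flip f)"


section \<open>Bounded, Fredholm and invertible operators\<close>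

text \<open>Operators act on a subspace \<open>X\<close> normed by \<open>N\<close>; their values outside \<open>X\<close> are irrelevant.\<close>

definition bounded_operator_on ::
  "circle_fun set \<Rightarrow> (circle_fun \<Rightarrow> real) \<Rightarrow> (circle_fun \<Rightarrow> circle_fun) \<Rightarrow> bool" where
  "bounded_operator_on X N A \<longleftrightarrow>
     (\<forall>f\<in>X. A f \<in> X) \<and>
     (\<forall>f\<in>X. \<forall>g\<in>X. A (f + g) = A f + A g) \<and>
     (\<forall>z. \<forall>f\<in>X. A (z *\<^sub>C f) = z *\<^sub>C A f) \<and>
     (\<exists>K. \<forall>f\<in>X. N (A f) \<le> K * N f)"

text \<open>Finite-dimensional kernel, closed range, finite-dimensional cokernel.\<close>

definition fredholm_on ::
  "circle_fun set \<Rightarrow> (circle_fun \<Rightarrow> real) \<Rightarrow> (circle_fun \<Rightarrow> circle_fun) \<Rightarrow> bool" where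
  "fredholm_on X N A \<longleftrightarrow>
     bounded_operator_on X N A \<and>
     (\<exists>B. finite B \<and> {f \<in> X. A f = 0} \<subseteq> circle_span B) \<and>
     (\<forall>g y. (\<forall>k::nat. g k \<in> A ` X) \<and> y \<in> X \<and> (\<lambda>k. N (g k - y)) \<longlonglongrightarrow> 0 \<longrightarrow> y \<in> A ` X) \<and>
     (\<exists>B. finite B \<and> B \<subseteq> X \<and> (\<forall>f\<in>X. \<exists>g \<in> A ` X. \<exists>h \<in> circle_span B. f = g + h))"

definition invertible_on ::
  "circle_fun set \<Rightarrow> (circle_fun \<Rightarrow> real) \<Rightarrow> (circle_fun \<Rightarrow> circle_fun) \<Rightarrow> bool" where
  "invertible_on X N A \<longleftrightarrow>
     bounded_operator_on X N A \<and>
     (\<exists>B. bounded_operator_on X N B \<and> (\<forall>f\<in>X. B (A f) = f \<and> A (B f) = f))"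


section \<open>The factorization conditions and the matrix\<close>

definition basic_factorization ::
  "real \<Rightarrow> real \<Rightarrow> circle_fun \<Rightarrow> circle_fun \<Rightarrow> circle_fun \<Rightarrow> circle_fun \<Rightarrow>
   int \<Rightarrow> int \<Rightarrow> circle_fun \<Rightarrow> circle_fun \<Rightarrow> bool" where
  "basic_factorization p q a b c d n m cp dp \<longleftrightarrow>
     a \<in> GLinf \<and> b \<in> GLinf \<and> a * tilde a = b * tilde b \<and>
     c = a / b \<and> c = tilde b / tilde a \<and>
     d = tilde a / b \<and> d = tilde b / a \<and>
     c = cp * tvar powi (2*n) * tilde (inverse cp) \<and>
     d = dp * tvar powi (2*m) * tilde (inverse dp) \<and>
     (1 + tvar) * cp \<in> Hp q \<and> (1 - tvar) * inverse cp \<in> Hp p \<and>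
     (1 + tvar) * dp \<in> Hp p \<and> (1 - tvar) * inverse dp \<in> Hp q"

definition rho :: "circle_fun \<Rightarrow> int \<Rightarrow> int \<Rightarrow> circle_fun \<Rightarrow> circle_fun \<Rightarrow> circle_fun" where
  "rho b n m cp dp =
     tvar powi (- m - n) * (1 + tvar) * (1 + inverse tvar) * tilde cp * tilde dp * inverse b"

definition toeplitz_hankel_mat :: "nat \<Rightarrow> circle_fun \<Rightarrow> complex mat" where
  "toeplitz_hankel_mat n r =
     Matrix.mat n n (\<lambda>(i, j). fourier_coeff r (int i - int j) + fourier_coeff r (int i + int j))"

end

theory Submission
  imports Defs "HOL-Complex_Analysis.Complex_Analysis" "Jordan_Normal_Form.Determinant"
begin

text \<open>
  Write \<open>X f = a f + b J f\<close>, so that the operator is \<open>A f = P (X f)\<close>. The relation \<open>a tilde a = b tilde b\<close>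
  gives \<open>J (X f) = d X f\<close>. Hence if \<open>A f = 0\<close>, that is \<open>X f = J h\<close> with \<open>h\<close> in the Hardy space, then
  \<open>h = d J h\<close>. The factorization of \<open>d\<close> turns this into an antisymmetry, which forces
  \<open>h = (1 + t) d\<^sub>+ t\<^sup>m\<^sup>-\<^sup>1 w\<close> with an even Laurent polynomial \<open>w\<close> of degree below \<open>m\<close>. The factorization of
  \<open>c\<close> then gives \<open>t\<^sup>n v + tilde (t\<^sup>n v) = \<rho> w\<close> for \<open>v = (1 + t) c\<^sub>+ f\<close>, and the coefficients of index
  below \<open>n\<close> form the linear system with the matrix of the theorem. The transpose of \<open>A\<close> has the same form
  with \<open>(n, c\<^sub>+)\<close> and \<open>(m, d\<^sub>+)\<close> exchanged and with the same \<open>\<rho>\<close>, so duality gives surjectivity when the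
  range is closed. Conversely, an invertible \<open>A\<close> with \<open>n, m \<ge> 0\<close> is compared with the operator with
  indices zero obtained from it by shifts.

  The Riesz projection is bounded by Calderon's positivity argument for \<open>1 < p \<le> 2\<close> and by doubling the
  exponent for larger \<open>p\<close>. Annihilators of closed subspaces come from nearest points, which exist
  by uniform convexity.
\<close>

section \<open>Lebesgue norms\<close>

text \<open>The factors \<open>cp\<close> and \<open>dp\<close> may be unbounded, so multiplication
  by them does not act on Hardy spaces. Only products of a function of exponent \<open>p\<close>
  with one of exponent \<open>q\<close> are formed; they lie in L^1, and from there on the argument
  uses their Fourier coefficients. Hence uniqueness is proved for exponent 1 and the coefficients of
  products are computed by convolution. The weights fit the parity: an odd Laurent polynomial is
  divisible by t - 1/t = - (1 - t) (1 + t) / t, so the factor 1 - t that tames 1/d_+ cancels, and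
  the factor 1 + t that tames d_+ remains. The kernel of the operator leads to n equations in m
  unknowns, the kernel of its transpose to m equations in n unknowns with the same \<rho>. For n = m
  this is one square system, so one condition settles injectivity and surjectivity together. The
  obstacle in the converse is that a solution of the system must produce a kernel function. This
  needs surjectivity of the operator with indices zero, and so its closed range; that range is a
  finite-dimensional extension of one whose closedness is inherited from the invertible
  operator.\<close>

definition Lpn :: "'a measure \<Rightarrow> real \<Rightarrow> ('a \<Rightarrow> complex) \<Rightarrow> real" where
  "Lpn M p f = (LINT x|M. norm (f x) powr p) powr (1/p)"

lemma Lpn_nonneg: "0 \<le> Lpn M p f"
  by (simp add: Lpn_def)

lemma Lpn_le_iff:
  assumes "0 < p" "0 \<le> A"
  shows "Lpn M p f \<le> A \<longleftrightarrow> (LINT x|M. norm (f x) powr p) \<le> A powr p"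
proof -
  have 0: "0 \<le> (LINT x|M. norm (f x) powr p)" by simp
  have "Lpn M p f \<le> A \<longleftrightarrow> Lpn M p f powr p \<le> A powr p"
    using assms Lpn_nonneg by (metis powr_less_mono2 linorder_not_less powr_mono2 less_imp_le)
  also have "Lpn M p f powr p = (LINT x|M. norm (f x) powr p)"
    using assms 0 by (simp add: Lpn_def powr_powr)
  finally show ?thesis .
qed

lemma Lpn_powr: "0 < p \<Longrightarrow> Lpn M p f powr p = (LINT x|M. norm (f x) powr p)"
  by (simp add: Lpn_def powr_powr)

lemma powr_add_le:
  fixes a b :: real
  assumes "0 \<le> a" "0 \<le> b" "0 < p"
  shows "(a + b) powr p \<le> 2 powr p * (a powr p + b powr p)"
proof -
  have "(a + b) powr p \<le> (2 * max a b) powr p"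
    using assms by (intro powr_mono2) auto
  also have "\<dots> = 2 powr p * max a b powr p"
    using assms by (simp add: powr_mult)
  also have "\<dots> \<le> 2 powr p * (a powr p + b powr p)"
    by (intro mult_left_mono) (auto simp: max_def)
  finally show ?thesis .
qed

lemma integrable_powr_add:
  fixes f g :: "'a \<Rightarrow> complex"
  assumes [measurable]: "f \<in> borel_measurable M" "g \<in> borel_measurable M" and "0 < p"
    and "integrable M (\<lambda>x. norm (f x) powr p)" "integrable M (\<lambda>x. norm (g x) powr p)"
  shows "integrable M (\<lambda>x. norm (f x + g x) powr p)"
proof (rule Bochner_Integration.integrable_bound)
  show "integrable M (\<lambda>x. 2 powr p * (norm (f x) powr p + norm (g x) powr p))"
    using assms by auto
  have "norm (f x + g x) powr p \<le> 2 powr p * (norm (f x) powr p + norm (g x) powr p)" for x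
  proof -
    have "norm (f x + g x) powr p \<le> (norm (f x) + norm (g x)) powr p"
      using \<open>0 < p\<close> by (intro powr_mono2 norm_triangle_ineq) auto
    also have "\<dots> \<le> 2 powr p * (norm (f x) powr p + norm (g x) powr p)"
      using \<open>0 < p\<close> by (intro powr_add_le) auto
    finally show ?thesis .
  qed
  then show "AE x in M. norm (norm (f x + g x) powr p)
      \<le> norm (2 powr p * (norm (f x) powr p + norm (g x) powr p))"
    by (intro AE_I2) (auto simp: abs_of_nonneg)
qed measurable

section \<open>Conjugate exponents, Hoelder's and Minkowski's inequalities\<close>

lemma conjugate_exponent:
  fixes p q :: real
  assumes "1 < p" "1/p + 1/q = 1"
  shows "1 < q" "p + q = p * q" "(p - 1) * q = p"
proof -
  have "q \<noteq> 0" using assms by auto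
  show e: "p + q = p * q" using assms \<open>q \<noteq> 0\<close> by (auto simp: field_simps)
  then show "(p - 1) * q = p" by (simp add: algebra_simps)
  have "(p - 1) * (q - 1) = 1" using e by (simp add: algebra_simps)
  then show "1 < q" using assms(1) zero_less_mult_iff[of "p - 1" "q - 1"] by simp
qed

text \<open>The free scales \<open>A\<close> and \<open>B\<close> take the place of the two norms in
  Hoelder's inequality. They are chosen strictly above the norms and then lowered to them, so a
  vanishing norm needs no case of its own.\<close>

lemma young_weighted:
  fixes a b :: real
  assumes "1 < p" "1/p + 1/q = 1" "0 \<le> a" "0 \<le> b" "0 < A" "0 < B"
  shows "a * b \<le> A * B * (a powr p / A powr p / p + b powr q / B powr q / q)"
proof -
  have q: "1 < q" by (rule conjugate_exponent[OF assms(1,2)])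
  have "(a/A) * (b/B) \<le> (a/A) powr p / p + (b/B) powr q / q"
    using assms q by (intro Youngs_inequality) auto
  then have "A * B * ((a/A) * (b/B)) \<le> A * B * ((a/A) powr p / p + (b/B) powr q / q)"
    using assms by (intro mult_left_mono) auto
  then show ?thesis using assms by (simp add: powr_divide)
qed

lemma Holder:
  fixes f g :: "'a \<Rightarrow> complex"
  assumes [measurable]: "f \<in> borel_measurable M" "g \<in> borel_measurable M"
    and p: "1 < p" "1/p + 1/q = 1"
    and f: "integrable M (\<lambda>x. norm (f x) powr p)" and g: "integrable M (\<lambda>x. norm (g x) powr q)"
  shows "integrable M (\<lambda>x. f x * g x)"
    and "(LINT x|M. norm (f x * g x)) \<le> Lpn M p f * Lpn M q g"
proof -
  note q = conjugate_exponent[OF p]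
  have bd: "norm (f x * g x) \<le>
      A * B * (norm (f x) powr p / A powr p / p + norm (g x) powr q / B powr q / q)"
    if "0 < A" "0 < B" for A B x
    unfolding norm_mult using p that by (intro young_weighted) auto
  have int: "integrable M (\<lambda>x. A * B * (norm (f x) powr p / A powr p / p + norm (g x) powr q / B powr q / q))" for A B
    using f g by auto
  show 1: "integrable M (\<lambda>x. f x * g x)"
  proof (rule Bochner_Integration.integrable_bound[OF int])
    show "AE x in M. norm (f x * g x) \<le> norm (1 * 1 * (norm (f x) powr p / 1 powr p / p + norm (g x) powr q / 1 powr q / q))"
      using bd[of 1 1] by (intro AE_I2) (auto intro: order_trans[OF _ abs_ge_self])
  qed measurable
  have le: "(LINT x|M. norm (f x * g x)) \<le> A * B" if A: "Lpn M p f < A" and B: "Lpn M q g < B" for A B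
  proof -
    have AB: "0 < A" "0 < B" using A B Lpn_nonneg[of M p f] Lpn_nonneg[of M q g] by linarith+
    have "(LINT x|M. norm (f x * g x)) \<le>
       (LINT x|M. A * B * (norm (f x) powr p / A powr p / p + norm (g x) powr q / B powr q / q))"
      using AB by (intro integral_mono bd integrable_norm 1 int)
    also have "\<dots> = A * B * ((LINT x|M. norm (f x) powr p) / A powr p / p + (LINT x|M. norm (g x) powr q) / B powr q / q)"
      using f g by simp
    also have "\<dots> \<le> A * B * (1 / p + 1 / q)"
    proof (intro mult_left_mono add_mono divide_right_mono)
      show "(LINT x|M. norm (f x) powr p) / A powr p \<le> 1"
        using Lpn_le_iff[of p A M f] A AB p by simp
      show "(LINT x|M. norm (g x) powr q) / B powr q \<le> 1"
        using Lpn_le_iff[of q B M g] B AB q by simp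
    qed (use p q AB in auto)
    finally show ?thesis using p by simp
  qed
  have "((\<lambda>e. (Lpn M p f + e) * (Lpn M q g + e)) \<longlongrightarrow> Lpn M p f * Lpn M q g) (at_right 0)"
    by (auto intro!: tendsto_eq_intros)
  then show "(LINT x|M. norm (f x * g x)) \<le> Lpn M p f * Lpn M q g"
    by (rule tendsto_lowerbound[OF _ eventually_at_rightI[of 0 1]])
       (rule le, simp_all)
qed

text \<open>Convexity of the power at (x + y)/(A + B), the mean of x/A and y/B with weights A/(A+B)
  and B/(A+B). Integrated with \<open>A\<close> and \<open>B\<close> slightly above the two norms it
  gives Minkowski's inequality.\<close>

lemma powr_convex_combination:
  fixes x y :: real
  assumes "1 \<le> p" "0 \<le> x" "0 \<le> y" "0 < A" "0 < B"
  shows "(x + y) powr p \<le> (A + B) powr p * (A/(A+B) * (x powr p / A powr p) + B/(A+B) * (y powr p / B powr p))"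
proof -
  have c: "(s * a + t * b) powr p \<le> s * a powr p + t * b powr p"
    if st: "s > 0" "t > 0" "s + t = 1" and ab: "a \<ge> 0" "b \<ge> 0" for s t a b :: real
  proof (cases "a = 0 \<or> b = 0")
    case False
    then show ?thesis
      using convex_onD[OF powr_convex[OF assms(1)], of t a b] that
      by (simp add: eq_diff_eq[symmetric])
  next
    \<comment> \<open>At the endpoint 0 convexity reduces to \<open>s powr p \<le> s\<close> for
      weights \<open>s \<le> 1\<close>.\<close>
    case True
    have le: "(s * a) powr p \<le> s * a powr p" if "0 < s" "s \<le> 1" "0 \<le> a" for s a :: real
    proof -
      have "s powr p \<le> s powr 1" using that assms by (intro powr_mono') auto
      then show ?thesis using that by (auto simp: powr_mult intro!: mult_right_mono)
    qed
    show ?thesis using True le[of s a] le[of t b] st ab assms by auto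
  qed
  have "(A + B) * (A/(A+B) * (x / A) + B/(A+B) * (y/B)) = x + y"
  proof -
    have "A/(A+B) * (x/A) = x/(A+B)" "B/(A+B) * (y/B) = y/(A+B)" "A + B \<noteq> 0" using assms by auto
    then have "(A + B) * (A/(A+B) * (x / A) + B/(A+B) * (y/B)) = (A + B) * (x/(A+B) + y/(A+B))" by metis
    also have "\<dots> = x + y" using \<open>A + B \<noteq> 0\<close> by (simp add: distrib_left)
    finally show ?thesis .
  qed
  then have "(x + y) powr p = ((A + B) * (A/(A+B) * (x / A) + B/(A+B) * (y/B))) powr p"
    by simp
  also have "\<dots> = (A + B) powr p * (A/(A+B) * (x / A) + B/(A+B) * (y/B)) powr p"
    using assms by (subst powr_mult) auto
  also have "\<dots> \<le> (A + B) powr p * (A/(A+B) * (x / A) powr p + B/(A+B) * (y/B) powr p)"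
    using assms by (intro mult_left_mono c) (auto simp: add_divide_distrib[symmetric])
  finally show ?thesis using assms by (simp add: powr_divide)
qed

lemma Minkowski:
  fixes f g :: "'a \<Rightarrow> complex"
  assumes [measurable]: "f \<in> borel_measurable M" "g \<in> borel_measurable M"
    and p: "1 \<le> p"
    and f: "integrable M (\<lambda>x. norm (f x) powr p)" and g: "integrable M (\<lambda>x. norm (g x) powr p)"
  shows "Lpn M p (\<lambda>x. f x + g x) \<le> Lpn M p f + Lpn M p g"
proof -
  have int: "integrable M (\<lambda>x. norm (f x + g x) powr p)"
    using assms by (intro integrable_powr_add) auto
  have le: "Lpn M p (\<lambda>x. f x + g x) \<le> A + B" if A: "Lpn M p f < A" and B: "Lpn M p g < B" for A B
  proof -
    have AB: "0 < A" "0 < B" using A B Lpn_nonneg[of M p f] Lpn_nonneg[of M p g] by linarith+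
    have "(LINT x|M. norm (f x + g x) powr p) \<le>
       (LINT x|M. (A + B) powr p * (A/(A+B) * (norm (f x) powr p / A powr p) + B/(A+B) * (norm (g x) powr p / B powr p)))"
    proof (intro integral_mono int)
      fix x
      have "norm (f x + g x) powr p \<le> (norm (f x) + norm (g x)) powr p"
        using p by (intro powr_mono2 norm_triangle_ineq) auto
      also have "\<dots> \<le> (A + B) powr p * (A/(A+B) * (norm (f x) powr p / A powr p) + B/(A+B) * (norm (g x) powr p / B powr p))"
        using p AB by (intro powr_convex_combination) auto
      finally show "norm (f x + g x) powr p \<le> \<dots>" .
    qed (use f g in auto)
    also have "\<dots> = (A + B) powr p * (A/(A+B) * ((LINT x|M. norm (f x) powr p) / A powr p) + B/(A+B) * ((LINT x|M. norm (g x) powr p) / B powr p))"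
      using f g by simp
    also have "\<dots> \<le> (A + B) powr p * (A/(A+B) * 1 + B/(A+B) * 1)"
    proof (intro mult_left_mono add_mono)
      show "(LINT x|M. norm (f x) powr p) / A powr p \<le> 1"
        using Lpn_le_iff[of p A M f] A AB p by simp
      show "(LINT x|M. norm (g x) powr p) / B powr p \<le> 1"
        using Lpn_le_iff[of p B M g] B AB p by simp
    qed (use AB in auto)
    also have "\<dots> = (A + B) powr p"
      using AB by (simp add: add_divide_distrib[symmetric])
    finally show ?thesis using AB p by (subst Lpn_le_iff) auto
  qed
  have "((\<lambda>e. (Lpn M p f + e) + (Lpn M p g + e)) \<longlongrightarrow> Lpn M p f + Lpn M p g) (at_right 0)"
    by (auto intro!: tendsto_eq_intros)
  then show ?thesis
    by (rule tendsto_lowerbound[OF _ eventually_at_rightI[of 0 1]])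
       (rule le, simp_all)
qed

section \<open>Elementary properties and completeness of the norms\<close>

lemma Lpn_eq_0_iff:
  assumes [measurable]: "f \<in> borel_measurable M" and "0 < p" "integrable M (\<lambda>x. norm (f x) powr p)"
  shows "Lpn M p f = 0 \<longleftrightarrow> (AE x in M. f x = 0)"
  using assms integral_nonneg_eq_0_iff_AE[OF assms(3)] by (simp add: Lpn_def)

lemma Lpn_cmult: "0 < p \<Longrightarrow> Lpn M p (\<lambda>x. z * f x) = norm z * Lpn M p f"
  by (simp add: Lpn_def norm_mult powr_mult powr_powr)

lemma Lpn_mono:
  assumes "0 < p" "integrable M (\<lambda>x. norm (g x) powr p)" "f \<in> borel_measurable M"
    "AE x in M. norm (f x) \<le> norm (g x)"
  shows "integrable M (\<lambda>x. norm (f x) powr p)" and "Lpn M p f \<le> Lpn M p g"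
proof -
  have ae: "AE x in M. norm (f x) powr p \<le> norm (g x) powr p"
    using assms(4) by eventually_elim (use assms in \<open>auto intro: powr_mono2\<close>)
  show i: "integrable M (\<lambda>x. norm (f x) powr p)"
    by (rule Bochner_Integration.integrable_bound[OF assms(2)]) (use assms(3) ae in auto)
  show "Lpn M p f \<le> Lpn M p g" unfolding Lpn_def
    using assms(1) by (intro powr_mono2 integral_mono_AE i assms(2) ae) auto
qed

lemma (in prob_space) Lpn_1_le:
  fixes f :: "'a \<Rightarrow> complex"
  assumes [measurable]: "f \<in> borel_measurable M" and p: "1 < p" "integrable M (\<lambda>x. norm (f x) powr p)"
  shows "integrable M f" "(LINT x|M. norm (f x)) \<le> Lpn M p f"
proof -
  have q: "1/p + 1/(p/(p-1)) = 1" using p by (simp add: field_simps)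
  show "integrable M f" "(LINT x|M. norm (f x)) \<le> Lpn M p f"
    using Holder[OF assms(1) borel_measurable_const[of 1] p(1) q p(2)] by (auto simp: Lpn_def prob_space)
qed

text \<open>Riesz-Fischer: along a subsequence with increments below (1/2)^k the increments are
  absolutely summable almost everywhere, because on a probability space the L^1 norm is below the
  L^p norm. Fatou's lemma carries the Cauchy estimate over to the pointwise limit.\<close>

lemma (in prob_space) Lpn_complete:
  fixes F :: "nat \<Rightarrow> 'a \<Rightarrow> complex"
  assumes F[measurable]: "\<And>n. F n \<in> borel_measurable M"
    and p: "1 < p" and i: "\<And>n. integrable M (\<lambda>x. norm (F n x) powr p)"
    and C: "\<And>e. e > 0 \<Longrightarrow> \<exists>N. \<forall>m\<ge>N. \<forall>n\<ge>N. Lpn M p (\<lambda>x. F m x - F n x) < e"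
  shows "\<exists>f \<in> borel_measurable M. integrable M (\<lambda>x. norm (f x) powr p) \<and>
     (\<lambda>n. Lpn M p (\<lambda>x. F n x - f x)) \<longlonglongrightarrow> 0"
proof -
  have idiff: "integrable M (\<lambda>x. norm (F m x - F n x) powr p)" for m n
    using integrable_powr_add[of "F m" M "\<lambda>x. - F n x" p] i p by auto
  obtain N where N: "\<And>e m n. e > 0 \<Longrightarrow> m \<ge> N e \<Longrightarrow> n \<ge> N e \<Longrightarrow> Lpn M p (\<lambda>x. F m x - F n x) < e"
    using C by metis
  define r where "r = rec_nat (N 1) (\<lambda>k r. max (Suc r) (N ((1/2)^Suc k)))"
  have r_Suc: "r (Suc k) = max (Suc (r k)) (N ((1/2)^Suc k))" for k by (simp add: r_def)
  have r_ge: "r k \<ge> N ((1/2)^k)" for k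
    by (cases k) (auto simp: r_Suc, simp add: r_def)
  have r_ge': "r k \<ge> k" for k
    by (induction k) (auto simp: r_Suc)
  define D where "D k x = F (r (Suc k)) x - F (r k) x" for k x
  have D[measurable]: "D k \<in> borel_measurable M" for k unfolding D_def by measurable
  have DL: "Lpn M p (D k) < (1/2)^k" for k
    unfolding D_def using r_ge[of k] r_Suc[of k] by (intro N) auto
  have D1: "(LINT x|M. norm (D k x)) \<le> (1/2)^k" "integrable M (D k)" for k
    using Lpn_1_le[of "D k" p] p DL[of k] idiff by (auto simp: D_def)
  have "(\<integral>\<^sup>+x. (\<Sum>k. ennreal (norm (D k x))) \<partial>M) = (\<Sum>k. \<integral>\<^sup>+x. ennreal (norm (D k x)) \<partial>M)"
    by (rule nn_integral_suminf) auto
  also have "\<dots> \<le> (\<Sum>k. ennreal ((1/2)^k))"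
    using D1 by (intro suminf_le) (auto simp: nn_integral_eq_integral)
  also have "\<dots> = ennreal (\<Sum>k. (1/2)^k)"
    by (rule suminf_ennreal2) auto
  also have "\<dots> < \<infinity>" by simp
  finally have "AE x in M. (\<Sum>k. ennreal (norm (D k x))) \<noteq> \<infinity>"
    by (intro nn_integral_PInf_AE) auto
  then have ae: "AE x in M. convergent (\<lambda>k. F (r k) x)"
  proof eventually_elim
    case (elim x)
    then have "summable (\<lambda>k. norm (D k x))"
      by (intro summable_suminf_not_top) auto
    then have "summable (\<lambda>k. D k x)" by (rule summable_norm_cancel)
    then have "convergent (\<lambda>n. \<Sum>k<n. D k x)" by (simp add: summable_iff_convergent)
    then have "convergent (\<lambda>n. F (r n) x - F (r 0) x)" by (simp add: D_def sum_lessThan_telescope[of "\<lambda>k. F (r k) x"])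
    then have "convergent (\<lambda>n. F (r n) x - F (r 0) x + F (r 0) x)"
      by (rule convergent_add) (rule convergent_const)
    then show ?case by simp
  qed
  define f where "f x = lim (\<lambda>k. F (r k) x)" for x
  have f[measurable]: "f \<in> borel_measurable M" unfolding f_def by measurable
  have key: "integrable M (\<lambda>x. norm (F n x - f x) powr p) \<and> Lpn M p (\<lambda>x. F n x - f x) \<le> e"
    if e: "e > 0" and n: "n \<ge> N e" for e n
  proof -
    have "(\<integral>\<^sup>+x. ennreal (norm (F n x - f x) powr p) \<partial>M)
       = (\<integral>\<^sup>+x. liminf (\<lambda>k. ennreal (norm (F n x - F (r k) x) powr p)) \<partial>M)"
    proof (rule nn_integral_cong_AE)
      from ae show "AE x in M. ennreal (norm (F n x - f x) powr p) = liminf (\<lambda>k. ennreal (norm (F n x - F (r k) x) powr p))"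
      proof eventually_elim
        case (elim x)
        then have "(\<lambda>k. F (r k) x) \<longlonglongrightarrow> f x" by (simp add: f_def convergent_LIMSEQ_iff)
        then have "(\<lambda>k. ennreal (norm (F n x - F (r k) x) powr p)) \<longlonglongrightarrow> ennreal (norm (F n x - f x) powr p)"
          using p by (intro tendsto_intros tendsto_powr2) auto
        then show ?case by (rule lim_imp_Liminf[OF sequentially_bot, symmetric])
      qed
    qed
    also have "\<dots> \<le> liminf (\<lambda>k. \<integral>\<^sup>+x. ennreal (norm (F n x - F (r k) x) powr p) \<partial>M)"
      by (rule nn_integral_liminf) auto
    also have "\<dots> \<le> ennreal (e powr p)"
    proof (rule Liminf_le)
      show "\<forall>\<^sub>F k in sequentially. (\<integral>\<^sup>+x. ennreal (norm (F n x - F (r k) x) powr p) \<partial>M) \<le> ennreal (e powr p)"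
      proof (rule eventually_mono)
        show "\<forall>\<^sub>F k in sequentially. k \<ge> N e" by (rule eventually_ge_at_top)
        fix k assume "k \<ge> N e"
        then have "Lpn M p (\<lambda>x. F n x - F (r k) x) \<le> e"
          using N[of e n "r k"] e n r_ge'[of k] by auto
        then show "(\<integral>\<^sup>+x. ennreal (norm (F n x - F (r k) x) powr p) \<partial>M) \<le> ennreal (e powr p)"
          using p e idiff by (subst nn_integral_eq_integral) (auto simp: Lpn_le_iff)
      qed
    qed simp
    finally have le: "(\<integral>\<^sup>+x. ennreal (norm (F n x - f x) powr p) \<partial>M) \<le> ennreal (e powr p)" .
    have int: "integrable M (\<lambda>x. norm (F n x - f x) powr p)"
      using le by (intro integrableI_bounded) (auto simp: le_less_trans)
    moreover have "Lpn M p (\<lambda>x. F n x - f x) \<le> e"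
      using le e p int by (subst Lpn_le_iff) (auto simp: nn_integral_eq_integral)
    ultimately show ?thesis by simp
  qed
  have "integrable M (\<lambda>x. norm (F (N 1) x + (f x - F (N 1) x)) powr p)"
    using key[of 1 "N 1"] p by (intro integrable_powr_add i) (auto simp: norm_minus_commute)
  moreover have "(\<lambda>n. Lpn M p (\<lambda>x. F n x - f x)) \<longlonglongrightarrow> 0"
  proof (rule LIMSEQ_I)
    fix e :: real assume "0 < e"
    then have "norm (Lpn M p (\<lambda>x. F n x - f x) - 0) < e" if "n \<ge> N (e/2)" for n
      using key[of "e/2" n] that Lpn_nonneg[of M p "\<lambda>x. F n x - f x"] by simp
    then show "\<exists>no. \<forall>n\<ge>no. norm (Lpn M p (\<lambda>x. F n x - f x) - 0) < e"
      by blast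
  qed
  ultimately show ?thesis using f by auto
qed

text \<open>The real differential of |z|^p at \<open>z\<close> is w \<mapsto>
  \<open>p * Re (dual_powr p z * w)\<close>. Applied pointwise this is, up to normalisation, the
  duality map from L^p to L^q.\<close>

definition dual_powr :: "real \<Rightarrow> complex \<Rightarrow> complex" where
  "dual_powr p z = of_real (norm z powr (p - 2)) * cnj z"

lemma norm_dual_powr: "norm (dual_powr p z) = norm z powr (p - 1)"
proof (cases "z = 0")
  case False
  then have "norm z powr (p - 1) = norm z powr (p - 2) * norm z powr 1"
    unfolding powr_add[symmetric] by simp
  then show ?thesis using False by (simp add: dual_powr_def norm_mult)
qed (simp add: dual_powr_def)

lemma dual_powr_mult: "dual_powr p z * z = of_real (norm z powr p)"
proof (cases "z = 0")
  case False
  have "dual_powr p z * z = of_real (norm z powr (p - 2)) * (z * cnj z)"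
    by (simp only: dual_powr_def mult.assoc mult.commute[of z])
  also have "\<dots> = of_real (norm z powr (p - 2) * (norm z)^2)"
    by (simp add: complex_norm_square[symmetric])
  also have "(norm z)^2 = norm z powr 2" using False by simp
  also have "norm z powr (p - 2) * norm z powr 2 = norm z powr p"
    unfolding powr_add[symmetric] by simp
  finally show ?thesis .
qed (simp add: dual_powr_def)

text \<open>The graph of \<open>z \<mapsto> |z|\<^sup>p\<close> lies above its tangent plane at \<open>z\<close>.\<close>

lemma powr_tangent:
  assumes "1 < p"
  shows "p * Re (dual_powr p z * (w - z)) \<le> norm w powr p - norm z powr p"
proof -
  define q where "q = p / (p - 1)"
  have pq: "1/p + 1/q = 1" using assms by (simp add: q_def field_simps)
  note q = conjugate_exponent[OF assms pq]
  have "Re (dual_powr p z * w) \<le> norm w * norm z powr (p - 1)"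
    using complex_Re_le_cmod[of "dual_powr p z * w"] by (simp add: norm_mult norm_dual_powr mult.commute)
  also have "\<dots> \<le> norm w powr p / p + (norm z powr (p - 1)) powr q / q"
    using assms q pq by (intro Youngs_inequality) auto
  also have "(norm z powr (p - 1)) powr q = norm z powr p"
    by (simp add: powr_powr q)
  finally have "p * Re (dual_powr p z * w) \<le> p * (norm w powr p / p + norm z powr p / q)"
    using assms by (intro mult_left_mono) auto
  also have "\<dots> = norm w powr p + (p - 1) * norm z powr p"
    using assms by (simp add: q_def field_simps)
  finally show ?thesis
    by (simp only: right_diff_distrib dual_powr_mult minus_complex.sel Re_complex_of_real) (simp add: algebra_simps)
qed

text \<open>The mean value theorem on the two halves of the interval, together with strict growth of
  the derivative \<open>p * u powr (p-1)\<close>.\<close>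

lemma powr_midpoint_strict:
  fixes x y :: real
  assumes "1 < p" "0 \<le> x" "x < y"
  shows "((x + y) / 2) powr p < (x powr p + y powr p) / 2"
proof -
  define m where "m = (x + y) / 2"
  have m: "x < m" "m < y" using assms by (auto simp: m_def)
  have cont: "continuous_on {a..b} (\<lambda>x::real. x powr p)" if "0 \<le> a" for a b
    using assms that by (intro continuous_on_powr' continuous_intros) auto
  have der: "((\<lambda>x. x powr p) has_derivative (*) (p * z powr (p-1))) (at z)" if "0 < z" for z :: real
    using that by (auto intro!: derivative_eq_intros simp flip: has_field_derivative_def)
  have mvt: "\<exists>u>a. u < b \<and> b powr p - a powr p = p * u powr (p-1) * (b - a)" if "0 \<le> a" "a < b" for a b :: real
  proof -
    have d: "((\<lambda>x. x powr p) has_derivative (*) (p * x powr (p-1))) (at x)" if "a < x" "x < b" for x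
      using der \<open>0 \<le> a\<close> that by auto
    obtain u where "a < u" "u < b" "b powr p - a powr p = (*) (p * u powr (p-1)) (b - a)"
      by (rule mvt[OF \<open>a < b\<close> cont[OF \<open>0 \<le> a\<close>] d])
    then show ?thesis by blast
  qed
  obtain u where u: "x < u" "u < m" "m powr p - x powr p = p * u powr (p-1) * (m - x)"
    using mvt[of x m] m assms by blast
  obtain v where v: "m < v" "v < y" "y powr p - m powr p = p * v powr (p-1) * (y - m)"
    using mvt[of m y] m assms by force
  have "u powr (p-1) < v powr (p-1)"
    using u v assms by (intro powr_less_mono2) auto
  then have "p * u powr (p-1) * (m - x) < p * v powr (p-1) * (m - x)"
    using assms m by simp
  also have "m - x = y - m" by (simp add: m_def field_simps)
  finally have "m powr p - x powr p < y powr p - m powr p" using u v \<open>m - x = y - m\<close> by simp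
  then show ?thesis by (simp add: m_def[symmetric])
qed

text \<open>Strictness has two sources: for equal moduli the parallelogram law shortens the
  midpoint, for different moduli the power is strictly convex on the real line.\<close>

lemma norm_powr_midpoint:
  fixes a b :: complex
  assumes "1 < p" "a \<noteq> b"
  shows "norm ((a + b) / 2) powr p < (norm a powr p + norm b powr p) / 2"
proof (cases "norm a = norm b")
  case True
  have "norm (a + b)^2 + norm (a - b)^2 = 4 * norm a ^2"
    using arg_cong[OF True, of "\<lambda>x. x^2"] unfolding cmod_power2 by (simp add: power2_eq_square algebra_simps)
  moreover have "norm (a - b)^2 > 0" using assms by simp
  moreover have "(2 * norm a)^2 = 4 * norm a^2" by (simp add: power2_eq_square)
  ultimately have "norm (a + b)^2 < (2 * norm a)^2" by linarith
  then have "norm (a + b) < 2 * norm a" by (rule power2_less_imp_less) simp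
  then show ?thesis using True assms
    by (simp add: norm_divide powr_less_mono2)
next
  case False
  have "norm ((a + b) / 2) powr p \<le> ((norm a + norm b) / 2) powr p"
    using assms by (intro powr_mono2) (auto simp: norm_divide norm_triangle_ineq)
  also have "\<dots> < (norm a powr p + norm b powr p) / 2"
    using powr_midpoint_strict[of p "norm a" "norm b"] powr_midpoint_strict[of p "norm b" "norm a"] False assms
    by (auto simp: add.commute neq_iff)
  finally show ?thesis .
qed

text \<open>The pointwise form of uniform convexity; the constant comes from compactness of the set
  \<open>|a|\<^sup>p + |b|\<^sup>p = 1\<close>.\<close>

lemma powr_uniformly_convex:
  fixes p e :: real
  assumes p: "1 < p" and e: "0 < e"
  shows "\<exists>C\<ge>0. \<forall>a b :: complex. norm (a - b) powr p \<le> e * (norm a powr p + norm b powr p)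
     + C * ((norm a powr p + norm b powr p) / 2 - norm ((a + b) / 2) powr p)"
proof -
  define s where "s z = norm (fst z) powr p + norm (snd z) powr p" for z :: "complex \<times> complex"
  define D where "D z = s z / 2 - norm ((fst z + snd z) / 2) powr p" for z :: "complex \<times> complex"
  define K where "K = {z. s z = 1 \<and> e \<le> norm (fst z - snd z) powr p}"
  have D0: "0 \<le> D z" for z
    using norm_powr_midpoint[OF p, of "fst z" "snd z"] by (cases "fst z = snd z") (auto simp: D_def s_def)
  have conts: "continuous_on A s" for A
    unfolding s_def using p by (intro continuous_on_powr' continuous_intros) auto
  have contd: "continuous_on A (\<lambda>z::complex \<times> complex. norm (fst z - snd z) powr p)" for A
    using p by (intro continuous_on_powr' continuous_intros) auto
  have contD: "continuous_on A D" for A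
    unfolding D_def using p by (intro continuous_on_powr' continuous_intros conts) auto
  have "bounded K"
  proof (rule boundedI)
    fix z assume "z \<in> K"
    then have "s z = 1" by (simp add: K_def)
    moreover have "norm (fst z) powr p \<le> s z" "norm (snd z) powr p \<le> s z" by (simp_all add: s_def)
    ultimately have "norm (fst z) powr p \<le> 1" "norm (snd z) powr p \<le> 1" by simp_all
    then have "norm (fst z) \<le> 1" "norm (snd z) \<le> 1"
      using p powr_less_mono2[of p 1 "norm (fst z)"] powr_less_mono2[of p 1 "norm (snd z)"]
      by (auto simp: not_le[symmetric])
    then show "norm z \<le> 1 + 1" using norm_Pair_le[of "fst z" "snd z"] by simp
  qed
  moreover have "closed K" unfolding K_def
    by (intro closed_Collect_conj closed_Collect_eq closed_Collect_le conts contd continuous_on_const)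
  ultimately have K: "compact K" by (simp add: compact_eq_bounded_closed)
  \<comment> \<open>On \<open>K\<close> the two components differ, so the midpoint defect
    \<open>D\<close> is positive there and has a positive minimum. Off \<open>K\<close>, on the unit
    level of \<open>s\<close>, the difference is already below \<open>e\<close>.\<close>
  obtain d where d: "d > 0" "\<And>z. z \<in> K \<Longrightarrow> d \<le> D z"
  proof (cases "K = {}")
    case False
    then obtain z where z: "z \<in> K" "\<And>y. y \<in> K \<Longrightarrow> D z \<le> D y"
      using continuous_attains_inf[OF K _ contD] by auto
    have "fst z \<noteq> snd z" using z e p by (auto simp: K_def)
    then have "D z > 0" using norm_powr_midpoint[OF p, of "fst z" "snd z"] by (simp add: D_def s_def)
    then show ?thesis using z that by blast
  qed (use that[of 1] in auto)
  have le: "norm (fst z - snd z) powr p \<le> 2 powr p * s z" for z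
  proof -
    have "norm (fst z - snd z) powr p \<le> (norm (fst z) + norm (snd z)) powr p"
      using p by (intro powr_mono2 norm_triangle_ineq4) auto
    also have "\<dots> \<le> 2 powr p * s z" unfolding s_def
      using p by (intro powr_add_le) auto
    finally show ?thesis .
  qed
  have 1: "norm (fst z - snd z) powr p \<le> e * s z + 2 powr p / d * D z" if "s z = 1" for z
  proof (cases "z \<in> K")
    case True
    then have "1 \<le> D z / d" using d by (simp add: field_simps)
    then have "2 powr p * 1 \<le> 2 powr p * (D z / d)" by (intro mult_left_mono) auto
    then show ?thesis using le[of z] that e by simp
  next
    case False
    then have "norm (fst z - snd z) powr p \<le> e" using that by (auto simp: K_def)
    moreover have "0 \<le> 2 powr p / d * D z" using D0[of z] d by simp
    ultimately show ?thesis using that by simp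
  qed
  have hom: "norm (complex_of_real (inverse l) * w) powr p = norm w powr p / l powr p" if "l > 0" for l w
    using that by (simp add: norm_mult norm_inverse norm_divide powr_divide flip: divide_inverse_commute)
  have 2: "norm (a - b) powr p \<le> e * s (a,b) + 2 powr p / d * D (a,b)" for a b
  proof (cases "s (a,b) = 0")
    case True
    then have "a = 0" "b = 0" by (auto simp: s_def add_nonneg_eq_0_iff)
    then show ?thesis using D0[of "(a,b)"] d True by simp
  next
    case False
    then have s: "s (a,b) > 0" by (simp add: s_def order_less_le)
    \<comment> \<open>All terms are homogeneous of degree \<open>p\<close>; dividing by
      \<open>l\<close> reduces to the level \<open>s = 1\<close>.\<close>
    define l where "l = s (a,b) powr (1/p)"
    have l: "l > 0" "l powr p = s (a,b)" using s p by (auto simp: l_def powr_powr)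
    define c where "c = complex_of_real (inverse l)"
    have sc: "s (c * a, c * b) = 1"
      unfolding s_def fst_conv snd_conv c_def hom[OF l(1)] l(2) add_divide_distrib[symmetric]
      using s by (simp add: s_def)
    have dc: "norm (c * a - c * b) powr p = norm (a - b) powr p / s (a,b)"
      unfolding right_diff_distrib[symmetric] c_def hom[OF l(1)] l(2) ..
    have "(c * a + c * b) / 2 = c * ((a + b) / 2)" by (simp add: algebra_simps)
    then have mc: "norm ((c * a + c * b) / 2) powr p = norm ((a + b) / 2) powr p / s (a,b)"
      by (simp only: c_def hom[OF l(1)] l(2))
    have "D (c * a, c * b) = D (a,b) / s (a,b)"
      unfolding D_def sc fst_conv snd_conv mc using s by (simp add: field_simps)
    then have "norm (a - b) powr p / s (a,b) \<le> e * 1 + 2 powr p / d * (D (a,b) / s (a,b))"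
      using 1[OF sc] unfolding sc fst_conv snd_conv dc by simp
    also have "\<dots> = (e * s (a,b) + 2 powr p / d * D (a,b)) / s (a,b)"
      using s by (simp add: add_divide_distrib)
    finally show ?thesis using s by (simp add: divide_le_cancel)
  qed
  show ?thesis
    by (rule exI[of _ "2 powr p / d"]) (use 2 d in \<open>auto simp: s_def D_def\<close>)
qed

section \<open>Normalised arc length\<close>

interpretation circle: prob_space circle
  by (rule prob_space_circle)

lemma AE_circle_norm: "AE t in circle. norm t = 1"
  by (rule AE_I2) (simp add: space_circle)

lemma borel_measurable_circle_continuous:
  assumes "continuous_on (sphere 0 1) f"
  shows "f \<in> borel_measurable circle"
proof -
  have "f \<in> borel_measurable (restrict_space borel (sphere 0 1))"
    using assms by (rule borel_measurable_continuous_on_restrict)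
  then show ?thesis by (simp cong: measurable_cong_sets)
qed

lemma cis_measurable [measurable]: "cis \<in> measurable lborel circle" "cis \<in> measurable borel circle"
  by (simp_all cong: measurable_cong_sets)

lemma nn_integral_circle:
  assumes [measurable]: "f \<in> borel_measurable circle"
  shows "(\<integral>\<^sup>+t. f t \<partial>circle) = (\<integral>\<^sup>+x. f (cis x) * indicator {0..2*pi} x \<partial>lborel) / ennreal (2*pi)"
proof -
  have f: "f \<in> borel_measurable (restrict_space borel (sphere 0 1))"
    using assms by (simp cong: measurable_cong_sets)
  have "(\<integral>\<^sup>+t. f t \<partial>circle) = (\<integral>\<^sup>+x. f (cis x) \<partial>uniform_measure lborel {0..2*pi})"
    unfolding circle_def by (rule nn_integral_distr) (use f in auto)
  also have "\<dots> = (\<integral>\<^sup>+x. f (cis x) * indicator {0..2*pi} x \<partial>lborel) / emeasure lborel {0..2*pi}"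
    by (rule nn_integral_uniform_measure) auto
  finally show ?thesis by simp
qed

lemma integral_circle:
  fixes f :: "complex \<Rightarrow> complex"
  assumes [measurable]: "f \<in> borel_measurable circle"
  shows "(LINT t|circle. f t) = 1 / (2*pi) * (LBINT x:{0..2*pi}. f (cis x))"
proof -
  have f: "f \<in> borel_measurable (restrict_space borel (sphere 0 1))"
    using assms by (simp cong: measurable_cong_sets)
  have u: "uniform_measure lborel {0..2*pi} = density lborel (\<lambda>x. ennreal (indicator {0..2*pi} x / (2*pi)))"
    unfolding uniform_measure_def
    by (intro density_cong AE_I2) (auto simp: indicator_def divide_ennreal simp flip: ennreal_1)
  have "(LINT t|circle. f t) = (LINT x|uniform_measure lborel {0..2*pi}. f (cis x))"
    unfolding circle_def by (rule integral_distr) (use f in auto)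
  also have "\<dots> = (LINT x|lborel. (indicator {0..2*pi} x / (2*pi)) *\<^sub>R f (cis x))"
    unfolding u by (rule integral_density) (auto intro!: AE_I2)
  also have "\<dots> = (LINT x|lborel. (1 / (2*pi)) *\<^sub>R (indicator {0..2*pi} x *\<^sub>R f (cis x)))"
    by simp
  also have "\<dots> = (1 / (2*pi)) *\<^sub>R (LBINT x:{0..2*pi}. f (cis x))"
    unfolding set_lebesgue_integral_def by (rule integral_scaleR_right)
  finally show ?thesis by (simp add: scaleR_conv_of_real)
qed

text \<open>In the angle, inversion is the reflection x \<mapsto> 2 pi - x, which preserves Lebesgue
  measure and the interval.\<close>

lemma distr_circle_inverse: "distr circle circle inverse = circle"
proof (rule measure_eqI)
  fix A assume "A \<in> sets (distr circle circle inverse)"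
  then have A[measurable]: "A \<in> sets circle" by simp
  have ind: "(\<lambda>t. indicator A (inverse t) :: ennreal) \<in> borel_measurable circle"
    by measurable
  have m: "(\<lambda>x. indicator A (cis x) * indicator {0..2*pi} x :: ennreal) \<in> borel_measurable borel"
    by measurable
  have "emeasure (distr circle circle inverse) A = (\<integral>\<^sup>+t. indicator A t \<partial>distr circle circle inverse)"
    by (rule nn_integral_indicator[symmetric]) (use A in simp)
  also have "\<dots> = (\<integral>\<^sup>+t. indicator A (inverse t) \<partial>circle)"
    by (rule nn_integral_distr) auto
  also have "\<dots> = (\<integral>\<^sup>+x. indicator A (inverse (cis x)) * indicator {0..2*pi} x \<partial>lborel) / ennreal (2*pi)"
    by (rule nn_integral_circle[OF ind])
  also have "(\<integral>\<^sup>+x. indicator A (inverse (cis x)) * indicator {0..2*pi} x \<partial>lborel)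
     = (\<integral>\<^sup>+x. indicator A (cis (2*pi + (-1) * x)) * indicator {0..2*pi} (2*pi + (-1) * x) \<partial>lborel)"
    using cis_divide[of "2*pi"]
    by (intro nn_integral_cong arg_cong2[where f = "(*)"]) (auto simp: divide_inverse indicator_def)
  also have "\<dots> = (\<integral>\<^sup>+x. indicator A (cis x) * indicator {0..2*pi} x \<partial>lborel)"
    using nn_integral_real_affine[OF m, of "-1" "2*pi"] by simp
  also have "\<dots> / ennreal (2*pi) = (\<integral>\<^sup>+t. indicator A t \<partial>circle)"
    by (rule nn_integral_circle[symmetric]) measurable
  also have "\<dots> = emeasure circle A"
    by (rule nn_integral_indicator) (use A in simp)
  finally show "emeasure (distr circle circle inverse) A = emeasure circle A" .
qed simp

lemma integral_circle_inverse:
  fixes f :: "complex \<Rightarrow> 'b::{banach, second_countable_topology}"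
  assumes "f \<in> borel_measurable circle"
  shows "(LINT t|circle. f (inverse t)) = (LINT t|circle. f t)"
  using integral_distr[OF inverse_measurable_circle assms] by (simp add: distr_circle_inverse)

lemma integrable_circle_inverse:
  fixes f :: "complex \<Rightarrow> 'b::{banach, second_countable_topology}"
  assumes "f \<in> borel_measurable circle"
  shows "integrable circle (\<lambda>t. f (inverse t)) \<longleftrightarrow> integrable circle f"
  using integrable_distr_eq[OF inverse_measurable_circle assms] by (simp add: distr_circle_inverse)

lemma powi_measurable_circle [measurable]: "(\<lambda>t. t powi k) \<in> borel_measurable circle"
  by (intro borel_measurable_circle_continuous continuous_intros) auto

lemma ident_measurable_circle [measurable]: "(\<lambda>t. t) \<in> borel_measurable circle"
  by (intro borel_measurable_circle_continuous continuous_intros)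

section \<open>The algebra of measurable functions modulo null sets\<close>

abbreviation cf :: "(complex \<Rightarrow> complex) \<Rightarrow> circle_fun" where "cf \<equiv> abs_circle_fun"

lemma circle_ae_eq_refl [simp]: "circle_ae_eq f f \<longleftrightarrow> f \<in> borel_measurable circle"
  by (simp add: circle_ae_eq_def)

lemma cf_cases [case_names cf, cases type: circle_fun]:
  obtains f where "f \<in> borel_measurable circle" "x = cf f"
  by (induction x rule: circle_fun.abs_induct) auto

lemma cf_eq_iff:
  assumes "f \<in> borel_measurable circle" "g \<in> borel_measurable circle"
  shows "cf f = cf g \<longleftrightarrow> (AE t in circle. f t = g t)"
  using Quotient3_rel[OF Quotient3_circle_fun, of f g] assms by (simp add: circle_ae_eq_def)

lift_definition cint :: "circle_fun \<Rightarrow> complex" is "\<lambda>f. LINT t|circle. f t"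
  by (intro integral_cong_AE) (auto simp: circle_ae_eq_def)

text \<open>\<open>circle_fun\<close> has zero divisors, so the exponent laws of a field do not
  apply to it; the pointwise power satisfies them because t is nonzero on the circle.\<close>

lift_definition tpow :: "int \<Rightarrow> circle_fun" is "\<lambda>k t. t powi k"
  by simp

lemmas cf_simps = plus_circle_fun.abs_eq minus_circle_fun.abs_eq uminus_circle_fun.abs_eq
  times_circle_fun.abs_eq inverse_circle_fun.abs_eq divide_circle_fun.abs_eq smult_circle_fun.abs_eq
  tilde.abs_eq cint.abs_eq

lemma tpow_0 [simp]: "tpow 0 = 1"
  by transfer (simp add: circle_ae_eq_def)

lemma tpow_add: "tpow (i + j) = tpow i * tpow j"
  by transfer (use AE_circle_norm in \<open>auto simp: circle_ae_eq_def elim!: eventually_mono intro: power_int_add\<close>)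

lemma tpow_1: "tpow 1 = tvar"
  by transfer (simp add: circle_ae_eq_def)

lemma tpow_of_nat: "tpow (int n) = tvar ^ n"
  by (induction n) (simp_all add: tpow_add tpow_1)

lemma inverse_tpow: "inverse (tpow k) = tpow (- k)"
  by transfer (simp add: circle_ae_eq_def power_int_minus)

lemma inverse_tvar: "inverse tvar = tpow (- 1)"
  by (simp add: inverse_tpow flip: tpow_1)

lemma inverse_tvar_pow: "inverse tvar ^ n = tpow (- int n)"
  unfolding inverse_tvar by (induction n) (simp_all add: tpow_add[symmetric])

lemma tvar_powi: "tvar powi k = tpow k"
  by (cases "k \<ge> 0") (simp_all add: power_int_def inverse_tvar_pow flip: tpow_of_nat)

lemma tilde_tpow [simp]: "tilde (tpow k) = tpow (- k)"
  by transfer (simp add: circle_ae_eq_def power_int_minus power_int_inverse)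

lemma tilde_hom [simp]:
  "tilde (x + y) = tilde x + tilde y" "tilde (x - y) = tilde x - tilde y" "tilde (- x) = - tilde x"
  "tilde (x * y) = tilde x * tilde y" "tilde (z *\<^sub>C x) = z *\<^sub>C tilde x" "tilde 0 = 0" "tilde 1 = 1"
  "tilde (inverse x) = inverse (tilde x)" "tilde (x / y) = tilde x / tilde y"
  by (transfer; auto simp: circle_ae_eq_def intro!: measurable_compose[OF inverse_measurable_circle])+

lemma tilde_tilde [simp]: "tilde (tilde x) = x"
  by transfer (auto simp: circle_ae_eq_def intro!: measurable_compose[OF inverse_measurable_circle])

lemma tilde_sum [simp]: "tilde (sum f A) = (\<Sum>i\<in>A. tilde (f i))"
  by (induction A rule: infinite_finite_induct) auto

lemma smult_mult [simp]: "(z *\<^sub>C x) * y = z *\<^sub>C (x * y)" "x * (z *\<^sub>C y) = z *\<^sub>C (x * y)"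
  by (transfer; auto simp: circle_ae_eq_def)+

lemma smult_sum: "z *\<^sub>C sum f A = (\<Sum>i\<in>A. z *\<^sub>C f i)"
  by (rule circle_fun.scale_sum_right)

lemma divide_cf: "(x :: circle_fun) / y = x * inverse y"
  by transfer (auto simp: circle_ae_eq_def divide_inverse)

lemma inverse_mult_cf: "inverse (x * y) = inverse x * inverse (y :: circle_fun)"
  by transfer (auto simp: circle_ae_eq_def)

lemma inverse_inverse_cf [simp]: "inverse (inverse (x :: circle_fun)) = x"
  by transfer (auto simp: circle_ae_eq_def)

section \<open>Lebesgue spaces on the circle\<close>

lemma in_Lp_cf: "f \<in> borel_measurable circle \<Longrightarrow>
    cf f \<in> Lp p \<longleftrightarrow> integrable circle (\<lambda>t. norm (f t) powr p)"
  by (simp add: Lp_def in_Lp.abs_eq)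

lemma Lp_norm_cf: "f \<in> borel_measurable circle \<Longrightarrow> Lp_norm p (cf f) = Lpn circle p f"
  by (simp add: Lp_norm.abs_eq Lpn_def)

lemma in_L1_cf: "f \<in> borel_measurable circle \<Longrightarrow> cf f \<in> Lp 1 \<longleftrightarrow> integrable circle f"
  by (simp add: in_Lp_cf integrable_norm_iff)

lemma Lp_norm_nonneg [simp]: "0 \<le> Lp_norm p x"
  by transfer simp

lemma zero_in_Lp [simp]: "0 \<in> Lp p"
  unfolding Lp_def by (simp, transfer) simp

lemma Lp_add: "0 < p \<Longrightarrow> x \<in> Lp p \<Longrightarrow> y \<in> Lp p \<Longrightarrow> x + y \<in> Lp p"
  by (cases x; cases y) (auto simp: in_Lp_cf cf_simps intro: integrable_powr_add)

lemma Lp_smult: "0 < p \<Longrightarrow> x \<in> Lp p \<Longrightarrow> z *\<^sub>C x \<in> Lp p"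
  by (cases x) (auto simp: in_Lp_cf cf_simps norm_mult powr_mult)

lemma minus_eq_smult: "- x = (- 1) *\<^sub>C x"
  by (simp only: circle_fun.scale_minus_left circle_fun.scale_one)

lemma Lp_minus [simp]: "- x \<in> Lp p \<longleftrightarrow> x \<in> Lp p"
  by (cases x) (auto simp: in_Lp_cf cf_simps)

lemma Lp_diff: "0 < p \<Longrightarrow> x \<in> Lp p \<Longrightarrow> y \<in> Lp p \<Longrightarrow> x - y \<in> Lp p"
  using Lp_add[of p x "- y"] by simp

lemma Lp_sum: "0 < p \<Longrightarrow> (\<And>i. i \<in> A \<Longrightarrow> f i \<in> Lp p) \<Longrightarrow> sum f A \<in> Lp p"
  by (induction A rule: infinite_finite_induct) (auto intro: Lp_add)

lemma Lp_norm_triangle: "1 \<le> p \<Longrightarrow> x \<in> Lp p \<Longrightarrow> y \<in> Lp p \<Longrightarrow> Lp_norm p (x + y) \<le> Lp_norm p x + Lp_norm p y"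
  by (cases x; cases y) (auto simp: in_Lp_cf cf_simps Lp_norm_cf intro: Minkowski)

lemma Lp_norm_smult: "0 < p \<Longrightarrow> Lp_norm p (z *\<^sub>C x) = norm z * Lp_norm p x"
  by (cases x) (auto simp: cf_simps Lp_norm_cf Lpn_cmult)

lemma Lp_norm_minus [simp]: "Lp_norm p (- x) = Lp_norm p x"
  by (cases x) (auto simp: cf_simps Lp_norm_cf Lpn_def)

lemma Lp_norm_diff_commute: "Lp_norm p (x - y) = Lp_norm p (y - x)"
  using Lp_norm_minus[of p "x - y"] by simp

lemma Lp_norm_zero [simp]: "Lp_norm p 0 = 0"
  by transfer simp

lemma Lp_norm_eq_0: "0 < p \<Longrightarrow> x \<in> Lp p \<Longrightarrow> Lp_norm p x = 0 \<Longrightarrow> x = 0"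
  by (cases x) (auto simp: in_Lp_cf Lp_norm_cf Lpn_eq_0_iff zero_circle_fun_def cf_eq_iff)

lemma Lp_norm_triangle_diff:
  "1 \<le> p \<Longrightarrow> x \<in> Lp p \<Longrightarrow> y \<in> Lp p \<Longrightarrow> z \<in> Lp p \<Longrightarrow> Lp_norm p (x - z) \<le> Lp_norm p (x - y) + Lp_norm p (y - z)"
  using Lp_norm_triangle[of p "x - y" "y - z"] by (simp add: Lp_diff)

lemma tilde_in_Lp [simp]: "tilde x \<in> Lp p \<longleftrightarrow> x \<in> Lp p"
proof (cases x)
  case (cf f)
  have [measurable]: "(\<lambda>t. f (inverse t)) \<in> borel_measurable circle"
    using cf by (intro measurable_compose[OF inverse_measurable_circle])
  show ?thesis using cf integrable_circle_inverse[of "\<lambda>t. norm (f t) powr p"]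
    by (simp add: cf_simps in_Lp_cf)
qed

lemma Lp_norm_tilde [simp]: "Lp_norm p (tilde x) = Lp_norm p x"
proof (cases x)
  case (cf f)
  have [measurable]: "(\<lambda>t. f (inverse t)) \<in> borel_measurable circle"
    using cf by (intro measurable_compose[OF inverse_measurable_circle])
  show ?thesis using cf integral_circle_inverse[of "\<lambda>t. norm (f t) powr p"]
    by (simp add: cf_simps Lp_norm_cf Lpn_def)
qed

lemma cint_tilde [simp]: "cint (tilde x) = cint x"
proof (cases x)
  case (cf f)
  then show ?thesis using integral_circle_inverse[of f]
    by (simp add: cf_simps measurable_compose[OF inverse_measurable_circle])
qed

lemma Lp_mult_1:
  assumes "1 < p" "1/p + 1/q = 1" "x \<in> Lp p" "y \<in> Lp q"
  shows "x * y \<in> Lp 1" "Lp_norm 1 (x * y) \<le> Lp_norm p x * Lp_norm q y"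
proof -
  obtain f g where [measurable]: "f \<in> borel_measurable circle" "g \<in> borel_measurable circle"
    and xy: "x = cf f" "y = cf g" by (cases x; cases y) auto
  show "x * y \<in> Lp 1" "Lp_norm 1 (x * y) \<le> Lp_norm p x * Lp_norm q y"
    using Holder[of f circle g p q] assms(3,4) unfolding xy
    by (auto simp: cf_simps in_Lp_cf Lp_norm_cf in_L1_cf assms)
       (simp add: Lpn_def)
qed

lemma norm_cint_le: "x \<in> Lp 1 \<Longrightarrow> norm (cint x) \<le> Lp_norm 1 x"
  by (cases x) (auto simp: cf_simps Lp_norm_cf Lpn_def intro: integral_norm_bound)

lemma Lp_le_1:
  assumes "1 < p" "x \<in> Lp p"
  shows "x \<in> Lp 1" "Lp_norm 1 x \<le> Lp_norm p x"
proof -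
  obtain f where [measurable]: "f \<in> borel_measurable circle" and x: "x = cf f" by (cases x) auto
  show "x \<in> Lp 1" "Lp_norm 1 x \<le> Lp_norm p x"
    using circle.Lpn_1_le[of f p] assms unfolding x
    by (auto simp: in_Lp_cf in_L1_cf Lp_norm_cf) (simp add: Lpn_def)
qed

lemma cint_add: "x \<in> Lp 1 \<Longrightarrow> y \<in> Lp 1 \<Longrightarrow> cint (x + y) = cint x + cint y"
  by (cases x; cases y) (simp add: in_L1_cf cf_simps)

lemma cint_diff: "x \<in> Lp 1 \<Longrightarrow> y \<in> Lp 1 \<Longrightarrow> cint (x - y) = cint x - cint y"
  by (cases x; cases y) (simp add: in_L1_cf cf_simps)

lemma cint_smult: "cint (z *\<^sub>C x) = z * cint x"
  by (cases x) (simp add: cf_simps)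

lemma cint_zero [simp]: "cint 0 = 0" by transfer simp

lemma cf_Linf: "f \<in> borel_measurable circle \<Longrightarrow> cf f \<in> Linf \<longleftrightarrow> (\<exists>K. AE t in circle. norm (f t) \<le> K)"
  by (simp add: Linf_def essentially_bounded.abs_eq)

lemma Linf_mult_Lp:
  assumes "a \<in> Linf" "0 < p"
  obtains K where "0 \<le> K" "\<And>x. x \<in> Lp p \<Longrightarrow> a * x \<in> Lp p \<and> Lp_norm p (a * x) \<le> K * Lp_norm p x"
proof -
  obtain f where f[measurable]: "f \<in> borel_measurable circle" and a: "a = cf f" by (cases a) auto
  obtain K where K: "AE t in circle. norm (f t) \<le> K" using assms(1) f unfolding a by (auto simp: cf_Linf)
  define K' where "K' = max K 0"
  have K': "0 \<le> K'" "AE t in circle. norm (f t) \<le> K'" using K by (auto simp: K'_def elim: eventually_mono)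
  have "a * x \<in> Lp p \<and> Lp_norm p (a * x) \<le> K' * Lp_norm p x" if "x \<in> Lp p" for x
  proof -
    obtain g where g[measurable]: "g \<in> borel_measurable circle" and x: "x = cf g" by (cases x) auto
    have i: "integrable circle (\<lambda>t. norm (complex_of_real K' * g t) powr p)"
      using that g unfolding x by (simp add: in_Lp_cf norm_mult powr_mult)
    have ae: "AE t in circle. norm (f t * g t) \<le> norm (complex_of_real K' * g t)"
      using K'(2) by eventually_elim (use K'(1) in \<open>auto simp: norm_mult intro!: mult_right_mono\<close>)
    have m: "(\<lambda>t. f t * g t) \<in> borel_measurable circle" by measurable
    show ?thesis using Lpn_mono[OF assms(2) i m ae] Lpn_cmult[OF assms(2), of circle "complex_of_real K'" g]
      unfolding a x by (auto simp: cf_simps in_Lp_cf Lp_norm_cf K'_def)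
  qed
  then show ?thesis using that[of K'] by (auto simp: K'_def)
qed

lemma Linf_Lp: "a \<in> Linf \<Longrightarrow> 0 < p \<Longrightarrow> x \<in> Lp p \<Longrightarrow> a * x \<in> Lp p"
  by (metis Linf_mult_Lp)

lemma one_Linf [simp]: "1 \<in> Linf"
  by (simp add: one_circle_fun_def cf_Linf) (auto intro: exI[of _ 1])

lemma Linf_mult: "a \<in> Linf \<Longrightarrow> b \<in> Linf \<Longrightarrow> a * b \<in> Linf"
proof (cases a; cases b)
  fix f g assume ab: "a \<in> Linf" "b \<in> Linf"
   and f: "f \<in> borel_measurable circle" "a = cf f" and g: "g \<in> borel_measurable circle" "b = cf g"
  from ab f g obtain K L where "AE t in circle. norm (f t) \<le> K" "AE t in circle. norm (g t) \<le> L"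
    by (auto simp: cf_Linf)
  then have "AE t in circle. norm (f t * g t) \<le> \<bar>K\<bar> * \<bar>L\<bar>"
    by eventually_elim (auto simp: norm_mult intro!: mult_mono)
  then show "a * b \<in> Linf" using f g by (auto simp: cf_simps cf_Linf)
qed

lemma Linf_add: "a \<in> Linf \<Longrightarrow> b \<in> Linf \<Longrightarrow> a + b \<in> Linf"
proof (cases a; cases b)
  fix f g assume ab: "a \<in> Linf" "b \<in> Linf"
   and f: "f \<in> borel_measurable circle" "a = cf f" and g: "g \<in> borel_measurable circle" "b = cf g"
  from ab f g obtain K L where "AE t in circle. norm (f t) \<le> K" "AE t in circle. norm (g t) \<le> L"
    by (auto simp: cf_Linf)
  then have "AE t in circle. norm (f t + g t) \<le> K + L"
    by eventually_elim (auto intro: order_trans[OF norm_triangle_ineq])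
  then show "a + b \<in> Linf" using f g by (auto simp: cf_simps cf_Linf)
qed

lemma Linf_smult: "a \<in> Linf \<Longrightarrow> z *\<^sub>C a \<in> Linf"
proof (cases a)
  fix f assume ab: "a \<in> Linf" and f: "f \<in> borel_measurable circle" "a = cf f"
  from ab f obtain K where "AE t in circle. norm (f t) \<le> K"
    by (auto simp: cf_Linf)
  then have "AE t in circle. norm (z * f t) \<le> norm z * K"
    by eventually_elim (auto simp: norm_mult intro: mult_left_mono)
  then show "z *\<^sub>C a \<in> Linf" using f by (auto simp: cf_simps cf_Linf)
qed

lemma Linf_sum: "(\<And>i. i \<in> A \<Longrightarrow> f i \<in> Linf) \<Longrightarrow> sum f A \<in> Linf"
  using Linf_smult[OF one_Linf, of 0] by (induction A rule: infinite_finite_induct) (auto intro: Linf_add)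

lemma Linf_tilde: "a \<in> Linf \<Longrightarrow> tilde a \<in> Linf"
proof (cases a)
  fix f assume ab: "a \<in> Linf" and f: "f \<in> borel_measurable circle" "a = cf f"
  from ab f obtain K where "AE t in circle. norm (f t) \<le> K"
    by (auto simp: cf_Linf)
  then have "AE t in circle. norm (f (inverse t)) \<le> K" by (rule AE_circle_inverse)
  then show "tilde a \<in> Linf" using f
    by (auto simp: cf_simps cf_Linf measurable_compose[OF inverse_measurable_circle])
qed

lemma tpow_cf: "tpow k = cf (\<lambda>t. t powi k)"
  by (simp add: tpow.abs_eq tpow_def)

lemma tpow_Linf [simp]: "tpow k \<in> Linf"
  using AE_circle_norm unfolding tpow_cf
  by (auto simp: cf_Linf norm_power_int intro!: exI[of _ 1] elim!: eventually_mono)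

lemma one_Lp [simp]: "1 \<in> Lp p"
  by (simp add: one_circle_fun_def in_Lp_cf)

lemma Linf_subset_Lp: "0 < p \<Longrightarrow> a \<in> Linf \<Longrightarrow> a \<in> Lp p"
  using Linf_Lp[of a p 1] by simp

lemma tpow_mult_Lp [simp]: "0 < p \<Longrightarrow> tpow k * x \<in> Lp p \<longleftrightarrow> x \<in> Lp p"
  using Linf_Lp[of "tpow k" p x] Linf_Lp[of "tpow (-k)" p "tpow k * x"]
  by (auto simp: mult.assoc[symmetric] tpow_add[symmetric])

lemma Lp_norm_tpow_mult [simp]: "Lp_norm p (tpow k * x) = Lp_norm p x"
proof (cases x)
  case (cf f)
  note [measurable] = cf(1)
  have "AE t in circle. norm (t powi k * f t) powr p = norm (f t) powr p"
    using AE_circle_norm by eventually_elim (simp add: norm_mult norm_power_int)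
  then have "(LINT t|circle. norm (t powi k * f t) powr p) = (LINT t|circle. norm (f t) powr p)"
    by (intro integral_cong_AE) measurable
  then show ?thesis unfolding cf(2) tpow_cf by (simp add: cf_simps Lp_norm_cf Lpn_def)
qed

lemma fourier_coeff_eq: "fourier_coeff x n = cint (tpow (- n) * x)"
proof (cases x)
  case (cf f)
  note [measurable] = cf(1)
  have "cis x powi n = exp (\<i> * of_int n * x)" for x n
    by (simp add: cis_conv_exp exp_power_int mult_ac)
  then show ?thesis unfolding cf(2) tpow_cf
    by (simp add: cf_simps fourier_coeff.abs_eq integral_circle cis_conv_exp[symmetric] mult.commute[of "f _"])
qed

lemma cint_1 [simp]: "cint 1 = 1"
  by (simp add: one_circle_fun_def cf_simps circle.prob_space)

lemma cint_tpow: "cint (tpow k) = (if k = 0 then 1 else 0)"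
proof (cases "k = 0")
  case False
  have c: "cis x powi k = cis (of_int k * x)" for x by (rule cis_power_int)
  have "((\<lambda>x. cis (of_int k * x)) has_integral (cis (of_int k * (2*pi)) / (\<i> * of_int k) - cis (of_int k * 0) / (\<i> * of_int k))) {0..2*pi}"
  proof (rule fundamental_theorem_of_calculus)
    fix x :: real
    show "((\<lambda>x. cis (of_int k * x) / (\<i> * of_int k)) has_vector_derivative cis (of_int k * x)) (at x within {0..2*pi})"
      unfolding cis_conv_exp using False
      by (auto intro!: derivative_eq_intros has_vector_derivative_real_field simp: mult_ac)
  qed simp
  moreover have "cis (of_int k * (2*pi)) = 1"
    using cis_multiple_2pi[of "of_int k"] by (simp add: mult_ac)
  ultimately have hi: "((\<lambda>x. cis (of_int k * x)) has_integral 0) {0..2*pi}" by simp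
  have "set_integrable lborel {0..2*pi} (\<lambda>x. cis (of_int k * x))"
    by (intro borel_integrable_atLeastAtMost') (auto intro!: continuous_intros)
  then have "(LBINT x:{0..2*pi}. cis (of_int k * x)) = integral {0..2*pi} (\<lambda>x. cis (of_int k * x))"
    by (rule set_borel_integral_eq_integral)
  also have "\<dots> = 0" using hi by (rule integral_unique)
  finally show ?thesis using False unfolding tpow_cf by (simp add: cf_simps integral_circle c)
qed simp

section \<open>Uniqueness of Fourier coefficients\<close>

definition trig :: "circle_fun set" where
  "trig = circle_span (range tpow)"

lemma tpow_trig [simp]: "tpow k \<in> trig"
  unfolding trig_def by (rule circle_fun.span_base) simp

lemma trig_add: "x \<in> trig \<Longrightarrow> y \<in> trig \<Longrightarrow> x + y \<in> trig"
  and trig_smult: "x \<in> trig \<Longrightarrow> z *\<^sub>C x \<in> trig"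
  and trig_zero [simp]: "0 \<in> trig"
  and trig_diff: "x \<in> trig \<Longrightarrow> y \<in> trig \<Longrightarrow> x - y \<in> trig"
  unfolding trig_def by (rule circle_fun.span_add circle_fun.span_scale circle_fun.span_zero circle_fun.span_diff; assumption?)+

lemma trig_induct [consumes 1, case_names zero add]:
  assumes "x \<in> trig" "P 0" "\<And>z k y. y \<in> trig \<Longrightarrow> P y \<Longrightarrow> P (z *\<^sub>C tpow k + y)"
  shows "P x"
proof -
  have "x \<in> trig \<and> P x"
    using assms(1) unfolding trig_def
  proof (induction rule: circle_fun.span_induct_alt)
    case (step c x y)
    then show ?case using assms(3) unfolding trig_def[symmetric]
      by (auto intro!: trig_add trig_smult)
  qed (use assms in \<open>auto simp flip: trig_def\<close>)
  then show ?thesis ..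
qed

lemma trig_mult: "x \<in> trig \<Longrightarrow> y \<in> trig \<Longrightarrow> x * y \<in> trig"
proof (induction rule: trig_induct)
  case (add z k x)
  have "tpow k * y \<in> trig" using \<open>y \<in> trig\<close>
    by (induction rule: trig_induct) (auto simp: distrib_left tpow_add[symmetric] intro!: trig_add trig_smult)
  then show ?case using add by (auto simp: distrib_right intro!: trig_add trig_smult)
qed auto

lemma trig_Linf: "x \<in> trig \<Longrightarrow> x \<in> Linf"
  by (induction rule: trig_induct) (auto intro!: Linf_add Linf_smult simp: Linf_smult[OF one_Linf, of 0, simplified])

lemma trig_Lp: "0 < p \<Longrightarrow> x \<in> trig \<Longrightarrow> x \<in> Lp p"
  by (intro Linf_subset_Lp trig_Linf)

section \<open>Trigonometric polynomials as a polynomial plus a conjugate polynomial\<close>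

definition harmonic_poly :: "(complex \<Rightarrow> complex) \<Rightarrow> bool" where
  "harmonic_poly v \<longleftrightarrow> (\<exists>G H. \<forall>t. norm t = 1 \<longrightarrow> v t = poly G t + cnj (poly H t))"

lemma harmonic_polyI: "(\<And>t. norm t = 1 \<Longrightarrow> v t = poly G t + cnj (poly H t)) \<Longrightarrow> harmonic_poly v"
  by (auto simp: harmonic_poly_def)

lemma harmonic_poly_cong: "harmonic_poly v \<Longrightarrow> (\<And>t. norm t = 1 \<Longrightarrow> w t = v t) \<Longrightarrow> harmonic_poly w"
  by (auto simp: harmonic_poly_def)

lemma harmonic_poly_add:
  assumes "harmonic_poly v" "harmonic_poly w"
  shows "harmonic_poly (\<lambda>t. v t + w t)"
proof -
  obtain G H G' H' where "\<And>t. norm t = 1 \<Longrightarrow> v t = poly G t + cnj (poly H t)" "\<And>t. norm t = 1 \<Longrightarrow> w t = poly G' t + cnj (poly H' t)"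
    using assms by (auto simp: harmonic_poly_def)
  then show ?thesis by (intro harmonic_polyI[of _ "G + G'" "H + H'"]) simp
qed

lemma harmonic_poly_cmult:
  assumes "harmonic_poly v"
  shows "harmonic_poly (\<lambda>t. z * v t)"
proof -
  obtain G H where "\<And>t. norm t = 1 \<Longrightarrow> v t = poly G t + cnj (poly H t)"
    using assms by (auto simp: harmonic_poly_def)
  then show ?thesis by (intro harmonic_polyI[of _ "Polynomial.smult z G" "Polynomial.smult (cnj z) H"]) (simp add: distrib_left)
qed

lemma harmonic_poly_cnj:
  assumes "harmonic_poly v"
  shows "harmonic_poly (\<lambda>t. cnj (v t))"
proof -
  obtain G H where "\<And>t. norm t = 1 \<Longrightarrow> v t = poly G t + cnj (poly H t)"
    using assms by (auto simp: harmonic_poly_def)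
  then show ?thesis by (intro harmonic_polyI[of _ H G]) simp
qed

lemma harmonic_poly_const: "harmonic_poly (\<lambda>t. c)"
  by (rule harmonic_polyI[of _ "[:c:]" 0]) simp

text \<open>Since t * cnj t = 1, multiplication by t lowers the conjugate part by one degree, and
  its constant coefficient moves to the analytic part as a multiple of t.\<close>

lemma harmonic_poly_ident_mult:
  assumes "harmonic_poly v"
  shows "harmonic_poly (\<lambda>t. t * v t)"
proof -
  obtain G H where GH: "\<And>t. norm t = 1 \<Longrightarrow> v t = poly G t + cnj (poly H t)"
    using assms by (auto simp: harmonic_poly_def)
  obtain b K where H: "H = pCons b K" by (cases H)
  have "t * cnj t = 1" if "norm t = 1" for t using that complex_norm_square[of t] by simp
  then have "t * (cnj t * z) = z" if "norm t = 1" for t z using that by (simp add: mult.assoc[symmetric])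
  then show ?thesis
    by (intro harmonic_polyI[of _ "[:0, 1:] * G + [:0, cnj b:]" K]) (simp add: GH H algebra_simps)
qed

lemma harmonic_poly_mult:
  assumes "harmonic_poly v" "harmonic_poly w"
  shows "harmonic_poly (\<lambda>t. v t * w t)"
proof -
  have pm: "harmonic_poly (\<lambda>t. poly G t * w t)" if w: "harmonic_poly w" for G w
  proof (induction G)
    case (pCons a G)
    have "harmonic_poly (\<lambda>t. a * w t + t * (poly G t * w t))"
      by (intro harmonic_poly_add harmonic_poly_cmult harmonic_poly_ident_mult pCons w)
    then show ?case by (rule harmonic_poly_cong) (simp add: algebra_simps)
  qed (simp add: harmonic_poly_const)
  obtain G H where GH: "\<And>t. norm t = 1 \<Longrightarrow> v t = poly G t + cnj (poly H t)"
    using assms by (auto simp: harmonic_poly_def)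
  have "harmonic_poly (\<lambda>t. poly G t * w t + cnj (poly H t * cnj (w t)))"
    by (intro harmonic_poly_add pm harmonic_poly_cnj assms)
  then show ?thesis by (rule harmonic_poly_cong) (simp add: GH algebra_simps)
qed

lemma harmonic_poly_real_polynomial:
  fixes g :: "complex \<Rightarrow> real"
  assumes "real_polynomial_function g"
  shows "harmonic_poly (\<lambda>t. of_real (g t))"
  using assms
proof (induction rule: real_polynomial_function.induct)
  case (linear g)
  then interpret bounded_linear g .
  have g: "g t = Re t * g 1 + Im t * g \<i>" for t
  proof -
    have "t = Re t *\<^sub>R 1 + Im t *\<^sub>R \<i>" by (simp add: complex_eq_iff)
    then have "g t = g (Re t *\<^sub>R 1 + Im t *\<^sub>R \<i>)" by simp
    then show ?thesis by (simp only: add scaleR real_scaleR_def)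
  qed
  \<comment> \<open>A real linear form is g(t) = 2 Re (c t) with c = (g(1) - i g(i)) / 2.\<close>
  have "of_real (g t) = poly [:0, Complex (g 1 / 2) (- g \<i> / 2):] t + cnj (poly [:0, Complex (g 1 / 2) (- g \<i> / 2):] t)" for t
    by (subst g) (simp add: complex_eq_iff algebra_simps)
  then show ?case by (rule harmonic_polyI)
qed (auto intro: harmonic_poly_const harmonic_poly_add harmonic_poly_mult)

lemma poly_measurable [measurable]: "poly G \<in> borel_measurable circle"
  "(\<lambda>t. cnj (poly G t)) \<in> borel_measurable circle" "(\<lambda>t. complex_of_real (Re (poly G t))) \<in> borel_measurable circle"
  by (intro borel_measurable_circle_continuous continuous_intros)+

lemma cnj_measurable_circle [measurable]: "cnj \<in> borel_measurable circle"
  by (intro borel_measurable_circle_continuous continuous_intros)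

lemma cf_cnj_powi: "cf (\<lambda>t. cnj (t ^ k)) = tpow (- int k)"
proof -
  have "AE t in circle. cnj (t ^ k) = t powi (- int k)"
    using AE_circle_norm
  proof eventually_elim
    case (elim t)
    have "inverse t = cnj t"
    proof (rule inverse_unique)
      show "t * cnj t = 1" using elim complex_norm_square[of t] by simp
    qed
    then show ?case by (simp add: power_int_minus power_inverse[symmetric])
  qed
  then show ?thesis unfolding tpow_cf by (subst cf_eq_iff) auto
qed

lemma tpow_minus_1: "tpow (- 1) = cf cnj"
  using cf_cnj_powi[of 1] by simp

lemma poly_fun_simps:
  fixes F G :: "complex poly"
  shows "poly (F + G) = (\<lambda>t. poly F t + poly G t)" "poly (F - G) = (\<lambda>t. poly F t - poly G t)"
    "poly (F * G) = (\<lambda>t. poly F t * poly G t)" "poly (Polynomial.smult z F) = (\<lambda>t. z * poly F t)"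
    "poly (pCons z F) = (\<lambda>t. z + t * poly F t)" "poly 0 = (\<lambda>t. 0 :: complex)" "poly (monom z k) = (\<lambda>t. z * t ^ k)"
  by (simp_all add: fun_eq_iff poly_monom)

lemma cf_poly_trig: "cf (poly G) \<in> trig" and cf_cnj_poly_trig: "cf (\<lambda>t. cnj (poly G t)) \<in> trig"
proof (induction G)
  case 0
  have "cf (\<lambda>t. 0) = 0" by (simp add: zero_circle_fun_def)
  case 1 show ?case using \<open>cf (\<lambda>t. 0) = 0\<close> by (simp add: poly_fun_simps)
  case 2 show ?case using \<open>cf (\<lambda>t. 0) = 0\<close> by simp
next
  case (pCons a G)
  have "cf (poly (pCons a G)) = a *\<^sub>C tpow 0 + tpow 1 * cf (poly G)"
    unfolding tpow_cf by (simp add: cf_simps poly_fun_simps)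
  moreover have "cf (\<lambda>t. cnj (poly (pCons a G) t)) = cnj a *\<^sub>C tpow 0 + tpow (-1) * cf (\<lambda>t. cnj (poly G t))"
    unfolding tpow_minus_1 by (simp add: cf_simps poly_fun_simps one_circle_fun_def)
  ultimately show "cf (poly (pCons a G)) \<in> trig" "cf (\<lambda>t. cnj (poly (pCons a G) t)) \<in> trig"
    using pCons.IH by (auto simp only: intro!: trig_add trig_smult trig_mult tpow_trig)
qed

lemma real_polynomial_trig:
  fixes g :: "complex \<Rightarrow> real"
  assumes "real_polynomial_function g"
  shows "cf (\<lambda>t. of_real (g t)) \<in> trig"
proof -
  obtain G H where GH: "\<And>t. norm t = 1 \<Longrightarrow> of_real (g t) = poly G t + cnj (poly H t)"
    using harmonic_poly_real_polynomial[OF assms] by (auto simp: harmonic_poly_def)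
  have [measurable]: "g \<in> borel_measurable circle"
    using assms by (auto intro!: borel_measurable_circle_continuous continuous_on_polymonial_function simp: real_polynomial_function_eq)
  have "cf (\<lambda>t. of_real (g t)) = cf (\<lambda>t. poly G t + cnj (poly H t))"
    using AE_circle_norm by (subst cf_eq_iff) (auto simp: GH elim!: eventually_mono)
  also have "\<dots> = cf (poly G) + cf (\<lambda>t. cnj (poly H t))" by (simp add: cf_simps)
  finally show ?thesis by (simp add: trig_add cf_poly_trig cf_cnj_poly_trig)
qed

text \<open>Real polynomial functions are trigonometric polynomials on the circle and so are
  annihilated by \<open>f\<close>; by Stone-Weierstrass they approximate \<open>g\<close> uniformly,
  with an error in the integral of at most \<open>e\<close> times the L^1 norm of
  \<open>f\<close>.\<close>

lemma integral_continuous_eq_0: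
  fixes f :: "complex \<Rightarrow> complex" and g :: "complex \<Rightarrow> real"
  assumes [measurable]: "f \<in> borel_measurable circle" and f: "integrable circle f"
    and 0: "\<And>k. cint (tpow k * cf f) = 0" and g: "continuous_on (sphere 0 1) g"
  shows "(LINT t|circle. f t * of_real (g t)) = 0"
proof -
  have gm[measurable]: "g \<in> borel_measurable circle" by (rule borel_measurable_circle_continuous[OF g])
  have L1: "cf f \<in> Lp 1" using f by (simp add: in_L1_cf)
  have tr: "cint (x * cf f) = 0" if "x \<in> trig" for x
    using that
  proof (induction rule: trig_induct)
    case (add z k y)
    have "z *\<^sub>C (tpow k * cf f) \<in> Lp 1" "y * cf f \<in> Lp 1"
      using L1 add by (auto intro!: Lp_smult Linf_Lp trig_Linf)
    then show ?case using add by (simp add: distrib_right cint_add cint_smult 0)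
  qed simp
  define I where "I = (LINT t|circle. norm (f t))"
  have le: "norm (LINT t|circle. f t * of_real (g t)) \<le> e * I" if e: "e > 0" for e
  proof -
    obtain h where h: "real_polynomial_function h" "\<And>t. t \<in> sphere 0 1 \<Longrightarrow> \<bar>g t - h t\<bar> < e"
      using Stone_Weierstrass_real_polynomial_function[OF compact_sphere g e] by blast
    have hm[measurable]: "h \<in> borel_measurable circle"
      using h by (auto intro!: borel_measurable_circle_continuous continuous_on_polymonial_function simp: real_polynomial_function_eq)
    have ae: "AE t in circle. norm (of_real (g t) - of_real (h t) :: complex) \<le> e"
      by (rule AE_I2) (use h in \<open>force simp: space_circle simp flip: of_real_diff\<close>)
    have i1: "integrable circle (\<lambda>t. (of_real (g t) - of_real (h t)) * f t)"
    proof (rule Bochner_Integration.integrable_bound)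
      show "integrable circle (\<lambda>t. e * norm (f t))" using f by simp
      show "AE t in circle. norm ((of_real (g t) - of_real (h t)) * f t) \<le> norm (e * norm (f t))"
        using ae by eventually_elim (use e in \<open>auto simp: norm_mult intro!: mult_right_mono\<close>)
    qed measurable
    have "cf (\<lambda>t. of_real (h t)) * cf f \<in> Lp 1"
      using L1 real_polynomial_trig[OF h(1)] by (intro Linf_Lp trig_Linf) auto
    then have i2: "integrable circle (\<lambda>t. of_real (h t) * f t)"
      by (simp add: cf_simps in_L1_cf)
    have i20: "(LINT t|circle. of_real (h t) * f t) = 0"
      using tr[OF real_polynomial_trig[OF h(1)]] by (simp add: cf_simps)
    have "(LINT t|circle. f t * of_real (g t)) = (LINT t|circle. (of_real (g t) - of_real (h t)) * f t + of_real (h t) * f t)"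
      by (simp add: algebra_simps)
    also have "\<dots> = (LINT t|circle. (of_real (g t) - of_real (h t)) * f t)"
      using i1 i2 i20 by simp
    also have "norm \<dots> \<le> (LINT t|circle. norm ((of_real (g t) - of_real (h t)) * f t))"
      by (rule integral_norm_bound)
    also have "\<dots> \<le> (LINT t|circle. e * norm (f t))"
    proof (rule integral_mono_AE[OF integrable_norm[OF i1]])
      show "AE t in circle. norm ((of_real (g t) - of_real (h t)) * f t) \<le> e * norm (f t)"
        using ae by eventually_elim (auto simp: norm_mult intro!: mult_right_mono)
    qed (use f in simp)
    finally show ?thesis by (simp add: I_def)
  qed
  have "((\<lambda>e. e * I) \<longlongrightarrow> 0) (at_right 0)" by (auto intro!: tendsto_eq_intros)
  then have "norm (LINT t|circle. f t * of_real (g t)) \<le> 0"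
    by (rule tendsto_lowerbound[OF _ eventually_at_rightI[of 0 1]]) (simp_all add: le)
  then show ?thesis by simp
qed

text \<open>The continuous functions \<open>max 0 (1 - real n * infdist t C)\<close> decrease to the
  indicator of a closed set; dominated convergence applies with bound |f|.\<close>

lemma integral_closed_eq_0:
  fixes f :: "complex \<Rightarrow> complex"
  assumes [measurable]: "f \<in> borel_measurable circle" and f: "integrable circle f"
    and 0: "\<And>k. cint (tpow k * cf f) = 0" and C: "closed C"
  shows "(LINT t|circle. f t * of_real (indicator C t)) = 0"
proof (cases "C = {}")
  case False
  define g where "g n t = max 0 (1 - real n * infdist t C)" for n t
  have cont: "continuous_on S (g n)" for n S
    unfolding g_def by (intro continuous_intros)
  have gm[measurable]: "g n \<in> borel_measurable circle" for n
    by (rule borel_measurable_circle_continuous[OF cont])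
  have lim: "(\<lambda>n. g n t) \<longlonglongrightarrow> indicator C t" for t
  proof (cases "t \<in> C")
    case False
    then have "infdist t C > 0" using C \<open>C \<noteq> {}\<close>
      using in_closed_iff_infdist_zero[of C t] infdist_nonneg[of t C] by (auto simp: order_less_le)
    then obtain N where N: "1 < real N * infdist t C" using reals_Archimedean3 by blast
    have "\<forall>\<^sub>F n in sequentially. g n t = 0"
      using eventually_ge_at_top[of N]
    proof eventually_elim
      case (elim n)
      then have "real N * infdist t C \<le> real n * infdist t C"
        by (intro mult_right_mono) (auto simp: infdist_nonneg)
      then show ?case using N by (simp add: g_def)
    qed
    then show ?thesis using False by (simp add: tendsto_eventually)
  qed (simp add: g_def)
  have [measurable]: "C \<in> sets borel" using C by simp
  have im: "(\<lambda>t. indicator C t :: real) \<in> borel_measurable circle"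
    by (rule borel_measurable_LIMSEQ_real[OF lim gm])
  have "(\<lambda>n. LINT t|circle. f t * of_real (g n t)) \<longlonglongrightarrow> (LINT t|circle. f t * of_real (indicator C t))"
  proof (rule integral_dominated_convergence)
    show "integrable circle (\<lambda>t. norm (f t))" using f by simp
    show "AE t in circle. (\<lambda>n. f t * of_real (g n t)) \<longlonglongrightarrow> f t * of_real (indicator C t)"
      by (intro AE_I2 tendsto_intros lim)
    have "\<bar>g n t\<bar> \<le> 1" for n t by (simp add: g_def infdist_nonneg)
    then show "AE t in circle. norm (f t * of_real (g n t)) \<le> norm (f t)" for n
      by (intro AE_I2) (simp add: norm_mult mult_left_le)
    show "(\<lambda>t. f t * of_real (indicator C t)) \<in> borel_measurable circle"
      using im by measurable
  qed measurable
  then show ?thesis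
    using integral_continuous_eq_0[OF assms(1) f 0 cont] by (simp add: LIMSEQ_const_iff)
qed simp

text \<open>Closed sets are stable under intersection and generate the Borel sets, and the sets over
  which \<open>f\<close> integrates to 0 form a Dynkin system.\<close>

lemma integral_borel_eq_0:
  fixes f :: "complex \<Rightarrow> complex"
  assumes [measurable]: "f \<in> borel_measurable circle" and f: "integrable circle f"
    and 0: "\<And>k. cint (tpow k * cf f) = 0" and A: "A \<in> sets borel"
  shows "(LINT t|circle. f t * of_real (indicator A t)) = 0"
proof -
  have m: "(\<lambda>t. indicator B t :: real) \<in> borel_measurable circle" if "B \<in> sets borel" for B :: "complex set"
    using measurable_compose[OF ident_measurable_circle borel_measurable_indicator[OF that]] .
  have i: "integrable circle (\<lambda>t. f t * of_real (indicator B t))" if "B \<in> sets borel" for B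
  proof (rule Bochner_Integration.integrable_bound[OF f])
    show "(\<lambda>t. f t * of_real (indicator B t)) \<in> borel_measurable circle"
      using m[OF that] by measurable
  qed (auto simp: norm_mult indicator_def)
  have "A \<in> sigma_sets UNIV (Collect closed)" using A by (simp add: borel_eq_closed)
  have st: "Int_stable (Collect closed :: complex set set)" by (auto simp: Int_stable_def)
  have sub: "Collect closed \<subseteq> Pow (UNIV :: complex set)" by simp
  from st sub \<open>A \<in> sigma_sets UNIV (Collect closed)\<close> show ?thesis
  proof (induction rule: sigma_sets_induct_disjoint)
    case (basic C)
    then show ?case using integral_closed_eq_0[OF assms(1) f 0] by simp
  next
    case (compl B)
    then have B: "B \<in> sets borel" by (simp add: borel_eq_closed)
    have "(LINT t|circle. f t * of_real (indicator (UNIV - B) t))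
        = (LINT t|circle. f t - f t * of_real (indicator B t))"
      by (intro Bochner_Integration.integral_cong) (auto simp: indicator_def)
    also have "\<dots> = (LINT t|circle. f t) - (LINT t|circle. f t * of_real (indicator B t))"
      using f i[OF B] by simp
    also have "(LINT t|circle. f t) = 0"
      using integral_closed_eq_0[OF assms(1) f 0 closed_UNIV] by simp
    finally show ?case using compl by simp
  next
    case (union B)
    have B: "B i \<in> sets borel" for i using union by (auto simp: borel_eq_closed)
    define S where "S n = (\<Union>i<n. B i)" for n
    have S0: "(LINT t|circle. f t * of_real (indicator (S n) t)) = 0" for n
    proof (induction n)
      case (Suc n)
      have "S n \<inter> B n = {}"
      proof -
        have "B i \<inter> B n = {}" if "i < n" for i
          using union(1) that by (simp add: disjoint_family_on_def)
        then show ?thesis by (auto simp: S_def)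
      qed
      then have "(LINT t|circle. f t * of_real (indicator (S (Suc n)) t))
        = (LINT t|circle. f t * of_real (indicator (S n) t) + f t * of_real (indicator (B n) t))"
        by (intro Bochner_Integration.integral_cong) (auto simp: S_def indicator_def lessThan_Suc)
      also have "\<dots> = 0"
        using B Suc union(3) by (subst Bochner_Integration.integral_add) (auto intro!: i simp: S_def)
      finally show ?case .
    qed (simp add: S_def)
    have "(\<lambda>n. LINT t|circle. f t * of_real (indicator (S n) t)) \<longlonglongrightarrow> (LINT t|circle. f t * of_real (indicator (\<Union>(range B)) t))"
    proof (rule integral_dominated_convergence)
      show "integrable circle (\<lambda>t. norm (f t))" using f by simp
      show "AE t in circle. norm (f t * of_real (indicator (S n) t)) \<le> norm (f t)" for n
        by (auto simp: indicator_def)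
      have "\<forall>\<^sub>F n in sequentially. indicator (S n) t = (indicator (\<Union>(range B)) t :: real)" for t
      proof (cases "t \<in> \<Union>(range B)")
        case True
        then obtain j where j: "t \<in> B j" by auto
        show ?thesis using eventually_gt_at_top[of j] by eventually_elim (use j in \<open>auto simp: S_def indicator_def\<close>)
      qed (auto simp: S_def indicator_def)
      then show "AE t in circle. (\<lambda>n. f t * of_real (indicator (S n) t)) \<longlonglongrightarrow> f t * of_real (indicator (\<Union>(range B)) t)"
        by (intro AE_I2 tendsto_intros tendsto_eventually)
      show "(\<lambda>t. f t * of_real (indicator (S n) t)) \<in> borel_measurable circle" for n
        using m[of "S n"] B by (auto simp: S_def intro!: borel_measurable_times)
      show "(\<lambda>t. f t * of_real (indicator (\<Union>(range B)) t)) \<in> borel_measurable circle"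
        using m[of "\<Union>(range B)"] B by (auto intro!: borel_measurable_times)
    qed
    then show ?case by (simp add: S0 LIMSEQ_const_iff)
  qed auto
qed

text \<open>The coefficients determine the integrals over all Borel sets, and these determine real
  and imaginary part almost everywhere.\<close>

theorem fourier_unique:
  assumes x: "x \<in> Lp 1" and 0: "\<And>k. fourier_coeff x k = 0"
  shows "x = 0"
proof (cases x)
  case (cf f)
  note [measurable] = cf(1)
  have f: "integrable circle f" using x cf by (simp add: in_L1_cf)
  have 0: "cint (tpow k * cf f) = 0" for k
    using 0[of "- k"] by (simp add: fourier_coeff_eq cf(2))
  have z: "(LINT t|circle. f t * of_real (indicator A t)) = 0" if A: "A \<in> sets circle" for A
  proof -
    obtain B where B: "B \<in> sets borel" "A = sphere 0 1 \<inter> B"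
      using A by (auto simp: sets_restrict_space)
    have "(LINT t|circle. f t * of_real (indicator A t)) = (LINT t|circle. f t * of_real (indicator B t))"
      by (intro Bochner_Integration.integral_cong) (auto simp: B space_circle indicator_def)
    then show ?thesis using integral_borel_eq_0[OF cf(1) f 0 B(1)] by simp
  qed
  have i: "integrable circle (\<lambda>t. f t * of_real (indicator A t))" if "A \<in> sets circle" for A
    by (rule Bochner_Integration.integrable_bound[OF f]) (use that in \<open>auto simp: norm_mult indicator_def\<close>)
  have "AE t in circle. Re (f t) = 0"
  proof (rule density_unique_real)
    fix A assume A: "A \<in> sets circle"
    have "(LINT t:A|circle. Re (f t)) = (LINT t|circle. Re (f t * of_real (indicator A t)))"
      unfolding set_lebesgue_integral_def by (simp add: mult.commute)
    also have "\<dots> = 0" using i[OF A] z[OF A] by (subst integral_Re) auto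
    finally show "(LINT t:A|circle. Re (f t)) = (LINT t:A|circle. 0)" by (simp add: set_lebesgue_integral_def)
  qed (use f in auto)
  moreover have "AE t in circle. Im (f t) = 0"
  proof (rule density_unique_real)
    fix A assume A: "A \<in> sets circle"
    have "(LINT t:A|circle. Im (f t)) = (LINT t|circle. Im (f t * of_real (indicator A t)))"
      unfolding set_lebesgue_integral_def by (simp add: mult.commute)
    also have "\<dots> = 0" using i[OF A] z[OF A] by (subst integral_Im) auto
    finally show "(LINT t:A|circle. Im (f t)) = (LINT t:A|circle. 0)" by (simp add: set_lebesgue_integral_def)
  qed (use f in auto)
  ultimately have "AE t in circle. f t = 0"
    by eventually_elim (simp add: complex_eq_iff)
  then show ?thesis unfolding cf(2) zero_circle_fun_def by (simp add: cf_eq_iff)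
qed

section \<open>Closed subspaces of Lebesgue spaces and annihilators\<close>

lemma Lp_complete:
  assumes p: "1 < p" and F: "\<And>n::nat. F n \<in> Lp p"
    and C: "\<And>e. e > 0 \<Longrightarrow> \<exists>N. \<forall>m\<ge>N. \<forall>n\<ge>N. Lp_norm p (F m - F n) < e"
  obtains f where "f \<in> Lp p" "(\<lambda>n. Lp_norm p (F n - f)) \<longlonglongrightarrow> 0"
proof -
  have "\<forall>n. \<exists>g. g \<in> borel_measurable circle \<and> F n = cf g"
    by (metis cf_cases)
  then obtain G where G[measurable]: "\<And>n. G n \<in> borel_measurable circle" and FG: "\<And>n. F n = cf (G n)" by metis
  have "\<exists>f \<in> borel_measurable circle. integrable circle (\<lambda>x. norm (f x) powr p) \<and>
     (\<lambda>n. Lpn circle p (\<lambda>x. G n x - f x)) \<longlonglongrightarrow> 0"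
    using F C by (intro circle.Lpn_complete G p) (auto simp: FG in_Lp_cf cf_simps Lp_norm_cf)
  then obtain f where [measurable]: "f \<in> borel_measurable circle" and
    "integrable circle (\<lambda>x. norm (f x) powr p)" "(\<lambda>n. Lpn circle p (\<lambda>x. G n x - f x)) \<longlonglongrightarrow> 0" by blast
  then show ?thesis by (intro that[of "cf f"]) (auto simp: FG in_Lp_cf cf_simps Lp_norm_cf)
qed

lemma dual_powr_continuous:
  assumes "1 < p"
  shows "isCont (dual_powr p) z"
proof (cases "z = 0")
  case True
  have "((\<lambda>z::complex. norm z powr (p - 1)) \<longlongrightarrow> norm (0::complex) powr (p - 1)) (at 0)"
    using assms by (intro tendsto_powr2 tendsto_intros) auto
  then have "((\<lambda>z. norm (dual_powr p z)) \<longlongrightarrow> 0) (at 0)" by (simp add: norm_dual_powr)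
  then have "(dual_powr p \<longlongrightarrow> 0) (at 0)" by (rule tendsto_norm_zero_cancel)
  then show ?thesis using True by (simp add: isCont_def dual_powr_def)
next
  case False
  then show ?thesis unfolding dual_powr_def[abs_def]
    by (intro continuous_intros) auto
qed

lemma dual_powr_measurable [measurable]: "1 < p \<Longrightarrow> dual_powr p \<in> borel_measurable borel"
  by (intro borel_measurable_continuous_onI continuous_at_imp_continuous_on ballI dual_powr_continuous)

text \<open>Differentiation under the integral is avoided: the tangent inequality at the perturbed
  point \<open>F + \<tau> s\<close> bounds the nonnegative increment of the norm from above by a
  multiple of the pairing there. Dominated convergence then lets \<tau> tend to 0.\<close>

lemma norm_minimal_variation:
  fixes F s :: "'a \<Rightarrow> complex"
  assumes p: "1 < p" and [measurable]: "F \<in> borel_measurable M" "s \<in> borel_measurable M"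
    and F: "integrable M (\<lambda>x. norm (F x) powr p)" and s: "integrable M (\<lambda>x. norm (s x) powr p)"
    and min: "\<And>\<tau>::real. 0 < \<tau> \<Longrightarrow> (LINT x|M. norm (F x) powr p) \<le> (LINT x|M. norm (F x + of_real \<tau> * s x) powr p)"
  shows "0 \<le> Re (LINT x|M. dual_powr p (F x) * s x)"
proof -
  note [measurable] = dual_powr_measurable[OF p]
  define w where "w x = (norm (F x) + norm (s x)) powr p" for x
  have iF: "integrable M (\<lambda>x. norm (F x + of_real \<tau> * s x) powr p)" for \<tau>
    using p F s by (intro integrable_powr_add) (auto simp: norm_mult powr_mult)
  have "integrable M (\<lambda>x. norm (of_real (norm (F x)) + of_real (norm (s x)) :: complex) powr p)"
    using p F s by (intro integrable_powr_add) auto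
  then have w: "integrable M w" unfolding w_def of_real_add[symmetric] norm_of_real by simp
  have bd: "norm (dual_powr p (F x + of_real \<tau> * s x) * s x) \<le> w x" if "0 \<le> \<tau>" "\<tau> \<le> 1" for \<tau> x
  proof -
    have "norm (of_real \<tau> * s x) \<le> norm (s x)" using that by (simp add: norm_mult mult_left_le_one_le)
    then have "norm (F x + of_real \<tau> * s x) \<le> norm (F x) + norm (s x)"
      by (intro order_trans[OF norm_triangle_ineq]) simp
    then have "norm (dual_powr p (F x + of_real \<tau> * s x) * s x) \<le> (norm (F x) + norm (s x)) powr (p - 1) * (norm (F x) + norm (s x))"
      using p unfolding norm_mult norm_dual_powr by (intro mult_mono powr_mono2) auto
    also have "\<dots> = w x"
      by (cases "norm (F x) + norm (s x) = 0") (simp_all add: w_def powr_mult_base[symmetric] powr_diff)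
    finally show ?thesis .
  qed
  have i: "integrable M (\<lambda>x. dual_powr p (F x + of_real \<tau> * s x) * s x)" if "0 \<le> \<tau>" "\<tau> \<le> 1" for \<tau>
    by (rule Bochner_Integration.integrable_bound[OF w])
       (use bd[OF that] in \<open>auto intro: order_trans[OF _ abs_ge_self]\<close>)
  have pos: "0 \<le> Re (LINT x|M. dual_powr p (F x + of_real \<tau> * s x) * s x)" if \<tau>: "0 < \<tau>" "\<tau> \<le> 1" for \<tau>
  proof -
    have "0 \<le> (LINT x|M. norm (F x + of_real \<tau> * s x) powr p) - (LINT x|M. norm (F x) powr p)"
      using min[OF \<tau>(1)] by simp
    also have "\<dots> = (LINT x|M. norm (F x + of_real \<tau> * s x) powr p - norm (F x) powr p)"
      using iF F by simp
    also have "\<dots> \<le> (LINT x|M. p * \<tau> * Re (dual_powr p (F x + of_real \<tau> * s x) * s x))"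
    proof (rule integral_mono)
      fix x
      have "p * Re (dual_powr p (F x + of_real \<tau> * s x) * (F x - (F x + of_real \<tau> * s x)))
          = - (p * \<tau> * Re (dual_powr p (F x + of_real \<tau> * s x) * s x))"
        by (simp add: algebra_simps)
      then show "norm (F x + of_real \<tau> * s x) powr p - norm (F x) powr p \<le> p * \<tau> * Re (dual_powr p (F x + of_real \<tau> * s x) * s x)"
        using powr_tangent[OF p, of "F x + of_real \<tau> * s x" "F x"] by linarith
      show "integrable M (\<lambda>x. p * \<tau> * Re (dual_powr p (F x + of_real \<tau> * s x) * s x))"
        using i[of \<tau>] \<tau> by (intro integrable_mult_right integrable_Re) auto
    qed (use iF F in auto)
    also have "\<dots> = p * \<tau> * Re (LINT x|M. dual_powr p (F x + of_real \<tau> * s x) * s x)"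
      using i[of \<tau>] \<tau> by (simp only: integral_mult_right_zero integral_Re)
    finally have "0 \<le> p * \<tau> * Re (LINT x|M. dual_powr p (F x + of_real \<tau> * s x) * s x)" .
    moreover have "0 < p * \<tau>" using p \<tau> by simp
    ultimately show ?thesis by (metis mult_le_cancel_left_pos mult_zero_right)
  qed
  define \<tau> where "\<tau> n = inverse (real (Suc n))" for n
  have \<tau>: "0 < \<tau> n" "\<tau> n \<le> 1" for n by (auto simp: \<tau>_def field_simps)
  have \<tau>0: "\<tau> \<longlonglongrightarrow> 0" unfolding \<tau>_def by (rule LIMSEQ_inverse_real_of_nat)
  have "(\<lambda>n. LINT x|M. dual_powr p (F x + of_real (\<tau> n) * s x) * s x) \<longlonglongrightarrow> (LINT x|M. dual_powr p (F x) * s x)"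
  proof (rule integral_dominated_convergence[OF _ _ w])
    have "(\<lambda>n. F x + of_real (\<tau> n) * s x) \<longlonglongrightarrow> F x + of_real 0 * s x" for x
      by (intro tendsto_intros \<tau>0)
    then show "AE x in M. (\<lambda>n. dual_powr p (F x + of_real (\<tau> n) * s x) * s x) \<longlonglongrightarrow> dual_powr p (F x) * s x"
      by (intro AE_I2 tendsto_intros isCont_tendsto_compose[OF dual_powr_continuous[OF p]]) simp
    show "AE x in M. norm (dual_powr p (F x + of_real (\<tau> n) * s x) * s x) \<le> w x" for n
      using bd[of "\<tau> n"] \<tau>[of n] by (intro AE_I2) auto
  qed measurable
  then have "(\<lambda>n. Re (LINT x|M. dual_powr p (F x + of_real (\<tau> n) * s x) * s x)) \<longlonglongrightarrow> Re (LINT x|M. dual_powr p (F x) * s x)"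
    by (rule tendsto_Re)
  then show ?thesis using pos \<tau> by (intro LIMSEQ_le_const[of _ _ 0]) auto
qed

lemma dual_powr_comp_measurable:
  "f \<in> borel_measurable M \<Longrightarrow> (\<lambda>t. if 1 < p then dual_powr p (f t) else 0) \<in> borel_measurable M"
  by (cases "1 < p") (simp_all add: measurable_compose[OF _ dual_powr_measurable])

text \<open>The value 0 for \<open>p \<le> 1\<close> makes the lifting total; measurability of
  \<open>dual_powr p\<close> is derived from its continuity, which is proved for
  \<open>1 < p\<close>.\<close>

lift_definition dual_cf :: "real \<Rightarrow> circle_fun \<Rightarrow> circle_fun" is
  "\<lambda>p f t. if 1 < p then dual_powr p (f t) else 0"
  by (auto simp: circle_ae_eq_def elim!: eventually_mono intro!: dual_powr_comp_measurable simp del: if_split)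

lemma dual_cf_cf: "1 < p \<Longrightarrow> f \<in> borel_measurable circle \<Longrightarrow> dual_cf p (cf f) = cf (\<lambda>t. dual_powr p (f t))"
  by (simp add: dual_cf.abs_eq)

lemma dual_cf_Lp:
  assumes "1 < p" "1/p + 1/q = 1" "x \<in> Lp p"
  shows "dual_cf p x \<in> Lp q"
proof (cases x)
  case (cf f)
  note [measurable] = cf(1) dual_powr_measurable[OF assms(1)]
  have "(p - 1) * q = p" by (rule conjugate_exponent[OF assms(1,2)])
  then show ?thesis using assms unfolding cf(2)
    by (simp add: dual_cf_cf in_Lp_cf norm_dual_powr powr_powr)
qed

lemma cint_dual_cf: "1 < p \<Longrightarrow> cint (dual_cf p x * x) = of_real (Lp_norm p x powr p)"
proof (cases x)
  case (cf f)
  assume p: "1 < p"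
  note [measurable] = cf(1) dual_powr_measurable[OF p]
  show ?thesis using p unfolding cf(2)
    by (simp add: dual_cf_cf cf_simps dual_powr_mult Lp_norm_cf Lpn_powr)
qed

lemma dual_cf_variation:
  assumes p: "1 < p" and F: "F \<in> Lp p" and s: "s \<in> Lp p"
    and min: "\<And>\<tau>::real. 0 < \<tau> \<Longrightarrow> Lp_norm p F \<le> Lp_norm p (F + of_real \<tau> *\<^sub>C s)"
  shows "0 \<le> Re (cint (dual_cf p F * s))"
proof -
  obtain f g where [measurable]: "f \<in> borel_measurable circle" "g \<in> borel_measurable circle"
    and Fs: "F = cf f" "s = cf g" by (cases F; cases s) auto
  note [measurable] = dual_powr_measurable[OF p]
  have "0 \<le> Re (LINT x|circle. dual_powr p (f x) * g x)"
  proof (rule norm_minimal_variation[OF p])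
    fix \<tau> :: real assume "0 < \<tau>"
    from min[OF this] have "Lpn circle p f \<le> Lpn circle p (\<lambda>x. f x + of_real \<tau> * g x)"
      by (simp add: Fs cf_simps Lp_norm_cf)
    then show "(LINT x|circle. norm (f x) powr p) \<le> (LINT x|circle. norm (f x + of_real \<tau> * g x) powr p)"
      using p Lpn_nonneg by (subst (asm) Lpn_le_iff) (auto simp: Lpn_powr)
  qed (use F s in \<open>auto simp: Fs in_Lp_cf\<close>)
  then show ?thesis using p by (simp add: Fs dual_cf_cf cf_simps)
qed

lemma Lp_norm_uniformly_convex:
  assumes p: "1 < p" and e: "0 < e"
  shows "\<exists>C\<ge>0. \<forall>x\<in>Lp p. \<forall>y\<in>Lp p. Lp_norm p (x - y) powr p \<le> e * (Lp_norm p x powr p + Lp_norm p y powr p)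
     + C * ((Lp_norm p x powr p + Lp_norm p y powr p) / 2 - Lp_norm p ((1/2) *\<^sub>C (x + y)) powr p)"
proof -
  obtain C where C: "C \<ge> 0" "\<And>a b :: complex. norm (a - b) powr p \<le> e * (norm a powr p + norm b powr p)
     + C * ((norm a powr p + norm b powr p) / 2 - norm ((a + b) / 2) powr p)"
    using powr_uniformly_convex[OF p e] by blast
  have "Lp_norm p (x - y) powr p \<le> e * (Lp_norm p x powr p + Lp_norm p y powr p)
     + C * ((Lp_norm p x powr p + Lp_norm p y powr p) / 2 - Lp_norm p ((1/2) *\<^sub>C (x + y)) powr p)"
    if x: "x \<in> Lp p" and y: "y \<in> Lp p" for x y
  proof -
    obtain f g where [measurable]: "f \<in> borel_measurable circle" "g \<in> borel_measurable circle"
      and xy: "x = cf f" "y = cf g" by (cases x; cases y) auto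
    have i: "integrable circle (\<lambda>t. norm (f t) powr p)" "integrable circle (\<lambda>t. norm (g t) powr p)"
      using x y by (auto simp: xy in_Lp_cf)
    have im: "integrable circle (\<lambda>t. norm ((f t + g t) / 2) powr p)"
      using integrable_powr_add[OF _ _ _ i] p by (simp add: norm_divide powr_divide)
    have id: "integrable circle (\<lambda>t. norm (f t - g t) powr p)"
      using integrable_powr_add[of f circle "\<lambda>t. - g t" p] p i by simp
    have "(LINT t|circle. norm (f t - g t) powr p) \<le> (LINT t|circle. e * (norm (f t) powr p + norm (g t) powr p)
     + C * ((norm (f t) powr p + norm (g t) powr p) / 2 - norm ((f t + g t) / 2) powr p))"
      by (intro integral_mono C id Bochner_Integration.integrable_add integrable_mult_right Bochner_Integration.integrable_diff
        integrable_divide_zero im i)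
    also have "\<dots> = e * ((LINT t|circle. norm (f t) powr p) + (LINT t|circle. norm (g t) powr p))
     + C * (((LINT t|circle. norm (f t) powr p) + (LINT t|circle. norm (g t) powr p)) / 2 - (LINT t|circle. norm ((f t + g t) / 2) powr p))"
      using i im by (simp del: norm_divide)
    finally show ?thesis using p by (simp add: xy cf_simps Lp_norm_cf Lpn_powr)
  qed
  then show ?thesis using C(1) by blast
qed

locale closed_Lp_subspace =
  fixes p :: real and S :: "circle_fun set"
  assumes p: "1 < p" and subset: "S \<subseteq> Lp p" and zero: "0 \<in> S"
    and add: "x \<in> S \<Longrightarrow> y \<in> S \<Longrightarrow> x + y \<in> S"
    and smult: "x \<in> S \<Longrightarrow> z *\<^sub>C x \<in> S"
    and closed: "(\<And>k::nat. g k \<in> S) \<Longrightarrow> y \<in> Lp p \<Longrightarrow> (\<lambda>k. Lp_norm p (g k - y)) \<longlonglongrightarrow> 0 \<Longrightarrow> y \<in> S"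
begin

text \<open>For a minimising sequence the midpoint of two residuals is the residual of a point of
  \<open>S\<close>, so its norm cannot fall below the infimum. The midpoint defect therefore tends
  to 0, and uniform convexity makes the residuals a Cauchy sequence.\<close>

lemma nearest_point:
  assumes f: "f \<in> Lp p"
  obtains s where "s \<in> S" "\<And>r. r \<in> S \<Longrightarrow> Lp_norm p (f - s) \<le> Lp_norm p (f - r)"
proof -
  have p0: "0 < p" "1 \<le> p" using p by auto
  define N where "N x = Lp_norm p x powr p" for x
  define d where "d = (INF s\<in>S. N (f - s))"
  have bdd: "bdd_below ((\<lambda>s. N (f - s)) ` S)" by (rule bdd_belowI[of _ 0]) (auto simp: N_def)
  have d0: "0 \<le> d" unfolding d_def using zero by (intro cINF_greatest) (auto simp: N_def)
  have d_le: "d \<le> N (f - s)" if "s \<in> S" for s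
    unfolding d_def by (rule cINF_lower[OF bdd that])
  have "\<exists>s\<in>S. N (f - s) < d + inverse (real (Suc n))" for n
    using cINF_less_iff[OF _ bdd, of "d + inverse (real (Suc n))"] zero by (auto simp: d_def[symmetric])
  then obtain s where s: "\<And>n. s n \<in> S" "\<And>n. N (f - s n) < d + inverse (real (Suc n))" by metis
  have fs: "f - s n \<in> Lp p" for n using f s subset p0 by (intro Lp_diff) auto
  have cauchy: "\<exists>M. \<forall>m\<ge>M. \<forall>n\<ge>M. Lp_norm p ((f - s m) - (f - s n)) < \<delta>" if \<delta>: "\<delta> > 0" for \<delta>
  proof -
    \<comment> \<open>The residual powers are at most \<open>d + 1\<close>, so the
      \<open>e\<close>-term contributes half of \<open>\<delta> powr p\<close>; the index
      \<open>M\<close> is chosen so that the defect term contributes at most a quarter.\<close>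
    define e where "e = \<delta> powr p / (4 * (d + 1))"
    have e: "e > 0" using \<delta> d0 by (simp add: e_def)
    obtain C where C: "C \<ge> 0" "\<And>x y. x \<in> Lp p \<Longrightarrow> y \<in> Lp p \<Longrightarrow> N (x - y) \<le> e * (N x + N y)
        + C * ((N x + N y) / 2 - N ((1/2) *\<^sub>C (x + y)))"
      unfolding N_def using Lp_norm_uniformly_convex[OF p e] by blast
    obtain M where M: "inverse (real (Suc M)) < \<delta> powr p / (4 * (C + 1))"
      using reals_Archimedean[of "\<delta> powr p / (4 * (C + 1))"] \<delta> C(1) by auto
    have "Lp_norm p ((f - s m) - (f - s n)) < \<delta>" if mn: "m \<ge> M" "n \<ge> M" for m n
    proof -
      have inv: "inverse (real (Suc k)) \<le> inverse (real (Suc M))" "inverse (real (Suc k)) \<le> 1" if "k \<ge> M" for k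
        using that by (auto simp: field_simps)
      have "(1/2) *\<^sub>C ((f - s m) + (f - s n)) = f - (1/2) *\<^sub>C (s m + s n)"
      proof -
        have "(1/2) *\<^sub>C (f + f) = f" unfolding circle_fun.scale_right_distrib circle_fun.scale_left_distrib[symmetric] by simp
        then have "f - (1/2) *\<^sub>C (s m + s n) = (1/2) *\<^sub>C (f + f) - (1/2) *\<^sub>C (s m + s n)" by simp
        also have "\<dots> = (1/2) *\<^sub>C ((f - s m) + (f - s n))"
          unfolding circle_fun.scale_right_diff_distrib[symmetric] by (simp add: algebra_simps)
        finally show ?thesis ..
      qed
      then have mid: "d \<le> N ((1/2) *\<^sub>C ((f - s m) + (f - s n)))"
        using d_le[of "(1/2) *\<^sub>C (s m + s n)"] s add smult by auto
      have "N ((f - s m) - (f - s n)) \<le> e * (N (f - s m) + N (f - s n))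
        + C * ((N (f - s m) + N (f - s n)) / 2 - N ((1/2) *\<^sub>C ((f - s m) + (f - s n))))"
        by (rule C fs)+
      also have "\<dots> \<le> e * (2 * (d + 1)) + C * inverse (real (Suc M))"
      proof (intro add_mono mult_left_mono)
        have N: "N (f - s k) \<le> d + inverse (real (Suc M))" "N (f - s k) \<le> d + 1" if "k \<ge> M" for k
          using less_imp_le[OF s(2)[of k]] inv[OF that] by (auto intro: order_trans simp del: of_nat_Suc)
        show "N (f - s m) + N (f - s n) \<le> 2 * (d + 1)"
          using N(2)[OF mn(1)] N(2)[OF mn(2)] by simp
        show "(N (f - s m) + N (f - s n)) / 2 - N ((1/2) *\<^sub>C ((f - s m) + (f - s n))) \<le> inverse (real (Suc M))"
          using mid N(1)[OF mn(1)] N(1)[OF mn(2)] by argo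
      qed (use e C in auto)
      also have "e * (2 * (d + 1)) = \<delta> powr p / 2"
      proof -
        have half: "x / (4 * D) * (2 * D) = x / 2" if "D > 0" for x D :: real using that by simp
        show ?thesis unfolding e_def by (rule half) (use d0 in simp)
      qed
      also have "C * inverse (real (Suc M)) \<le> (C + 1) * (\<delta> powr p / (4 * (C + 1)))"
        using M C(1) by (intro mult_mono) auto
      also have "(C + 1) * (\<delta> powr p / (4 * (C + 1))) = \<delta> powr p / 4" using C(1) by (simp add: field_simps)
      also have "\<delta> powr p / 2 + \<delta> powr p / 4 < \<delta> powr p" using \<delta> by simp
      finally have "Lp_norm p ((f - s m) - (f - s n)) powr p < \<delta> powr p" by (simp add: N_def)
      moreover have "\<delta> powr p \<le> Lp_norm p ((f - s m) - (f - s n)) powr p" if "\<not> ?thesis"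
        using that p0 \<delta> by (intro powr_mono2) auto
      ultimately show ?thesis by linarith
    qed
    then show ?thesis by blast
  qed
  obtain F where F: "F \<in> Lp p" "(\<lambda>n. Lp_norm p ((f - s n) - F)) \<longlonglongrightarrow> 0"
    using Lp_complete[OF p fs cauchy] by blast
  have sF: "f - F \<in> S"
  proof (rule closed[of s])
    show "(\<lambda>k. Lp_norm p (s k - (f - F))) \<longlonglongrightarrow> 0"
      using F(2) by (subst Lp_norm_diff_commute) (simp add: algebra_simps)
  qed (use s f F p0 in \<open>auto intro: Lp_diff\<close>)
  have "Lp_norm p F \<le> Lp_norm p (f - r)" if "r \<in> S" for r
  proof -
    have "Lp_norm p F \<le> (d + inverse (real (Suc n))) powr (1/p) + Lp_norm p ((f - s n) - F)" for n
    proof -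
      have "Lp_norm p F \<le> Lp_norm p (f - s n) + Lp_norm p (F - (f - s n))"
        using Lp_norm_triangle[of p "f - s n" "F - (f - s n)"] p0 fs[of n] F(1) by (simp add: Lp_diff)
      also have "Lp_norm p (f - s n) = N (f - s n) powr (1/p)" using p0 by (simp add: N_def powr_powr)
      also have "\<dots> \<le> (d + inverse (real (Suc n))) powr (1/p)"
        using s(2)[of n] p0 by (intro powr_mono2) (auto simp: N_def)
      finally show ?thesis by (simp add: Lp_norm_diff_commute[of p F])
    qed
    moreover have "(\<lambda>n. (d + inverse (real (Suc n))) powr (1/p) + Lp_norm p ((f - s n) - F)) \<longlonglongrightarrow> (d + 0) powr (1/p) + 0"
      using p0 d0 by (intro tendsto_add tendsto_powr2 F(2) tendsto_const LIMSEQ_inverse_real_of_nat)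
        (auto intro!: always_eventually)
    ultimately have "Lp_norm p F \<le> d powr (1/p)" by (intro LIMSEQ_le_const[of _ "d powr (1/p)"]) auto
    also have "\<dots> \<le> N (f - r) powr (1/p)"
      using d_le[OF that] p0 d0 by (intro powr_mono2) auto
    also have "\<dots> = Lp_norm p (f - r)" using p0 by (simp add: N_def powr_powr)
    finally show ?thesis .
  qed
  then show ?thesis using that[OF sF] by simp
qed

text \<open>A concrete Hahn-Banach functional: the residual \<open>F\<close> at a nearest point
  cannot be shortened in any direction of \<open>S\<close>, so its dual function annihilates
  \<open>S\<close>, while its pairing with \<open>F\<close> is the p-th power of the norm of
  \<open>F\<close>.\<close>

theorem annihilator:
  assumes q: "1/p + 1/q = 1" and f: "f \<in> Lp p" "f \<notin> S"
  obtains k where "k \<in> Lp q" "cint (k * f) \<noteq> 0" "\<And>s. s \<in> S \<Longrightarrow> cint (k * s) = 0"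
proof -
  have p0: "0 < p" "1 \<le> p" using p by auto
  obtain s0 where s0: "s0 \<in> S" "\<And>r. r \<in> S \<Longrightarrow> Lp_norm p (f - s0) \<le> Lp_norm p (f - r)"
    using nearest_point[OF f(1)] by blast
  define F where "F = f - s0"
  have F: "F \<in> Lp p" using f s0 subset p0 by (auto simp: F_def intro: Lp_diff)
  define k where "k = dual_cf p F"
  have k: "k \<in> Lp q" unfolding k_def by (rule dual_cf_Lp[OF p q F])
  have Re: "0 \<le> Re (cint (k * s))" if s: "s \<in> S" for s
    unfolding k_def
  proof (rule dual_cf_variation[OF p F])
    fix \<tau> :: real
    have "s0 + (- of_real \<tau>) *\<^sub>C s \<in> S" using s s0 by (intro add smult)
    from s0(2)[OF this] show "Lp_norm p F \<le> Lp_norm p (F + of_real \<tau> *\<^sub>C s)"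
      by (simp add: F_def circle_fun.scale_minus_left algebra_simps)
  qed (use s subset in auto)
  have ann: "cint (k * s) = 0" if s: "s \<in> S" for s
  proof -
    have "0 \<le> Re (z * cint (k * s))" for z
      using Re[OF smult[OF s, of z]] by (simp add: cint_smult)
    from this[of 1] this[of "-1"] this[of \<i>] this[of "-\<i>"] show ?thesis by (simp add: complex_eq_iff)
  qed
  have "F \<noteq> 0" using f s0 by (auto simp: F_def)
  then have "Lp_norm p F \<noteq> 0" using Lp_norm_eq_0[OF p0(1) F] by auto
  then have "cint (k * F) \<noteq> 0" unfolding k_def cint_dual_cf[OF p] by simp
  moreover have "f = s0 + F" by (simp add: F_def)
  then have "cint (k * f) = cint (k * s0) + cint (k * F)"
    using Lp_mult_1(1)[OF p q, of s0 k] Lp_mult_1(1)[OF p q, of F k] k F s0 subset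
    by (auto simp: distrib_left mult.commute[of _ k] intro!: cint_add)
  ultimately have "cint (k * f) \<noteq> 0" using ann[OF s0(1)] by simp
  then show ?thesis using that k ann by blast
qed

end

section \<open>Analytic polynomials and Calderon's inequality\<close>

lemma integral_circle_mean_value:
  assumes "continuous_on (cball 0 1) f" "f holomorphic_on ball 0 1"
  shows "(LINT t|circle. f t) = f 0"
proof -
  have cs: "continuous_on (sphere 0 1) f"
    using assms(1) by (rule continuous_on_subset) auto
  have m[measurable]: "f \<in> borel_measurable circle"
    by (rule borel_measurable_circle_continuous[OF cs])
  have "((\<lambda>u. f u / (u - 0)) has_contour_integral (2 * of_real pi * \<i> * f 0)) (circlepath 0 1)"
    using assms by (intro Cauchy_integral_circlepath) auto
  then have "((\<lambda>u. f u / u) has_contour_integral (2 * of_real pi * \<i> * f 0)) (part_circlepath 0 1 0 (2*pi))"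
    by (simp add: circlepath_def)
  then have "((\<lambda>x. f (cis x) / cis x * 1 * \<i> * cis x) has_integral (2 * of_real pi * \<i> * f 0)) {0..2*pi}"
    by (subst (asm) has_contour_integral_part_circlepath_iff) (auto simp: mult_ac)
  then have "((\<lambda>x. (1/\<i>) * (f (cis x) / cis x * 1 * \<i> * cis x)) has_integral (1/\<i>) * (2 * of_real pi * \<i> * f 0)) {0..2*pi}"
    by (rule has_integral_mult_right)
  moreover have "(1/\<i>) * (f (cis x) / cis x * 1 * \<i> * cis x) = f (cis x)" for x
    by (simp add: field_simps)
  moreover have "(1/\<i>) * (2 * of_real pi * \<i> * f 0) = 2 * of_real pi * f 0"
    by (simp add: field_simps)
  ultimately have hi: "((\<lambda>x. f (cis x)) has_integral (2 * of_real pi * f 0)) {0..2*pi}"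
    by (simp only:)
  have "continuous_on {0..2*pi} (\<lambda>x. f (cis x))"
    by (rule continuous_on_compose2[OF cs]) (auto intro!: continuous_intros)
  then have "set_integrable lborel {0..2*pi} (\<lambda>x. f (cis x))"
    by (rule borel_integrable_atLeastAtMost')
  then have "(LBINT x:{0..2*pi}. f (cis x)) = integral {0..2*pi} (\<lambda>x. f (cis x))"
    by (rule set_borel_integral_eq_integral)
  also have "\<dots> = 2 * of_real pi * f 0" using hi by (rule integral_unique)
  finally show ?thesis by (simp add: integral_circle)
qed

lemma continuous_circle_bounded:
  assumes "continuous_on (sphere 0 1) (f :: complex \<Rightarrow> 'a::real_normed_vector)"
  obtains B where "0 \<le> B" "AE t in circle. norm (f t) \<le> B"
proof -
  have "compact (f ` sphere 0 1)" by (intro compact_continuous_image assms compact_sphere)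
  then obtain B where B: "B > 0" "\<And>x. x \<in> f ` sphere 0 1 \<Longrightarrow> norm x \<le> B"
    using compact_imp_bounded bounded_pos by metis
  then show ?thesis by (intro that[of B] AE_I2) (auto simp: space_circle)
qed

lemma integrable_circle_continuous:
  assumes "continuous_on (sphere 0 1) (f :: complex \<Rightarrow> 'a::{banach,second_countable_topology})"
  shows "integrable circle f"
proof -
  obtain B where B: "0 \<le> B" "AE t in circle. norm (f t) \<le> B"
    using continuous_circle_bounded[OF assms] .
  then show ?thesis by (intro circle.integrable_const_bound[of _ B] borel_measurable_circle_continuous assms) auto
qed

lemma cf_continuous_Linf:
  assumes "continuous_on (sphere 0 1) f"
  shows "cf f \<in> Linf"
proof -
  obtain B where "0 \<le> B" "AE t in circle. norm (f t) \<le> B"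
    using continuous_circle_bounded[OF assms] .
  then show ?thesis using assms by (auto simp: cf_Linf borel_measurable_circle_continuous)
qed

text \<open>The angle \<open>c\<close> in the proof is such that \<open>cos (p x) < 0\<close> for \<open>c \<le> |x| < pi / 2\<close>; this is possible
  because \<open>1 < p \<le> 2\<close>.\<close>

lemma calderon_pointwise:
  assumes p: "1 < p" "p \<le> (2::real)"
  obtains A B where "0 \<le> A" "0 \<le> B"
    "\<And>w::complex. 0 < Re w \<Longrightarrow> norm w powr p \<le> A * Re w powr p - B * Re (w powr of_real p)"
proof -
  \<comment> \<open>The midpoint of pi/(2p) and pi/2.\<close>
  define c where "c = pi * (1 + 1/p) / 4"
  have c: "0 < c" "c < pi/2" "pi/2 < p * c" "p * c < pi"
  proof -
    have pc: "p * c = pi * (p + 1) / 4" using p by (simp add: c_def field_simps)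
    show "0 < c" using p by (simp add: c_def add_pos_pos)
    have "pi * (1 + 1/p) < pi * 2" using p by (intro mult_strict_left_mono) auto
    then show "c < pi/2" by (simp add: c_def)
    have "pi * 2 < pi * (p + 1)" "pi * (p + 1) < pi * 4" using p by (intro mult_strict_left_mono; simp)+
    then show "pi/2 < p * c" "p * c < pi" unfolding pc by simp_all
  qed
  define m where "m = - cos (p * c)"
  have m: "0 < m" using cos_lt_zero_pi[of "p * c"] cos_monotone_0_pi[of "pi/2" "p * c"] c by (simp add: m_def)
  \<comment> \<open>Beyond the angle \<open>c\<close> the term \<open>- B * cos (p * x)\<close>
    alone is at least 1. Up to \<open>c\<close> it costs at most \<open>B\<close>, and
    \<open>A\<close> is chosen to pay for \<open>1 + B\<close>.\<close>
  define B where "B = 1 / m"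
  have B: "0 < B" using m by (simp add: B_def)
  have cc: "0 < cos c" using c by (intro cos_gt_zero_pi) auto
  define A where "A = (1 + B) / cos c powr p"
  have A: "0 < A" using B cc by (simp add: A_def)
  have key: "1 \<le> A * cos x powr p - B * cos (p * x)" if x: "0 \<le> x" "x < pi/2" for x
  proof (cases "x \<le> c")
    case True
    have "cos c \<le> cos x" using True x c by (intro cos_monotone_0_pi_le) auto
    then have "cos c powr p \<le> cos x powr p" using cc p by (intro powr_mono2) auto
    then have "(1 + B) * 1 \<le> (1 + B) * (cos x powr p / cos c powr p)"
      using B cc by (intro mult_left_mono) auto
    moreover have "B * cos (p * x) \<le> B * 1" using B by (intro mult_left_mono) auto
    ultimately show ?thesis by (simp add: A_def)
  next
    case False
    have "p * x \<le> 2 * (pi/2)" using p x by (intro mult_mono) auto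
    then have "cos (p * x) \<le> cos (p * c)" using False x c p by (intro cos_monotone_0_pi_le) auto
    then have "B * cos (p * x) \<le> B * (- m)" using B by (intro mult_left_mono) (auto simp: m_def)
    moreover have "B * (- m) = -1" using m by (simp add: B_def)
    moreover have "0 \<le> A * cos x powr p" using A by simp
    ultimately show ?thesis by linarith
  qed
  have "norm w powr p \<le> A * Re w powr p - B * Re (w powr of_real p)" if w: "0 < Re w" for w :: complex
  proof -
    have w0: "w \<noteq> 0" using w by auto
    define x where "x = Im (Ln w)"
    have x: "\<bar>x\<bar> < pi/2" unfolding x_def by (rule Re_Ln_pos_lt_imp[OF w])
    have polar: "Ln w = of_real (ln (norm w)) + \<i> * of_real x"
      using w0 by (simp add: complex_eq_iff x_def)
    have "w = exp (Ln w)" using w0 by simp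
    also have "\<dots> = of_real (norm w) * cis x"
      using w0 unfolding polar by (simp add: exp_add cis_conv_exp exp_of_real)
    finally have "Re w = Re (of_real (norm w) * cis x)" by simp
    then have Rew: "Re w = norm w * cos x" by simp
    have "w powr of_real p = exp (of_real (p * ln (norm w)) + \<i> * of_real (p * x))"
      using w0 by (simp add: powr_def polar algebra_simps)
    also have "\<dots> = of_real (exp (p * ln (norm w))) * cis (p * x)"
      unfolding exp_add cis_conv_exp by (simp only: exp_of_real)
    also have "exp (p * ln (norm w)) = norm w powr p" using w0 by (simp add: powr_def)
    finally have Rewp: "Re (w powr of_real p) = norm w powr p * cos (p * x)" by simp
    have cx: "cos x > 0" using x by (intro cos_gt_zero_pi) auto
    have "1 \<le> A * cos x powr p - B * cos (p * x)"
      using key[of "\<bar>x\<bar>"] x p by (cases "x \<ge> 0") auto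
    then have "norm w powr p * 1 \<le> norm w powr p * (A * cos x powr p - B * cos (p * x))"
      by (intro mult_left_mono) auto
    also have "\<dots> = A * (norm w * cos x) powr p - B * (norm w powr p * cos (p * x))"
      using cx by (simp add: powr_mult algebra_simps)
    finally show ?thesis by (simp add: Rew Rewp)
  qed
  then show ?thesis using that[of A B] A B by auto
qed

text \<open>The minimum principle for the harmonic function Re P, read off from the maximum modulus
  principle for exp (- P).\<close>

lemma Re_poly_pos_ball:
  fixes P :: "complex poly"
  assumes "\<And>t. norm t = 1 \<Longrightarrow> 0 < Re (poly P t)" and z: "norm z \<le> 1"
  shows "0 < Re (poly P z)"
proof -
  have "continuous_on (sphere 0 1) (\<lambda>t::complex. Re (poly P t))" by (intro continuous_intros)
  then obtain t where t: "norm t = 1" "\<And>s. norm s = 1 \<Longrightarrow> Re (poly P t) \<le> Re (poly P s)"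
    using continuous_attains_inf[of "sphere 0 1" "\<lambda>t::complex. Re (poly P t)"] by auto
  have "norm (exp (- poly P z)) \<le> exp (- Re (poly P t))"
  proof (rule maximum_modulus_frontier[of "\<lambda>z. exp (- poly P z)" "cball 0 1"])
    show "norm (exp (- poly P s)) \<le> exp (- Re (poly P t))" if "s \<in> frontier (cball 0 1)" for s
      using that t(2)[of s] by simp
  qed (use z in \<open>auto intro!: holomorphic_intros continuous_intros\<close>)
  then have "Re (poly P t) \<le> Re (poly P z)" by simp
  then show ?thesis using assms(1)[OF t(1)] by simp
qed

text \<open>\<open>P\<close> maps the disc into the right half plane, so its p-th power is
  holomorphic and has mean P(0)^p, a positive number since P(0) is real. When the pointwise
  inequality is integrated, the term with \<open>B\<close> can thus be dropped.\<close>

lemma calderon_positive: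
  assumes p: "1 < p" "p \<le> (2::real)"
  obtains A where "0 \<le> A"
    "\<And>P. (\<And>t. norm t = 1 \<Longrightarrow> 0 < Re (poly P t)) \<Longrightarrow> Im (poly P 0) = 0 \<Longrightarrow>
       Lp_norm p (cf (poly P)) \<le> A * Lp_norm p (cf (\<lambda>t. of_real (Re (poly P t))))"
proof -
  obtain A B where AB: "0 \<le> A" "0 \<le> B"
    "\<And>w::complex. 0 < Re w \<Longrightarrow> norm w powr p \<le> A * Re w powr p - B * Re (w powr of_real p)"
    using calderon_pointwise[OF p] by metis
  have "Lp_norm p (cf (poly P)) \<le> A powr (1/p) * Lp_norm p (cf (\<lambda>t. of_real (Re (poly P t))))"
    if pos: "\<And>t. norm t = 1 \<Longrightarrow> 0 < Re (poly P t)" and P0: "Im (poly P 0) = 0" for P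
  proof -
    have pos': "0 < Re (poly P z)" if "norm z \<le> 1" for z
      using Re_poly_pos_ball[OF pos] that by blast
    have nn: "poly P z \<notin> \<real>\<^sub>\<le>\<^sub>0" if "norm z \<le> 1" for z
      using pos'[OF that] by (auto simp: complex_nonpos_Reals_iff)
    have cont: "continuous_on (cball 0 1) (\<lambda>z. poly P z powr of_real p)"
    proof (rule continuous_on_powr_complex)
      show "cball 0 1 \<subseteq> {z. 0 \<le> Re (poly P z) \<or> Im (poly P z) \<noteq> 0}"
        using less_imp_le[OF pos'] by auto
    qed (use p in \<open>auto intro!: continuous_intros\<close>)
    have mv: "(LINT t|circle. poly P t powr of_real p) = poly P 0 powr of_real p"
      by (rule integral_circle_mean_value[OF cont])
         (use nn in \<open>auto intro!: holomorphic_intros\<close>)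
    have "poly P 0 = of_real (Re (poly P 0))" using P0 by (simp add: complex_eq_iff)
    then have "poly P 0 powr of_real p = of_real (Re (poly P 0) powr p)"
      using pos'[of 0] by (metis less_imp_le powr_of_real norm_zero zero_le_one)
    then have mvpos: "0 \<le> Re (poly P 0 powr of_real p)" by simp
    have cp: "continuous_on (sphere 0 1) (\<lambda>z. poly P z powr of_real p)"
      using cont by (rule continuous_on_subset) auto
    have i1: "integrable circle (\<lambda>t. poly P t powr of_real p)"
      by (rule integrable_circle_continuous[OF cp])
    have i2: "integrable circle (\<lambda>t. Re (poly P t) powr p)"
      by (rule integrable_circle_continuous) (use pos in \<open>force intro!: continuous_intros\<close>)
    have i3: "integrable circle (\<lambda>t. norm (poly P t) powr p)"
      by (rule integrable_circle_continuous) (use pos in \<open>force intro!: continuous_intros\<close>)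
    have "(LINT t|circle. norm (poly P t) powr p) \<le> (LINT t|circle. A * Re (poly P t) powr p - B * Re (poly P t powr of_real p))"
      by (intro integral_mono_AE i3 Bochner_Integration.integrable_diff integrable_mult_right i2 integrable_Re i1 AE_I2 AB pos)
         (simp add: space_circle)
    also have "\<dots> = A * (LINT t|circle. Re (poly P t) powr p) - B * Re (LINT t|circle. poly P t powr of_real p)"
      using i1 i2 by simp
    also have "\<dots> \<le> A * (LINT t|circle. Re (poly P t) powr p)"
      using mvpos AB by (simp add: mv)
    also have "(LINT t|circle. Re (poly P t) powr p) = (LINT t|circle. norm (complex_of_real (Re (poly P t))) powr p)"
      by (intro Bochner_Integration.integral_cong) (auto simp: space_circle pos less_imp_le abs_of_pos)
    finally have le: "(LINT t|circle. norm (poly P t) powr p) \<le> A * (LINT t|circle. norm (complex_of_real (Re (poly P t))) powr p)" .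
    have m: "poly P \<in> borel_measurable circle" "(\<lambda>t. complex_of_real (Re (poly P t))) \<in> borel_measurable circle"
      by (intro borel_measurable_circle_continuous continuous_intros)+
    show ?thesis
      unfolding Lp_norm_cf[OF m(1)] Lp_norm_cf[OF m(2)] Lpn_def
      using p AB le by (subst powr_mult[symmetric]) (auto intro!: powr_mono2)
  qed
  then show ?thesis using that[of "A powr (1/p)"] by simp
qed

lemma real_polynomial_Re_poly:
  fixes g :: "complex \<Rightarrow> real"
  assumes "real_polynomial_function g"
  obtains V where "Im (poly V 0) = 0" "\<And>t. norm t = 1 \<Longrightarrow> Re (poly V t) = g t"
proof -
  obtain G H where GH: "\<And>t. norm t = 1 \<Longrightarrow> of_real (g t) = poly G t + cnj (poly H t)"
    using harmonic_poly_real_polynomial[OF assms] by (auto simp: harmonic_poly_def)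
  have "Re (poly G t) + Re (poly H t) = g t" if "norm t = 1" for t
    using arg_cong[OF GH[OF that], of Re] by simp
  then show ?thesis
    by (intro that[of "G + H - [:\<i> * of_real (Im (poly (G + H) 0)):]"]) (simp_all)
qed

section \<open>The Riesz projection\<close>

lemma fourier_coeff_add: "x \<in> Lp 1 \<Longrightarrow> y \<in> Lp 1 \<Longrightarrow> fourier_coeff (x + y) n = fourier_coeff x n + fourier_coeff y n"
  by (simp add: fourier_coeff_eq distrib_left cint_add)

lemma fourier_coeff_diff: "x \<in> Lp 1 \<Longrightarrow> y \<in> Lp 1 \<Longrightarrow> fourier_coeff (x - y) n = fourier_coeff x n - fourier_coeff y n"
  by (simp add: fourier_coeff_eq right_diff_distrib cint_diff)

lemma fourier_coeff_smult [simp]: "fourier_coeff (z *\<^sub>C x) n = z * fourier_coeff x n"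
  by (simp add: fourier_coeff_eq cint_smult)

lemma fourier_coeff_minus [simp]: "fourier_coeff (- x) n = - fourier_coeff x n"
  by (simp only: minus_eq_smult fourier_coeff_smult) simp

lemma fourier_coeff_zero [simp]: "fourier_coeff 0 n = 0"
  by (simp add: fourier_coeff_eq)

lemma fourier_coeff_sum:
  "(\<And>i. i \<in> A \<Longrightarrow> f i \<in> Lp 1) \<Longrightarrow> fourier_coeff (sum f A) n = (\<Sum>i\<in>A. fourier_coeff (f i) n)"
  by (induction A rule: infinite_finite_induct) (auto simp: fourier_coeff_add Lp_sum)

lemma fourier_coeff_tpow_mult [simp]: "fourier_coeff (tpow k * x) n = fourier_coeff x (n - k)"
  by (simp add: fourier_coeff_eq mult.assoc[symmetric] tpow_add[symmetric])

lemma fourier_coeff_tpow: "fourier_coeff (tpow k) n = (if n = k then 1 else 0)"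
  by (simp add: fourier_coeff_eq tpow_add[symmetric] cint_tpow)

lemma fourier_coeff_1: "fourier_coeff 1 n = (if n = 0 then 1 else 0)"
  using fourier_coeff_tpow[of 0 n] by simp

lemma fourier_coeff_tilde [simp]: "fourier_coeff (tilde x) n = fourier_coeff x (- n)"
  using cint_tilde[of "tpow n * x"] by (simp add: fourier_coeff_eq)

lemma norm_fourier_coeff_le: "x \<in> Lp 1 \<Longrightarrow> norm (fourier_coeff x n) \<le> Lp_norm 1 x"
  using norm_cint_le[of "tpow (- n) * x"] by (simp add: fourier_coeff_eq)

lemma fourier_unique_eq:
  assumes "x \<in> Lp 1" "y \<in> Lp 1" "\<And>n. fourier_coeff x n = fourier_coeff y n"
  shows "x = y"
  using fourier_unique[of "x - y"] assms by (simp add: Lp_diff fourier_coeff_diff)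

text \<open>The functions approximable by trigonometric polynomials form a closed subspace; all
  Fourier coefficients of an annihilator vanish, so it is 0.\<close>

lemma trig_dense:
  assumes p: "1 < p" and x: "x \<in> Lp p" and e: "0 < e"
  obtains y where "y \<in> trig" "Lp_norm p (x - y) < e"
proof -
  define S where "S = {x \<in> Lp p. \<forall>e>0. \<exists>y\<in>trig. Lp_norm p (x - y) < e}"
  have p0: "0 < p" "1 \<le> p" using p by auto
  interpret closed_Lp_subspace p S
  proof
    show "0 \<in> S" by (auto simp: S_def intro!: bexI[of _ 0])
    show "x + y \<in> S" if xy: "x \<in> S" "y \<in> S" for x y
      unfolding S_def
    proof (safe)
      fix e :: real assume e: "0 < e"
      obtain a b where ab: "a \<in> trig" "Lp_norm p (x - a) < e/2" "b \<in> trig" "Lp_norm p (y - b) < e/2"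
        using xy half_gt_zero[OF e] unfolding S_def by blast
      have "x - a \<in> Lp p" "y - b \<in> Lp p" using xy ab p0 trig_Lp[OF p0(1)] by (auto simp: S_def intro!: Lp_diff)
      then have "Lp_norm p ((x - a) + (y - b)) < e"
        using Lp_norm_triangle[OF p0(2), of "x - a" "y - b"] ab by simp
      then show "\<exists>ya\<in>trig. Lp_norm p (x + y - ya) < e"
        using ab by (intro bexI[of _ "a + b"]) (auto simp: algebra_simps intro: trig_add)
    qed (use xy p0 in \<open>auto simp: S_def intro: Lp_add\<close>)
    show "z *\<^sub>C x \<in> S" if xS: "x \<in> S" for x z
      unfolding S_def
    proof (safe)
      fix e :: real assume e: "0 < e"
      have "0 < e / (norm z + 1)" using e by (simp add: add_nonneg_pos)
      then obtain a where a: "a \<in> trig" "Lp_norm p (x - a) < e / (norm z + 1)"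
        using xS unfolding S_def by blast
      have "norm z * Lp_norm p (x - a) \<le> (norm z + 1) * Lp_norm p (x - a)" by (simp add: mult_right_mono)
      also have "\<dots> < e"
      proof -
        have "0 < norm z + 1" by (simp add: add_nonneg_pos)
        then show ?thesis using a(2) by (metis mult.commute pos_less_divide_eq)
      qed
      finally have "Lp_norm p (z *\<^sub>C (x - a)) < e" using p0 by (simp add: Lp_norm_smult)
      then show "\<exists>y\<in>trig. Lp_norm p (z *\<^sub>C x - y) < e"
        using a by (intro bexI[of _ "z *\<^sub>C a"]) (auto simp: circle_fun.scale_right_diff_distrib intro: trig_smult)
    qed (use xS p0 in \<open>auto simp: S_def intro: Lp_smult\<close>)
    show "y \<in> S" if g: "\<And>k::nat. g k \<in> S" and y: "y \<in> Lp p" and l: "(\<lambda>k. Lp_norm p (g k - y)) \<longlonglongrightarrow> 0" for g y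
      unfolding S_def
    proof (safe)
      fix e :: real assume e: "0 < e"
      obtain k where k: "Lp_norm p (g k - y) < e/2"
        using order_tendstoD(2)[OF l half_gt_zero[OF e]] by (auto simp: eventually_sequentially)
      obtain a where a: "a \<in> trig" "Lp_norm p (g k - a) < e/2"
        using g[of k] half_gt_zero[OF e] unfolding S_def by blast
      have "Lp_norm p (y - a) \<le> Lp_norm p (y - g k) + Lp_norm p (g k - a)"
        using g[of k] a y p0 by (intro Lp_norm_triangle_diff) (auto simp: S_def intro: trig_Lp)
      then have "Lp_norm p (y - a) < e" using k a by (simp add: Lp_norm_diff_commute[of p y])
      then show "\<exists>ya\<in>trig. Lp_norm p (y - ya) < e" using a by blast
    qed (use y in simp)
  qed (use p in \<open>auto simp: S_def\<close>)
  have "x \<in> S"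
  proof (rule ccontr)
    assume nS: "x \<notin> S"
    define q where "q = p / (p - 1)"
    have q: "1/p + 1/q = 1" using p by (simp add: q_def field_simps)
    obtain k where k: "k \<in> Lp q" "cint (k * x) \<noteq> 0" "\<And>s. s \<in> S \<Longrightarrow> cint (k * s) = 0"
      using annihilator[OF q x nS] by blast
    have "tpow j \<in> S" for j
      using p0 by (auto simp: S_def intro!: trig_Lp bexI[of _ "tpow j"])
    then have "fourier_coeff k j = 0" for j
      using k(3)[of "tpow (-j)"] by (simp add: fourier_coeff_eq mult.commute)
    moreover have "k \<in> Lp 1" using k conjugate_exponent(1)[OF p q] by (intro Lp_le_1(1)[of q])
    ultimately have "k = 0" using fourier_unique by blast
    then show False using k by simp
  qed
  then show ?thesis using that e unfolding S_def by blast
qed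

section \<open>From positive real parts to all trigonometric polynomials\<close>

lemma cf_poly_Linf [simp]: "cf (poly G) \<in> Linf" "cf (\<lambda>t. cnj (poly G t)) \<in> Linf"
  "cf (\<lambda>t. complex_of_real (Re (poly G t))) \<in> Linf"
  by (intro cf_continuous_Linf continuous_intros)+

lemma Lp_norm_mono_continuous:
  assumes "0 < p" "continuous_on (sphere 0 1) f" "continuous_on (sphere 0 1) g"
    "\<And>t. norm t = 1 \<Longrightarrow> norm (f t) \<le> norm (g t)"
  shows "Lp_norm p (cf f) \<le> Lp_norm p (cf g)"
proof -
  have [measurable]: "f \<in> borel_measurable circle" "g \<in> borel_measurable circle"
    using assms by (auto intro: borel_measurable_circle_continuous)
  have "integrable circle (\<lambda>t. norm (g t) powr p)"
    using Linf_subset_Lp[OF assms(1) cf_continuous_Linf[OF assms(3)]] by (simp add: in_Lp_cf)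
  then show ?thesis using assms by (auto simp: Lp_norm_cf space_circle intro!: Lpn_mono AE_I2)
qed

lemma Lp_norm_const: "0 < p \<Longrightarrow> Lp_norm p (cf (\<lambda>t. c)) = norm c"
  by (simp add: Lp_norm_cf Lpn_def powr_powr circle.prob_space)

text \<open>The mean of E^2 is E(0)^2, which is nonnegative, so the L^2 norm of Im E is at most that
  of Re E and the square integral of E is at most 8 \<delta>^2. The bound x^p \<le> \<delta>^p +
  \<delta>^(p-2) x^2, valid for \<open>p \<le> 2\<close>, passes to the exponent \<open>p\<close>;
  the constant is 9 = 1 + 8.\<close>

lemma Lp_norm_poly_small:
  fixes E :: "complex poly"
  assumes p: "1 < p" "p \<le> 2" and \<delta>: "0 < \<delta>" and E: "Im (poly E 0) = 0"
    and small: "\<And>t. norm t = 1 \<Longrightarrow> \<bar>Re (poly E t)\<bar> \<le> 2 * \<delta>"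
  shows "Lp_norm p (cf (poly E)) \<le> 9 * \<delta>"
proof -
  have ic: "integrable circle f" if "continuous_on UNIV f" for f :: "complex \<Rightarrow> 'b::{banach,second_countable_topology}"
    using that by (intro integrable_circle_continuous) (rule continuous_on_subset, auto)
  have iRe: "integrable circle (\<lambda>t. (Re (poly E t))^2)" and iIm: "integrable circle (\<lambda>t. (Im (poly E t))^2)"
    by (intro ic continuous_intros)+
  have "(LINT t|circle. poly (E * E) t) = poly (E * E) 0"
    by (intro integral_circle_mean_value continuous_intros holomorphic_intros)
  then have "Re (LINT t|circle. poly (E * E) t) \<ge> 0" using E by simp
  moreover have "Re (LINT t|circle. poly (E * E) t) = (LINT t|circle. Re (poly (E * E) t))"
    by (intro integral_Re[symmetric] ic continuous_intros)
  moreover have "(LINT t|circle. Re (poly (E * E) t)) = (LINT t|circle. (Re (poly E t))^2 - (Im (poly E t))^2)"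
    by (simp add: power2_eq_square)
  ultimately have "(LINT t|circle. (Im (poly E t))^2) \<le> (LINT t|circle. (Re (poly E t))^2)"
    using iRe iIm by simp
  moreover have "(LINT t|circle. (Re (poly E t))^2) \<le> (LINT t|circle. (2 * \<delta>)^2)"
  proof (intro integral_mono_AE AE_I2 iRe)
    fix t assume "t \<in> space circle"
    then have "\<bar>Re (poly E t)\<bar> \<le> \<bar>2 * \<delta>\<bar>" using small[of t] by (simp add: space_circle)
    then show "(Re (poly E t))^2 \<le> (2 * \<delta>)^2" by (simp only: abs_le_square_iff)
  qed simp
  ultimately have n2: "(LINT t|circle. (norm (poly E t))^2) \<le> 8 * \<delta>^2"
    using iRe iIm by (simp add: cmod_power2 circle.prob_space power_mult_distrib)
  have i2: "integrable circle (\<lambda>t. (norm (poly E t))^2)"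
    by (intro ic continuous_intros)
  have ip: "integrable circle (\<lambda>t. norm (poly E t) powr p)"
    using Linf_subset_Lp[of p "cf (poly E)"] p by (simp add: in_Lp_cf)
  have pw: "x powr p \<le> \<delta> powr p + \<delta> powr (p - 2) * x^2" if x: "0 \<le> x" for x
  proof (cases "x \<le> \<delta>")
    case True
    then have "x powr p \<le> \<delta> powr p" using x p by (intro powr_mono2) auto
    then show ?thesis by (simp add: add_increasing2)
  next
    case False
    then have "x powr (p - 2) \<le> \<delta> powr (p - 2)" using \<delta> p by (intro powr_mono2') auto
    then have "x powr (p - 2) * x^2 \<le> \<delta> powr (p - 2) * x^2" by (intro mult_right_mono) auto
    moreover have "x powr p = x powr (p - 2) * x powr 2" unfolding powr_add[symmetric] by simp
    moreover have "x powr 2 = x^2" using False \<delta> by simp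
    ultimately show ?thesis by (simp add: add_increasing)
  qed
  have "(LINT t|circle. norm (poly E t) powr p) \<le> (LINT t|circle. \<delta> powr p + \<delta> powr (p - 2) * (norm (poly E t))^2)"
    using i2 ip by (intro integral_mono pw) auto
  also have "\<dots> = \<delta> powr p + \<delta> powr (p - 2) * (LINT t|circle. (norm (poly E t))^2)"
    using i2 by (simp add: circle.prob_space)
  also have "\<dots> \<le> \<delta> powr p + \<delta> powr (p - 2) * (8 * \<delta>^2)"
    using n2 by (intro add_left_mono mult_left_mono) auto
  also have "\<delta> powr (p - 2) * (8 * \<delta>^2) = 8 * (\<delta> powr (p - 2) * \<delta> powr 2)" using \<delta> by simp
  also have "\<delta> powr (p - 2) * \<delta> powr 2 = \<delta> powr p" unfolding powr_add[symmetric] by simp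
  also have "\<delta> powr p + 8 * \<delta> powr p \<le> (9 * \<delta>) powr p"
  proof -
    have "9 powr 1 \<le> (9::real) powr p" using p by (intro powr_mono) auto
    then have "9 * \<delta> powr p \<le> 9 powr p * \<delta> powr p" by (intro mult_right_mono) auto
    then show ?thesis using \<delta> by (simp add: powr_mult)
  qed
  finally show ?thesis using p \<delta> by (simp add: Lp_norm_cf Lpn_le_iff)
qed

lemma cf_poly_diff: "cf (poly (F - G)) = cf (poly F) - cf (poly G)"
  by (simp add: cf_simps poly_fun_simps)

lemma cf_poly_add: "cf (poly (F + G)) = cf (poly F) + cf (poly G)"
  by (simp add: cf_simps poly_fun_simps)

lemma cf_poly_smult: "cf (poly (Polynomial.smult z F)) = z *\<^sub>C cf (poly F)"
  by (simp add: cf_simps poly_fun_simps)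

lemma cf_poly_mult: "cf (poly (F * G)) = cf (poly F) * cf (poly G)"
  by (simp add: cf_simps poly_fun_simps)

text \<open>Positive and negative part of Re F are not real parts of polynomials. Raised by 2
  \<delta> and approximated within \<delta>, they become positive real parts of polynomials
  \<open>V\<close> and \<open>W\<close>, to which Calderon's bound applies. The error
  \<open>F - V + W\<close> has real part at most 2 \<delta> in modulus, so its norm vanishes with
  \<delta>.\<close>

lemma poly_real_part_bound:
  assumes p: "1 < p" "p \<le> (2::real)"
  obtains C where "0 \<le> C"
    "\<And>F. Im (poly F 0) = 0 \<Longrightarrow> Lp_norm p (cf (poly F)) \<le> C * Lp_norm p (cf (\<lambda>t. of_real (Re (poly F t))))"
proof -
  have p0: "0 < p" "1 \<le> p" using p by auto
  obtain A where A: "0 \<le> A"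
    "\<And>P. (\<And>t. norm t = 1 \<Longrightarrow> 0 < Re (poly P t)) \<Longrightarrow> Im (poly P 0) = 0 \<Longrightarrow>
       Lp_norm p (cf (poly P)) \<le> A * Lp_norm p (cf (\<lambda>t. of_real (Re (poly P t))))"
    using calderon_positive[OF p] by metis
  have "Lp_norm p (cf (poly F)) \<le> 2 * A * Lp_norm p (cf (\<lambda>t. of_real (Re (poly F t))))"
    if F0: "Im (poly F 0) = 0" for F
  proof -
    define U where "U = Lp_norm p (cf (\<lambda>t. of_real (Re (poly F t))))"
    have le: "Lp_norm p (cf (poly F)) \<le> 9 * \<delta> + 2 * (A * (U + 3 * \<delta>))" if \<delta>: "0 < \<delta>" for \<delta>
    proof -
      have appr: "\<exists>V. Im (poly V 0) = 0 \<and> (\<forall>t. norm t = 1 \<longrightarrow> \<bar>Re (poly V t) - (max (s * Re (poly F t)) 0 + 2 * \<delta>)\<bar> < \<delta>)" for s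
      proof -
        have "continuous_on (sphere 0 1) (\<lambda>t::complex. max (s * Re (poly F t)) 0 + 2 * \<delta>)"
          by (intro continuous_intros)
        then obtain g where g: "real_polynomial_function g"
          "\<And>t. t \<in> sphere 0 1 \<Longrightarrow> \<bar>max (s * Re (poly F t)) 0 + 2 * \<delta> - g t\<bar> < \<delta>"
          using Stone_Weierstrass_real_polynomial_function[OF compact_sphere _ \<delta>] by blast
        obtain V where V: "Im (poly V 0) = 0" "\<And>t. norm t = 1 \<Longrightarrow> Re (poly V t) = g t"
          using real_polynomial_Re_poly[OF g(1)] by blast
        show ?thesis using V g(2) by (intro exI[of _ V]) (auto simp: abs_minus_commute)
      qed
      have bd: "Lp_norm p (cf (poly V)) \<le> A * (U + 3 * \<delta>)"
        if V: "Im (poly V 0) = 0" "\<And>t. norm t = 1 \<Longrightarrow> \<bar>Re (poly V t) - (max (s * Re (poly F t)) 0 + 2 * \<delta>)\<bar> < \<delta>"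
          and s: "\<bar>s\<bar> = 1" for V s
      proof -
        have pos: "0 < Re (poly V t)" if "norm t = 1" for t using V(2)[OF that] \<delta> by linarith
        have "Lp_norm p (cf (\<lambda>t. of_real (Re (poly V t)))) \<le> Lp_norm p (cf (\<lambda>t. of_real (norm (complex_of_real (Re (poly F t))) + 3 * \<delta>)))"
        proof (rule Lp_norm_mono_continuous[OF p0(1)])
          fix t :: complex assume t: "norm t = 1"
          have "\<bar>s * Re (poly F t)\<bar> = \<bar>Re (poly F t)\<bar>" using s by (simp add: abs_mult)
          then show "norm (complex_of_real (Re (poly V t))) \<le> norm (complex_of_real (norm (complex_of_real (Re (poly F t))) + 3 * \<delta>))"
            using V(2)[OF t] pos[OF t] \<delta> unfolding norm_of_real by linarith
        qed (intro continuous_intros)+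
        also have "\<dots> = Lp_norm p (cf (\<lambda>t. of_real (norm (complex_of_real (Re (poly F t))))) + cf (\<lambda>t. of_real (3 * \<delta>)))"
          by (subst cf_simps) auto
        also have "\<dots> \<le> Lp_norm p (cf (\<lambda>t. of_real (norm (complex_of_real (Re (poly F t)))))) + Lp_norm p (cf (\<lambda>t. of_real (3 * \<delta>)))"
          using p0 by (intro Lp_norm_triangle Linf_subset_Lp cf_continuous_Linf continuous_intros) auto
        also have "Lp_norm p (cf (\<lambda>t. complex_of_real (norm (complex_of_real (Re (poly F t)))))) \<le> U"
          unfolding U_def by (intro Lp_norm_mono_continuous p0 continuous_intros) auto
        also have "Lp_norm p (cf (\<lambda>t. of_real (3 * \<delta>))) = 3 * \<delta>" using p0 \<delta> by (simp add: Lp_norm_const)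
        finally have "A * Lp_norm p (cf (\<lambda>t. of_real (Re (poly V t)))) \<le> A * (U + 3 * \<delta>)"
          using A(1) by (intro mult_left_mono) auto
        then show ?thesis using A(2)[OF pos V(1)] by simp
      qed
      obtain V where V: "Im (poly V 0) = 0" "\<And>t. norm t = 1 \<Longrightarrow> \<bar>Re (poly V t) - (max (1 * Re (poly F t)) 0 + 2 * \<delta>)\<bar> < \<delta>"
        using appr[of 1] by auto
      obtain W where W: "Im (poly W 0) = 0" "\<And>t. norm t = 1 \<Longrightarrow> \<bar>Re (poly W t) - (max (-1 * Re (poly F t)) 0 + 2 * \<delta>)\<bar> < \<delta>"
        using appr[of "-1"] by auto
      define E where "E = F - V + W"
      have "\<bar>Re (poly E t)\<bar> \<le> 2 * \<delta>" if "norm t = 1" for t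
        using V(2)[OF that] W(2)[OF that] by (simp add: E_def)
      then have E: "Lp_norm p (cf (poly E)) \<le> 9 * \<delta>"
        using V(1) W(1) F0 by (intro Lp_norm_poly_small p \<delta>) (auto simp: E_def)
      have L: "cf (poly G) \<in> Lp p" for G using p0 by (simp add: Linf_subset_Lp)
      have "cf (poly F) = cf (poly E) + (cf (poly V) - cf (poly W))"
        by (simp add: E_def cf_poly_add cf_poly_diff del: poly_add poly_diff)
      also have "Lp_norm p \<dots> \<le> Lp_norm p (cf (poly E)) + (Lp_norm p (cf (poly V)) + Lp_norm p (cf (poly W)))"
        using Lp_norm_triangle[OF p0(2) L[of E], of "cf (poly V) - cf (poly W)"]
          Lp_norm_triangle[OF p0(2) L[of V], of "- cf (poly W)"] L p0 by (simp add: Lp_diff)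
      also have "\<dots> \<le> 9 * \<delta> + (A * (U + 3 * \<delta>) + A * (U + 3 * \<delta>))"
        using E bd[OF V] bd[OF W] by (intro add_mono) auto
      finally show ?thesis by simp
    qed
    have "((\<lambda>\<delta>. 9 * \<delta> + 2 * (A * (U + 3 * \<delta>))) \<longlongrightarrow> 2 * A * U) (at_right 0)"
      by (auto intro!: tendsto_eq_intros)
    then show ?thesis unfolding U_def[symmetric]
      by (rule tendsto_lowerbound[OF _ eventually_at_rightI[of 0 1]]) (simp_all only: le zero_less_one greaterThanLessThan_iff trivial_limit_at_right_real not_False_eq_True)
  qed
  then show ?thesis using that[of "2 * A"] A(1) by simp
qed

text \<open>\<open>C\<close> bounds the norm of the projection of trigonometric polynomials onto their analytic part.\<close>

definition riesz_bound :: "real \<Rightarrow> real \<Rightarrow> bool" where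
  "riesz_bound p C \<longleftrightarrow> 0 \<le> C \<and> (\<forall>G H. poly H 0 = 0 \<longrightarrow>
     Lp_norm p (cf (poly G)) \<le> C * Lp_norm p (cf (poly G) + cf (\<lambda>t. cnj (poly H t))))"

lemma riesz_bound_le_2:
  assumes p: "1 < p" "p \<le> 2"
  obtains C where "riesz_bound p C"
proof -
  have p0: "0 < p" "1 \<le> p" using p by auto
  obtain C where C: "0 \<le> C"
    "\<And>F. Im (poly F 0) = 0 \<Longrightarrow> Lp_norm p (cf (poly F)) \<le> C * Lp_norm p (cf (\<lambda>t. of_real (Re (poly F t))))"
    using poly_real_part_bound[OF p] by metis
  have L: "cf (poly G) \<in> Lp p" for G using p0 by (simp add: Linf_subset_Lp)
  have "Lp_norm p (cf (poly G)) \<le> (C + C + 1) * Lp_norm p (cf (poly G) + cf (\<lambda>t. cnj (poly H t)))"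
    if H: "poly H 0 = 0" for G H
  proof -
    define f where "f t = poly G t + cnj (poly H t)" for t
    have fc: "continuous_on S f" for S unfolding f_def by (intro continuous_intros)
    have f: "cf f = cf (poly G) + cf (\<lambda>t. cnj (poly H t))" by (simp add: f_def[abs_def] cf_simps)
    \<comment> \<open>On the circle \<open>F1\<close> and \<open>F2\<close> have the real parts Re f
      and Im f. The added constants make both values at 0 real, and F1 + i F2 = 2 G - G(0).\<close>
    define F1 where "F1 = G + H - [:\<i> * of_real (Im (poly G 0)):]"
    define F2 where "F2 = Polynomial.smult (-\<i>) (G - H) + [:\<i> * of_real (Re (poly G 0)):]"
    have "Lp_norm p (cf (poly F1)) \<le> C * Lp_norm p (cf (\<lambda>t. of_real (Re (poly F1 t))))"
      by (rule C) (simp add: F1_def H)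
    also have "\<dots> \<le> C * Lp_norm p (cf f)"
    proof (intro mult_left_mono C Lp_norm_mono_continuous p0 fc continuous_intros)
      fix t :: complex
      have "Re (poly F1 t) = Re (f t)" by (simp add: F1_def f_def)
      then show "norm (complex_of_real (Re (poly F1 t))) \<le> norm (f t)" by (simp add: abs_Re_le_cmod)
    qed
    finally have 1: "Lp_norm p (cf (poly F1)) \<le> C * Lp_norm p (cf f)" .
    have "Lp_norm p (cf (poly F2)) \<le> C * Lp_norm p (cf (\<lambda>t. of_real (Re (poly F2 t))))"
      by (rule C) (simp add: F2_def H)
    also have "\<dots> \<le> C * Lp_norm p (cf f)"
    proof (intro mult_left_mono C Lp_norm_mono_continuous p0 fc continuous_intros)
      fix t :: complex
      have "Re (poly F2 t) = Im (f t)" by (simp add: F2_def f_def)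
      then show "norm (complex_of_real (Re (poly F2 t))) \<le> norm (f t)" by (simp add: abs_Im_le_cmod)
    qed
    finally have 2: "Lp_norm p (cf (poly F2)) \<le> C * Lp_norm p (cf f)" .
    have "(LINT t|circle. f t) = (LINT t|circle. poly G t) + cnj (LINT t|circle. poly H t)"
    proof -
      have "integrable circle (poly G)" "integrable circle (poly H)"
        by (intro integrable_circle_continuous continuous_intros)+
      then show ?thesis unfolding f_def by simp
    qed
    also have "\<dots> = poly G 0"
      by (subst integral_circle_mean_value, intro continuous_intros, intro holomorphic_intros)+ (simp add: H)
    finally have G0: "poly G 0 = cint (cf f)"
      by (simp add: cf_simps borel_measurable_circle_continuous[OF fc])
    have fL: "cf f \<in> Linf" by (rule cf_continuous_Linf[OF fc])
    have "norm (poly G 0) \<le> Lp_norm p (cf f)"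
      unfolding G0 using norm_cint_le[of "cf f"] Lp_le_1(2)[OF p(1), of "cf f"] fL p0
      by (auto simp: Linf_subset_Lp intro: order_trans)
    then have 3: "Lp_norm p (cf (poly [:poly G 0:])) \<le> Lp_norm p (cf f)"
      using Lp_norm_const[OF p0(1), of "poly G 0"] by (simp add: poly_fun_simps)
    have "F1 + Polynomial.smult \<i> F2 + [:poly G 0:] = Polynomial.smult 2 G"
    proof -
      have "poly (F1 + Polynomial.smult \<i> F2 + [:poly G 0:]) t = poly (Polynomial.smult 2 G) t" for t
        by (simp add: F1_def F2_def algebra_simps) (simp add: complex_eq_iff)
      then show ?thesis by (simp add: poly_eq_poly_eq_iff[symmetric] fun_eq_iff)
    qed
    then have e: "2 *\<^sub>C cf (poly G) = cf (poly F1) + \<i> *\<^sub>C cf (poly F2) + cf (poly [:poly G 0:])"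
      by (simp only: cf_poly_smult[symmetric] cf_poly_add[symmetric])
    have "2 * Lp_norm p (cf (poly G)) = Lp_norm p (2 *\<^sub>C cf (poly G))"
      using p0 by (simp add: Lp_norm_smult)
    also have "\<dots> \<le> Lp_norm p (cf (poly F1) + \<i> *\<^sub>C cf (poly F2)) + Lp_norm p (cf (poly [:poly G 0:]))"
      unfolding e by (intro Lp_norm_triangle p0 L Lp_add Lp_smult)
    also have "Lp_norm p (cf (poly F1) + \<i> *\<^sub>C cf (poly F2)) \<le> Lp_norm p (cf (poly F1)) + Lp_norm p (\<i> *\<^sub>C cf (poly F2))"
      by (intro Lp_norm_triangle p0 L Lp_smult)
    also have "Lp_norm p (\<i> *\<^sub>C cf (poly F2)) = Lp_norm p (cf (poly F2))" using p0 by (simp add: Lp_norm_smult)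
    finally have "2 * Lp_norm p (cf (poly G)) \<le> (C + C + 1) * Lp_norm p (cf f)"
      using 1 2 3 unfolding distrib_right by linarith
    then show ?thesis using Lp_norm_nonneg[of p "cf (poly G)"] unfolding f[symmetric] by linarith
  qed
  then show ?thesis using that[of "C + C + 1"] C(1) by (simp add: riesz_bound_def)
qed

lemma Lp_norm_mult_double:
  assumes p: "0 < p" and x: "x \<in> Linf" and y: "y \<in> Linf"
  shows "Lp_norm p (x * y) \<le> Lp_norm (2*p) x * Lp_norm (2*p) y"
proof -
  obtain f g where [measurable]: "f \<in> borel_measurable circle" "g \<in> borel_measurable circle"
    and xy: "x = cf f" "y = cf g" by (cases x; cases y) auto
  have "x \<in> Lp (2*p)" "y \<in> Lp (2*p)" using p x y by (auto intro: Linf_subset_Lp)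
  then have i: "integrable circle (\<lambda>t. norm (complex_of_real (norm (f t) powr p)) powr 2)"
    "integrable circle (\<lambda>t. norm (complex_of_real (norm (g t) powr p)) powr 2)"
    by (simp_all add: xy in_Lp_cf powr_powr mult.commute)
  have "(LINT t|circle. norm (f t * g t) powr p) =
      (LINT t|circle. norm (complex_of_real (norm (f t) powr p) * complex_of_real (norm (g t) powr p)))"
    by (simp add: norm_mult powr_mult)
  also have "\<dots> \<le> Lpn circle 2 (\<lambda>t. complex_of_real (norm (f t) powr p)) * Lpn circle 2 (\<lambda>t. complex_of_real (norm (g t) powr p))"
    by (rule Holder(2)[OF _ _ _ _ i]) auto
  also have "\<dots> = (LINT t|circle. norm (f t) powr (2*p)) powr (1/2) * (LINT t|circle. norm (g t) powr (2*p)) powr (1/2)"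
    by (simp add: Lpn_def powr_powr mult.commute)
  finally have "(LINT t|circle. norm (f t * g t) powr p) powr (1/p) \<le>
    ((LINT t|circle. norm (f t) powr (2*p)) powr (1/2) * (LINT t|circle. norm (g t) powr (2*p)) powr (1/2)) powr (1/p)"
    using p by (intro powr_mono2) auto
  also have "\<dots> = Lpn circle (2*p) f * Lpn circle (2*p) g"
    by (simp add: Lpn_def powr_mult powr_powr)
  finally show ?thesis by (simp add: xy cf_simps Lp_norm_cf Lpn_def)
qed

lemma Lp_norm_square: "0 < p \<Longrightarrow> Lp_norm p (x * x) = (Lp_norm (2*p) x)^2"
proof (cases x)
  case (cf f)
  assume p: "0 < p"
  note [measurable] = cf(1)
  have "norm (f t * f t) powr p = norm (f t) powr (2 * p)" for t
  proof -
    have "norm (f t * f t) powr p = norm (f t) powr (p + p)" unfolding powr_add by (simp add: norm_mult powr_mult)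
    then show ?thesis by simp
  qed
  moreover have "a powr (1/p) = (a powr (1/(2*p)))^2" for a :: real
  proof -
    have "1/p = 1/(2*p) + 1/(2*p)" using p by simp
    then show ?thesis by (metis power2_eq_square powr_add)
  qed
  ultimately show ?thesis by (simp add: cf cf_simps Lp_norm_cf Lpn_def)
qed

text \<open>For \<open>f = g + h\<close> with \<open>g\<close> analytic and \<open>h\<close> coanalytic, \<open>g\<^sup>2 - h\<^sup>2 = 2 g f - f\<^sup>2\<close>; so the bound
  for the exponent \<open>p\<close>, applied to \<open>g\<^sup>2 - h\<^sup>2\<close>, is a quadratic inequality for the \<open>2p\<close>-norm of \<open>g\<close>.\<close>

lemma riesz_bound_double:
  assumes p: "1 < p" and C: "riesz_bound p C"
  shows "riesz_bound (2*p) (2*C + 1)"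
  unfolding riesz_bound_def
proof (intro conjI allI impI)
  show "0 \<le> 2*C + 1" using C by (simp add: riesz_bound_def)
  fix G H :: "complex poly" assume H: "poly H 0 = 0"
  have p0: "0 < p" "1 \<le> p" using p by auto
  define g where "g = cf (poly G)"
  define h where "h = cf (\<lambda>t. cnj (poly H t))"
  define f where "f = g + h"
  have Li: "g \<in> Linf" "f \<in> Linf" by (auto simp: f_def g_def h_def intro: Linf_add)
  have "cf (poly (G * G)) = g * g" unfolding g_def by (rule cf_poly_mult)
  moreover have "cf (\<lambda>t. cnj (poly (- (H * H)) t)) = - (h * h)" unfolding h_def by (simp add: cf_simps)
  moreover have "poly (- (H * H)) 0 = 0" using H by simp
  ultimately have "Lp_norm p (g * g) \<le> C * Lp_norm p (g * g + - (h * h))"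
    using C unfolding riesz_bound_def by metis
  also have "g * g + - (h * h) = (g * f + g * f) + - (f * f)" by (simp add: f_def algebra_simps)
  also have "C * Lp_norm p \<dots> \<le> C * (Lp_norm p (g * f) + Lp_norm p (g * f) + Lp_norm p (f * f))"
  proof (rule mult_left_mono)
    have L: "g * f \<in> Lp p" "f * f \<in> Lp p" using p0 Li by (auto intro!: Linf_subset_Lp Linf_mult)
    show "Lp_norm p (g * f + g * f + - (f * f)) \<le> Lp_norm p (g * f) + Lp_norm p (g * f) + Lp_norm p (f * f)"
      using Lp_norm_triangle[OF p0(2) Lp_add[OF p0(1) L(1) L(1)] Lp_minus[THEN iffD2, OF L(2)]]
        Lp_norm_triangle[OF p0(2) L(1) L(1)] unfolding Lp_norm_minus by linarith
  qed (use C in \<open>simp add: riesz_bound_def\<close>)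
  also have "\<dots> \<le> C * (Lp_norm (2*p) g * Lp_norm (2*p) f + Lp_norm (2*p) g * Lp_norm (2*p) f + (Lp_norm (2*p) f)^2)"
    using C p0 Li by (intro mult_left_mono add_mono Lp_norm_mult_double) (auto simp: riesz_bound_def Lp_norm_square)
  finally have q: "(Lp_norm (2*p) g)^2 \<le> C * (2 * Lp_norm (2*p) g * Lp_norm (2*p) f + (Lp_norm (2*p) f)^2)"
    using p0 by (simp add: Lp_norm_square algebra_simps)
  \<comment> \<open>If a > (2C+1) b, then a^2 exceeds 2 C a b + a b, and the last product already
    dominates C b^2.\<close>
  have "a \<le> (2*C+1) * b" if "a^2 \<le> C * (2 * a * b + b^2)" "0 \<le> a" "0 \<le> b" "0 \<le> C" for a b :: real
  proof (rule ccontr)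
    assume "\<not> ?thesis"
    then have l: "(2*C+1) * b < a" by simp
    moreover have "0 \<le> (2*C+1) * b" using that by simp
    ultimately have "((2*C+1) * b) * a < a * a" by (intro mult_strict_right_mono) auto
    moreover have "b * ((2*C+1) * b) \<le> b * a" using l that by (intro mult_left_mono) auto
    moreover have "0 \<le> C * b * b" "0 \<le> b * b" using that by auto
    moreover have "C * (2 * a * b + b^2) = 2 * (C * b * a) + C * b * b" "((2*C+1) * b) * a = 2 * (C * b * a) + b * a"
      "b * ((2*C+1) * b) = 2 * (C * b * b) + b * b" "a^2 = a * a"
      by (simp_all add: algebra_simps power2_eq_square)
    ultimately have "C * (2 * a * b + b^2) < a^2" by linarith
    then show False using that by simp
  qed
  from this[OF q] C show "Lp_norm (2*p) (cf (poly G)) \<le> (2*C + 1) * Lp_norm (2*p) (cf (poly G) + cf (\<lambda>t. cnj (poly H t)))"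
    by (simp add: riesz_bound_def g_def[symmetric] h_def[symmetric] f_def[symmetric])
qed

text \<open>Half of an exponent above 2 is still above 1, so repeated halving ends in the range of
  Calderon's bound, and doubling leads back.\<close>

theorem riesz_bound_exists:
  assumes "1 < p"
  obtains C where "riesz_bound p C"
proof -
  have "\<exists>C. riesz_bound p C" if "1 < p" "p \<le> 2 ^ Suc k" for k p
    using that
  proof (induction k arbitrary: p)
    case 0
    then show ?case using riesz_bound_le_2[of p] by auto
  next
    case (Suc k)
    show ?case
    proof (cases "p \<le> 2")
      case True
      then show ?thesis using riesz_bound_le_2[of p] Suc.prems by auto
    next
      case False
      then obtain C where "riesz_bound (p/2) C" using Suc.IH[of "p/2"] Suc.prems by auto
      then have "riesz_bound (2 * (p/2)) (2*C+1)" using False by (intro riesz_bound_double) auto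
      then show ?thesis by auto
    qed
  qed
  moreover obtain k where "p < 2 ^ k" using real_arch_pow[of 2 p] by auto
  then have "p \<le> 2 ^ Suc k" using power_increasing[of k "Suc k" "2::real"] by linarith
  ultimately show ?thesis using that assms by blast
qed

section \<open>Construction of the projection on the whole space\<close>

lemma trig_poly_decomposition:
  assumes "x \<in> trig"
  obtains G H where "poly H 0 = 0" "x = cf (poly G) + cf (\<lambda>t. cnj (poly H t))"
proof -
  have "\<exists>G H. poly H 0 = 0 \<and> x = cf (poly G) + cf (\<lambda>t. cnj (poly H t))"
    using assms
  proof (induction rule: trig_induct)
    case zero
    show ?case by (rule exI[of _ 0], rule exI[of _ 0]) (simp add: cf_simps zero_circle_fun_def poly_fun_simps)
  next
    case (add z k y)
    then obtain G H where GH: "poly H 0 = 0" "y = cf (poly G) + cf (\<lambda>t. cnj (poly H t))" by blast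
    show ?case
    proof (cases "k \<ge> 0")
      case True
      then have "tpow k = cf (poly (monom 1 (nat k)))"
        by (simp add: tpow_cf poly_fun_simps power_int_def)
      then have "z *\<^sub>C tpow k + y = cf (poly (Polynomial.smult z (monom 1 (nat k)) + G)) + cf (\<lambda>t. cnj (poly H t))"
        unfolding GH(2) cf_poly_add cf_poly_smult by (simp add: add.assoc)
      then show ?thesis using GH(1) by blast
    next
      case False
      then have k: "k = - int (nat (- k))" by simp
      have "tpow k = cf (\<lambda>t. cnj (poly (monom 1 (nat (- k))) t))"
        by (subst k, subst cf_cnj_powi[symmetric]) (simp add: poly_monom)
      then have "z *\<^sub>C tpow k + y = cf (poly G) + cf (\<lambda>t. cnj (poly (Polynomial.smult (cnj z) (monom 1 (nat (- k))) + H) t))"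
        unfolding GH(2) by (simp add: cf_simps algebra_simps)
      moreover have "poly (Polynomial.smult (cnj z) (monom 1 (nat (- k))) + H) 0 = 0"
        using GH(1) False by (simp add: poly_monom)
      ultimately show ?thesis by blast
    qed
  qed
  then show ?thesis using that by blast
qed

lemma cf_poly_L1 [simp]: "cf (poly G) \<in> Lp 1" "cf (\<lambda>t. cnj (poly G t)) \<in> Lp 1"
  by (auto intro: Linf_subset_Lp)

lemma fourier_coeff_poly: "n < 0 \<Longrightarrow> fourier_coeff (cf (poly G)) n = 0"
proof (induction G arbitrary: n)
  case 0
  have "cf (poly 0) = 0" by (simp add: zero_circle_fun_def poly_fun_simps)
  show ?case unfolding \<open>cf (poly 0) = 0\<close> by simp
next
  case (pCons a G)
  have e: "cf (poly (pCons a G)) = a *\<^sub>C tpow 0 + tpow 1 * cf (poly G)"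
    unfolding tpow_cf by (simp add: cf_simps poly_fun_simps)
  show ?case unfolding e using pCons
    by (subst fourier_coeff_add) (auto intro!: Lp_smult simp: fourier_coeff_1)
qed

lemma fourier_coeff_cnj_poly: "n > 0 \<Longrightarrow> fourier_coeff (cf (\<lambda>t. cnj (poly G t))) n = 0"
proof (induction G arbitrary: n)
  case 0
  have "cf (\<lambda>t. cnj (poly 0 t)) = 0" by (simp add: zero_circle_fun_def)
  then show ?case by simp
next
  case (pCons a G)
  have e: "cf (\<lambda>t. cnj (poly (pCons a G) t)) = cnj a *\<^sub>C tpow 0 + tpow (-1) * cf (\<lambda>t. cnj (poly G t))"
    unfolding tpow_minus_1 by (simp add: cf_simps poly_fun_simps one_circle_fun_def)
  show ?case unfolding e using pCons
    by (subst fourier_coeff_add) (auto intro!: Lp_smult simp: fourier_coeff_1)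
qed

lemma fourier_coeff_cnj_poly_0:
  assumes "poly G 0 = 0" "n \<ge> 0"
  shows "fourier_coeff (cf (\<lambda>t. cnj (poly G t))) n = 0"
proof -
  obtain a K where K: "G = pCons a K" by (cases G)
  have "cf (\<lambda>t. cnj (poly (pCons 0 K) t)) = tpow (-1) * cf (\<lambda>t. cnj (poly K t))"
    unfolding tpow_minus_1 by (simp add: cf_simps poly_fun_simps)
  then show ?thesis using assms by (simp add: K fourier_coeff_cnj_poly)
qed

lemma Lp_fourier_coeff_tendsto:
  assumes p: "1 < p" and "\<And>n::nat. F n \<in> Lp p" "f \<in> Lp p" "(\<lambda>n. Lp_norm p (F n - f)) \<longlonglongrightarrow> 0"
  shows "(\<lambda>n. fourier_coeff (F n) k) \<longlonglongrightarrow> fourier_coeff f k"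
proof -
  have "(\<lambda>n. fourier_coeff (F n) k - fourier_coeff f k) \<longlonglongrightarrow> 0"
  proof (rule Lim_null_comparison[OF always_eventually assms(4)], rule allI)
    fix n
    have d: "F n - f \<in> Lp p" using assms by (intro Lp_diff) auto
    have "norm (fourier_coeff (F n - f) k) \<le> Lp_norm 1 (F n - f)"
      by (intro norm_fourier_coeff_le Lp_le_1[OF p d])
    also have "\<dots> \<le> Lp_norm p (F n - f)" by (intro Lp_le_1[OF p d])
    finally show "norm (fourier_coeff (F n) k - fourier_coeff f k) \<le> Lp_norm p (F n - f)"
      using assms Lp_le_1(1)[OF p] by (simp add: fourier_coeff_diff)
  qed
  then show ?thesis by (rule LIM_zero_cancel)
qed

lemma Lp_norm_tendsto:
  assumes p: "1 \<le> p" and F: "\<And>n::nat. F n \<in> Lp p" and f: "f \<in> Lp p" and l: "(\<lambda>n. Lp_norm p (F n - f)) \<longlonglongrightarrow> 0"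
  shows "(\<lambda>n. Lp_norm p (F n)) \<longlonglongrightarrow> Lp_norm p f"
proof -
  have p0: "0 < p" using p by simp
  have "(\<lambda>n. Lp_norm p (F n) - Lp_norm p f) \<longlonglongrightarrow> 0"
  proof (rule Lim_null_comparison[OF always_eventually l], rule allI)
    fix n
    have "Lp_norm p (F n) \<le> Lp_norm p (F n - f) + Lp_norm p f"
      using Lp_norm_triangle[OF p Lp_diff[OF p0 F[of n] f] f] by simp
    moreover have "Lp_norm p f \<le> Lp_norm p (f - F n) + Lp_norm p (F n)"
      using Lp_norm_triangle[OF p Lp_diff[OF p0 f F[of n]] F[of n]] by simp
    ultimately show "norm (Lp_norm p (F n) - Lp_norm p f) \<le> Lp_norm p (F n - f)"
      by (simp add: Lp_norm_diff_commute[of p f])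
  qed
  then show ?thesis by (rule LIM_zero_cancel)
qed

lemma Cauchy_Lp_tendsto:
  assumes p: "1 \<le> p" and F: "\<And>n::nat. F n \<in> Lp p" and f: "f \<in> Lp p" and l: "(\<lambda>n. Lp_norm p (F n - f)) \<longlonglongrightarrow> 0"
    and e: "0 < e"
  shows "\<exists>N. \<forall>m\<ge>N. \<forall>n\<ge>N. Lp_norm p (F m - F n) < e"
proof -
  obtain N where N: "\<And>n. n \<ge> N \<Longrightarrow> Lp_norm p (F n - f) < e/2"
    using order_tendstoD(2)[OF l half_gt_zero[OF e]] by (auto simp: eventually_sequentially)
  have "Lp_norm p (F m - F n) < e" if "m \<ge> N" "n \<ge> N" for m n
    using Lp_norm_triangle_diff[OF p F[of m] f F[of n]] N[OF that(1)] N[OF that(2)]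
    by (simp add: Lp_norm_diff_commute[of p f])
  then show ?thesis by blast
qed

text \<open>The analytic parts of trigonometric approximations form a Cauchy sequence by the uniform
  bound, and Fourier coefficients are continuous in the norm. Requiring \<open>poly H 0 = 0\<close>
  assigns the constant term to the analytic part.\<close>

theorem riesz_projection_exists:
  assumes p: "1 < p"
  obtains C where "0 \<le> C" "\<And>x. x \<in> Lp p \<Longrightarrow> \<exists>g \<in> Hp p.
    (\<forall>n\<ge>0. fourier_coeff g n = fourier_coeff x n) \<and> Lp_norm p g \<le> C * Lp_norm p x"
proof -
  have p0: "0 < p" "1 \<le> p" using p by auto
  obtain C where C: "riesz_bound p C" using riesz_bound_exists[OF p] .
  have C0: "0 \<le> C" using C by (simp add: riesz_bound_def)
  have "\<exists>g \<in> Hp p. (\<forall>n\<ge>0. fourier_coeff g n = fourier_coeff x n) \<and> Lp_norm p g \<le> C * Lp_norm p x"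
    if x: "x \<in> Lp p" for x
  proof -
    have "\<exists>y G H. y \<in> trig \<and> Lp_norm p (x - y) < inverse (real (Suc n)) \<and> poly H 0 = 0 \<and> y = cf (poly G) + cf (\<lambda>t. cnj (poly H t))" for n
    proof -
      obtain y where y: "y \<in> trig" "Lp_norm p (x - y) < inverse (real (Suc n))"
        using trig_dense[OF p x, of "inverse (real (Suc n))"] by auto
      then show ?thesis using trig_poly_decomposition[OF y(1)] by metis
    qed
    then obtain y G H where y: "\<And>n. y n \<in> trig" "\<And>n. Lp_norm p (x - y n) < inverse (real (Suc n))"
      and H: "\<And>n. poly (H n) 0 = 0" and yGH: "\<And>n. y n = cf (poly (G n)) + cf (\<lambda>t. cnj (poly (H n) t))" by metis
    have yL: "y n \<in> Lp p" for n using y p0 by (intro trig_Lp)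
    have gL: "cf (poly F) \<in> Lp p" for F using p0 by (simp add: Linf_subset_Lp)
    have yx: "(\<lambda>n. Lp_norm p (y n - x)) \<longlonglongrightarrow> 0"
    proof (rule Lim_null_comparison[OF always_eventually LIMSEQ_inverse_real_of_nat], rule allI)
      show "norm (Lp_norm p (y n - x)) \<le> inverse (real (Suc n))" for n
        using less_imp_le[OF y(2)[of n]] unfolding Lp_norm_diff_commute[of p "y n"] by simp
    qed
    have gd: "Lp_norm p (cf (poly (G m)) - cf (poly (G n))) \<le> C * Lp_norm p (y m - y n)" for m n
    proof -
      have e: "y m - y n = cf (poly (G m - G n)) + cf (\<lambda>t. cnj (poly (H m - H n) t))"
        unfolding yGH by (simp add: cf_simps algebra_simps)
      have "poly (H m - H n) 0 = 0" using H by simp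
      then show ?thesis unfolding e cf_poly_diff[symmetric] using C unfolding riesz_bound_def by blast
    qed
    have "\<exists>N. \<forall>m\<ge>N. \<forall>n\<ge>N. Lp_norm p (cf (poly (G m)) - cf (poly (G n))) < e" if e: "0 < e" for e
    proof -
      have "0 < e / (C + 1)" using e C0 by simp
      then obtain N where N: "\<forall>m\<ge>N. \<forall>n\<ge>N. Lp_norm p (y m - y n) < e / (C + 1)"
        using Cauchy_Lp_tendsto[OF p0(2) yL x yx] by blast
      have "Lp_norm p (cf (poly (G m)) - cf (poly (G n))) < e" if "m \<ge> N" "n \<ge> N" for m n
      proof -
        have "C * Lp_norm p (y m - y n) \<le> (C + 1) * Lp_norm p (y m - y n)" by (simp add: mult_right_mono)
        also have "\<dots> < e" using N that C0 by (simp add: pos_less_divide_eq mult.commute)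
        finally show ?thesis using gd[of m n] by simp
      qed
      then show ?thesis by blast
    qed
    then obtain g where g: "g \<in> Lp p" "(\<lambda>n. Lp_norm p (cf (poly (G n)) - g)) \<longlonglongrightarrow> 0"
      using Lp_complete[OF p, of "\<lambda>n. cf (poly (G n))"] gL by blast
    have cg: "(\<lambda>n. fourier_coeff (cf (poly (G n))) k) \<longlonglongrightarrow> fourier_coeff g k" for k
      by (rule Lp_fourier_coeff_tendsto[OF p gL g])
    have cx: "(\<lambda>n. fourier_coeff (y n) k) \<longlonglongrightarrow> fourier_coeff x k" for k
      by (rule Lp_fourier_coeff_tendsto[OF p yL x yx])
    have "fourier_coeff g k = 0" if "k < 0" for k
      using cg[of k] that by (simp add: fourier_coeff_poly LIMSEQ_const_iff)
    then have "g \<in> Hp p" using g by (simp add: Hp_def)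
    moreover have "fourier_coeff g k = fourier_coeff x k" if "k \<ge> 0" for k
    proof (rule LIMSEQ_unique[OF cg])
      have "fourier_coeff (y n) k = fourier_coeff (cf (poly (G n))) k" for n
        unfolding yGH by (subst fourier_coeff_add) (auto simp: fourier_coeff_cnj_poly_0[OF H that])
      then show "(\<lambda>n. fourier_coeff (cf (poly (G n))) k) \<longlonglongrightarrow> fourier_coeff x k" using cx[of k] by simp
    qed
    moreover have "Lp_norm p g \<le> C * Lp_norm p x"
    proof (rule LIMSEQ_le)
      show "(\<lambda>n. Lp_norm p (cf (poly (G n)))) \<longlonglongrightarrow> Lp_norm p g"
        by (rule Lp_norm_tendsto[OF p0(2) gL g])
      show "(\<lambda>n. C * Lp_norm p (y n)) \<longlonglongrightarrow> C * Lp_norm p x"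
        by (intro tendsto_intros Lp_norm_tendsto[OF p0(2) yL x yx])
      show "\<exists>N. \<forall>n\<ge>N. Lp_norm p (cf (poly (G n))) \<le> C * Lp_norm p (y n)"
        using C H unfolding riesz_bound_def yGH by blast
    qed
    ultimately show ?thesis by blast
  qed
  then show ?thesis using that C0 by blast
qed

section \<open>Hardy spaces as closed subspaces and linearity of the projection\<close>

lemma Hp_Lp: "f \<in> Hp p \<Longrightarrow> f \<in> Lp p"
  by (simp add: Hp_def)

lemma Hp_coeff: "f \<in> Hp p \<Longrightarrow> n < 0 \<Longrightarrow> fourier_coeff f n = 0"
  by (simp add: Hp_def)

lemma riesz_proj:
  assumes p: "1 < p" and x: "x \<in> Lp p"
  shows riesz_proj_Hp: "riesz_proj p x \<in> Hp p"
    and riesz_proj_coeff: "n \<ge> 0 \<Longrightarrow> fourier_coeff (riesz_proj p x) n = fourier_coeff x n"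
proof -
  obtain g where g: "g \<in> Hp p" "\<forall>n\<ge>0. fourier_coeff g n = fourier_coeff x n"
    using riesz_projection_exists[OF p] x by metis
  have "riesz_proj p x \<in> Hp p \<and> (\<forall>n\<ge>0. fourier_coeff (riesz_proj p x) n = fourier_coeff x n)"
    unfolding riesz_proj_def
  proof (rule theI[of _ g])
    fix h assume h: "h \<in> Hp p \<and> (\<forall>n\<ge>0. fourier_coeff h n = fourier_coeff x n)"
    show "h = g"
    proof (rule fourier_unique_eq)
      show "h \<in> Lp 1" "g \<in> Lp 1" using h g Lp_le_1(1)[OF p] by (auto simp: Hp_def)
      show "fourier_coeff h n = fourier_coeff g n" for n
        using h g by (cases "n < 0") (auto simp: Hp_def)
    qed
  qed (use g in auto)
  then show "riesz_proj p x \<in> Hp p" "n \<ge> 0 \<Longrightarrow> fourier_coeff (riesz_proj p x) n = fourier_coeff x n" by auto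
qed

lemma riesz_proj_eqI:
  assumes p: "1 < p" and x: "x \<in> Lp p" and g: "g \<in> Hp p" "\<And>n. n \<ge> 0 \<Longrightarrow> fourier_coeff g n = fourier_coeff x n"
  shows "riesz_proj p x = g"
proof (rule fourier_unique_eq)
  show "riesz_proj p x \<in> Lp 1" "g \<in> Lp 1" using riesz_proj_Hp[OF p x] g Lp_le_1(1)[OF p] by (auto simp: Hp_def)
  show "fourier_coeff (riesz_proj p x) n = fourier_coeff g n" for n
    using riesz_proj_coeff[OF p x, of n] g(2)[of n] Hp_coeff[OF g(1), of n] Hp_coeff[OF riesz_proj_Hp[OF p x], of n] by (cases "n < 0") auto
qed

lemma riesz_proj_bounded:
  assumes p: "1 < p"
  obtains C where "0 \<le> C" "\<And>x. x \<in> Lp p \<Longrightarrow> Lp_norm p (riesz_proj p x) \<le> C * Lp_norm p x"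
proof -
  obtain C where C: "0 \<le> C" "\<And>x. x \<in> Lp p \<Longrightarrow> \<exists>g \<in> Hp p.
    (\<forall>n\<ge>0. fourier_coeff g n = fourier_coeff x n) \<and> Lp_norm p g \<le> C * Lp_norm p x"
    using riesz_projection_exists[OF p] by metis
  have "Lp_norm p (riesz_proj p x) \<le> C * Lp_norm p x" if x: "x \<in> Lp p" for x
    using C(2)[OF x] riesz_proj_eqI[OF p x] by metis
  then show ?thesis using that C(1) by blast
qed

lemma Hp_add: "1 < p \<Longrightarrow> f \<in> Hp p \<Longrightarrow> g \<in> Hp p \<Longrightarrow> f + g \<in> Hp p"
  and Hp_diff: "1 < p \<Longrightarrow> f \<in> Hp p \<Longrightarrow> g \<in> Hp p \<Longrightarrow> f - g \<in> Hp p"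
  using Lp_le_1(1)[of p] by (auto simp: Hp_def Lp_add Lp_diff fourier_coeff_add fourier_coeff_diff)

lemma Hp_smult: "1 < p \<Longrightarrow> f \<in> Hp p \<Longrightarrow> z *\<^sub>C f \<in> Hp p"
  by (auto simp: Hp_def Lp_smult)

lemma Hp_zero [simp]: "0 \<in> Hp p"
  by (simp add: Hp_def)

lemma Hp_sum: "1 < p \<Longrightarrow> (\<And>i. i \<in> A \<Longrightarrow> f i \<in> Hp p) \<Longrightarrow> sum f A \<in> Hp p"
  by (induction A rule: infinite_finite_induct) (auto intro: Hp_add)

lemma Hp_tpow: "1 < p \<Longrightarrow> 0 \<le> k \<Longrightarrow> tpow k \<in> Hp p"
  by (simp add: Hp_def fourier_coeff_tpow Linf_subset_Lp)

lemma Hp_tpow_mult: "1 < p \<Longrightarrow> 0 \<le> k \<Longrightarrow> f \<in> Hp p \<Longrightarrow> tpow k * f \<in> Hp p"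
  by (simp add: Hp_def)

lemma Hp_closed:
  assumes p: "1 < p" and "\<And>n::nat. F n \<in> Hp p" "f \<in> Lp p" "(\<lambda>n. Lp_norm p (F n - f)) \<longlonglongrightarrow> 0"
  shows "f \<in> Hp p"
proof -
  have "fourier_coeff f k = 0" if "k < 0" for k
    using Lp_fourier_coeff_tendsto[OF p _ assms(3,4), of k] Hp_coeff[OF assms(2) that] Hp_Lp[OF assms(2)]
    by (simp add: LIMSEQ_const_iff)
  then show ?thesis using assms(3) by (simp add: Hp_def)
qed

lemma riesz_proj_add:
  assumes p: "1 < p" and x: "x \<in> Lp p" and y: "y \<in> Lp p"
  shows "riesz_proj p (x + y) = riesz_proj p x + riesz_proj p y"
proof (rule riesz_proj_eqI[OF p])
  show "fourier_coeff (riesz_proj p x + riesz_proj p y) n = fourier_coeff (x + y) n" if "n \<ge> 0" for n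
    using riesz_proj_coeff[OF p x that] riesz_proj_coeff[OF p y that] Lp_le_1(1)[OF p] x y
      Hp_Lp[OF riesz_proj_Hp[OF p x]] Hp_Lp[OF riesz_proj_Hp[OF p y]] by (simp add: fourier_coeff_add)
qed (use p x y in \<open>auto intro!: Lp_add Hp_add riesz_proj_Hp\<close>)

lemma riesz_proj_smult:
  assumes p: "1 < p" and x: "x \<in> Lp p"
  shows "riesz_proj p (z *\<^sub>C x) = z *\<^sub>C riesz_proj p x"
proof (rule riesz_proj_eqI[OF p])
  show "fourier_coeff (z *\<^sub>C riesz_proj p x) n = fourier_coeff (z *\<^sub>C x) n" if "n \<ge> 0" for n
    using riesz_proj_coeff[OF p x that] by simp
qed (use p x in \<open>auto intro!: Lp_smult Hp_smult riesz_proj_Hp\<close>)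

lemma riesz_proj_diff:
  assumes p: "1 < p" and x: "x \<in> Lp p" and y: "y \<in> Lp p"
  shows "riesz_proj p (x - y) = riesz_proj p x - riesz_proj p y"
  using riesz_proj_add[OF p x Lp_smult[OF _ y], of "- 1"] riesz_proj_smult[OF p y, of "- 1"] p
  by (simp add: minus_eq_smult[symmetric])

lemma riesz_proj_ident: "1 < p \<Longrightarrow> f \<in> Hp p \<Longrightarrow> riesz_proj p f = f"
  by (rule riesz_proj_eqI) (auto simp: Hp_Lp)

section \<open>Products of Hardy functions\<close>

lemma riesz_proj_trig:
  assumes p: "1 < p" and "y \<in> trig"
  shows "riesz_proj p y \<in> circle_span (tpow ` {0..})"
  using assms(2)
proof (induction rule: trig_induct)
  case zero
  then show ?case using riesz_proj_ident[OF p Hp_zero] by (simp add: circle_fun.span_zero)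
next
  case (add z k y)
  have p0: "0 < p" using p by simp
  have t: "riesz_proj p (tpow k) \<in> circle_span (tpow ` {0..})"
  proof (cases "0 \<le> k")
    case True
    then show ?thesis using riesz_proj_ident[OF p Hp_tpow[OF p True]] by (auto intro: circle_fun.span_base)
  next
    case False
    then have "riesz_proj p (tpow k) = 0"
      by (intro riesz_proj_eqI[OF p]) (auto simp: fourier_coeff_tpow Linf_subset_Lp[OF p0])
    then show ?thesis by (simp add: circle_fun.span_zero)
  qed
  have tL: "tpow k \<in> Lp p" by (simp add: Linf_subset_Lp p0)
  have L: "z *\<^sub>C tpow k \<in> Lp p" "tpow k \<in> Lp p" "y \<in> Lp p"
    using p0 add by (simp_all add: Lp_smult tL trig_Lp)
  show ?case unfolding riesz_proj_add[OF p L(1) L(3)] riesz_proj_smult[OF p L(2)]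
    by (intro circle_fun.span_add circle_fun.span_scale t add)
qed

text \<open>Projecting a trigonometric approximation gives an analytic one, with the error enlarged
  at most by the norm of the projection.\<close>

lemma Hp_dense:
  assumes p: "1 < p" and f: "f \<in> Hp p" and e: "0 < e"
  obtains y where "y \<in> circle_span (tpow ` {0..})" "y \<in> Hp p" "Lp_norm p (f - y) < e"
proof -
  obtain C where C: "0 \<le> C" "\<And>x. x \<in> Lp p \<Longrightarrow> Lp_norm p (riesz_proj p x) \<le> C * Lp_norm p x"
    using riesz_proj_bounded[OF p] by blast
  have "0 < e / (C + 1)" using C e by simp
  then obtain y where y: "y \<in> trig" "Lp_norm p (f - y) < e / (C + 1)"
    using trig_dense[OF p Hp_Lp[OF f]] by blast
  have yL: "y \<in> Lp p" using y p by (intro trig_Lp) auto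
  have "f - riesz_proj p y = riesz_proj p (f - y)"
    using riesz_proj_diff[OF p Hp_Lp[OF f] yL] riesz_proj_ident[OF p f] by simp
  then have "Lp_norm p (f - riesz_proj p y) \<le> C * Lp_norm p (f - y)"
    using C(2)[of "f - y"] Lp_diff[OF _ Hp_Lp[OF f] yL] p by simp
  also have "\<dots> \<le> (C + 1) * Lp_norm p (f - y)" by (simp add: mult_right_mono)
  also have "\<dots> < e" using y(2) C(1) by (simp add: pos_less_divide_eq mult.commute)
  finally show ?thesis using that riesz_proj_trig[OF p y(1)] riesz_proj_Hp[OF p yL] by blast
qed

text \<open>For fixed \<open>g\<close> the difference \<open>D\<close> of the two sides is linear
  and continuous in \<open>f\<close> and vanishes on the monomials, whose span is dense. For
  \<open>k < 0\<close> the sum is empty, so the product has no negative coefficients.\<close>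

lemma Hp_mult_coeff:
  assumes p: "1 < p" and q: "1/p + 1/q = 1" and f: "f \<in> Hp p" and g: "g \<in> Hp q"
  shows "fourier_coeff (f * g) k = (\<Sum>j\<in>{0..k}. fourier_coeff f j * fourier_coeff g (k - j))"
proof -
  have q1: "1 < q" by (rule conjugate_exponent[OF p q])
  have p0: "0 < p" using p by simp
  have gL: "g \<in> Lp q" "g \<in> Lp 1" using g Lp_le_1(1)[OF q1] by (auto simp: Hp_Lp)
  define D where "D x = fourier_coeff (x * g) k - (\<Sum>j\<in>{0..k}. fourier_coeff x j * fourier_coeff g (k - j))" for x
  define K where "K = Lp_norm q g + (\<Sum>j\<in>{0..k}. norm (fourier_coeff g (k - j)))"
  have K: "0 \<le> K" by (auto simp: K_def intro!: add_nonneg_nonneg sum_nonneg)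
  have D_add: "D (x + y) = D x + D y" if "x \<in> Lp p" "y \<in> Lp p" for x y
    using that Lp_mult_1(1)[OF p q that(1) gL(1)] Lp_mult_1(1)[OF p q that(2) gL(1)] Lp_le_1(1)[OF p]
    by (simp add: D_def distrib_right fourier_coeff_add sum.distrib)
  have D_smult: "D (z *\<^sub>C x) = z * D x" for z x
    by (simp add: D_def right_diff_distrib sum_distrib_left mult.assoc)
  have D_bound: "norm (D x) \<le> K * Lp_norm p x" if x: "x \<in> Lp p" for x
  proof -
    have "norm (D x) \<le> norm (fourier_coeff (x * g) k) + norm (\<Sum>j\<in>{0..k}. fourier_coeff x j * fourier_coeff g (k - j))"
      unfolding D_def by (rule norm_triangle_ineq4)
    also have "norm (fourier_coeff (x * g) k) \<le> Lp_norm p x * Lp_norm q g"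
      using norm_fourier_coeff_le[OF Lp_mult_1(1)[OF p q x gL(1)]] Lp_mult_1(2)[OF p q x gL(1)] by (rule order_trans)
    also have "norm (\<Sum>j\<in>{0..k}. fourier_coeff x j * fourier_coeff g (k - j)) \<le> (\<Sum>j\<in>{0..k}. Lp_norm p x * norm (fourier_coeff g (k - j)))"
    proof (rule sum_norm_le)
      fix j
      have "norm (fourier_coeff x j) \<le> Lp_norm p x"
        using norm_fourier_coeff_le[OF Lp_le_1(1)[OF p x]] Lp_le_1(2)[OF p x] by (rule order_trans)
      then show "norm (fourier_coeff x j * fourier_coeff g (k - j)) \<le> Lp_norm p x * norm (fourier_coeff g (k - j))"
        by (simp add: norm_mult mult_right_mono)
    qed
    finally show ?thesis by (simp add: K_def algebra_simps sum_distrib_left)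
  qed
  have D_poly: "y \<in> Lp p \<and> D y = 0" if "y \<in> circle_span (tpow ` {0..})" for y
    using that
  proof (induction rule: circle_fun.span_induct_alt)
    case base
    then show ?case by (simp add: D_def)
  next
    case (step c x y)
    then obtain i where i: "x = tpow i" "0 \<le> i" by auto
    have xL: "x \<in> Lp p" using i p0 by (auto intro: Linf_subset_Lp)
    have "D x = fourier_coeff g (k - i) - (\<Sum>j\<in>{0..k}. (if j = i then fourier_coeff g (k - j) else 0))"
    proof -
      have "(\<Sum>j\<in>{0..k}. fourier_coeff x j * fourier_coeff g (k - j)) = (\<Sum>j\<in>{0..k}. (if j = i then fourier_coeff g (k - j) else 0))"
        unfolding i by (intro sum.cong) (auto simp: fourier_coeff_tpow)
      then show ?thesis by (simp add: D_def i)
    qed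
    also have "\<dots> = 0" using i(2) Hp_coeff[OF g, of "k - i"] by simp
    finally have "D x = 0" .
    then show ?case using step xL p0 by (simp add: D_add D_smult Lp_smult Lp_add)
  qed
  have le: "norm (D f) \<le> K * e" if e: "0 < e" for e
  proof -
    obtain y where y: "y \<in> circle_span (tpow ` {0..})" "y \<in> Hp p" "Lp_norm p (f - y) < e"
      using Hp_dense[OF p f e] by blast
    have "f - y \<in> Lp p" using f y p0 by (intro Lp_diff Hp_Lp)
    then have "D ((f - y) + y) = D (f - y) + D y" using y Hp_Lp by (intro D_add) auto
    then have "norm (D f) = norm (D (f - y))" using D_poly[OF y(1)] by simp
    also have "\<dots> \<le> K * Lp_norm p (f - y)" by (rule D_bound) fact
    also have "\<dots> \<le> K * e" using y K by (intro mult_left_mono) auto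
    finally show ?thesis .
  qed
  have "((\<lambda>e. K * e) \<longlongrightarrow> 0) (at_right 0)" by (auto intro!: tendsto_eq_intros)
  then have "norm (D f) \<le> 0"
    by (rule tendsto_lowerbound[OF _ eventually_at_rightI[of 0 1]]) (simp_all add: le)
  then show ?thesis by (simp add: D_def)
qed

lemma Hp_mult_coeff_neg:
  assumes "1 < p" "1/p + 1/q = 1" "f \<in> Hp p" "g \<in> Hp q" "k < 0"
  shows "fourier_coeff (f * g) k = 0"
  using Hp_mult_coeff[OF assms(1-4), of k] assms(5) by simp

section \<open>Duality and the bounded inverse theorem on Hardy spaces\<close>

text \<open>The functional \<open>s \<mapsto> cint (s * tilde g)\<close> pairs the \<open>n\<close>-th coefficient of \<open>s\<close> with the \<open>n\<close>-th
  coefficient of \<open>g\<close>.\<close>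

lemma Hp_annihilator:
  assumes q: "1/p + 1/q = 1" and S: "closed_Lp_subspace p S" "S \<subseteq> Hp p" and f: "f \<in> Hp p" "f \<notin> S"
  obtains g where "g \<in> Hp q" "g \<noteq> 0" "\<And>s. s \<in> S \<Longrightarrow> cint (s * tilde g) = 0"
proof -
  interpret S: closed_Lp_subspace p S by (rule S)
  note p = S.p
  have p0: "0 < p" "1 \<le> p" using p by auto
  \<comment> \<open>The preimage of \<open>S\<close> under the projection contains all monomials of
    negative index. A functional annihilating it therefore has no coefficients of positive index,
    and its reflection is analytic.\<close>
  define S' where "S' = {x \<in> Lp p. riesz_proj p x \<in> S}"
  interpret S': closed_Lp_subspace p S'
  proof
    show "0 \<in> S'" using riesz_proj_ident[OF p Hp_zero] S.zero by (simp add: S'_def)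
    show "x + y \<in> S'" if "x \<in> S'" "y \<in> S'" for x y
      using that p p0 S.add by (auto simp: S'_def riesz_proj_add Lp_add)
    show "z *\<^sub>C x \<in> S'" if "x \<in> S'" for x z
      using that p p0 S.smult by (auto simp: S'_def riesz_proj_smult Lp_smult)
    show "y \<in> S'" if g: "\<And>k::nat. g k \<in> S'" and y: "y \<in> Lp p" and l: "(\<lambda>k. Lp_norm p (g k - y)) \<longlonglongrightarrow> 0" for g y
    proof -
      obtain C where C: "0 \<le> C" "\<And>x. x \<in> Lp p \<Longrightarrow> Lp_norm p (riesz_proj p x) \<le> C * Lp_norm p x"
        using riesz_proj_bounded[OF p] by blast
      have "riesz_proj p y \<in> S"
      proof (rule S.closed[of "\<lambda>k. riesz_proj p (g k)"])
        show "riesz_proj p (g k) \<in> S" for k using g by (simp add: S'_def)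
        show "riesz_proj p y \<in> Lp p" by (intro Hp_Lp riesz_proj_Hp p y)
        show "(\<lambda>k. Lp_norm p (riesz_proj p (g k) - riesz_proj p y)) \<longlonglongrightarrow> 0"
        proof (rule Lim_null_comparison[OF always_eventually], rule allI)
          fix k
          have gk: "g k \<in> Lp p" using g by (simp add: S'_def)
          show "norm (Lp_norm p (riesz_proj p (g k) - riesz_proj p y)) \<le> C * Lp_norm p (g k - y)"
            using C(2)[OF Lp_diff[OF p0(1) gk y]] riesz_proj_diff[OF p gk y] by simp
          show "(\<lambda>k. C * Lp_norm p (g k - y)) \<longlonglongrightarrow> 0" using tendsto_mult_right_zero[OF l] .
        qed
      qed
      then show ?thesis using y by (simp add: S'_def)
    qed
  qed (use p in \<open>auto simp: S'_def\<close>)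
  have "f \<notin> S'" using f riesz_proj_ident[OF p f(1)] by (simp add: S'_def)
  then obtain k where k: "k \<in> Lp q" "cint (k * f) \<noteq> 0" "\<And>s. s \<in> S' \<Longrightarrow> cint (k * s) = 0"
    using S'.annihilator[OF q Hp_Lp[OF f(1)]] by blast
  have "fourier_coeff k n = 0" if n: "n > 0" for n
  proof -
    have "riesz_proj p (tpow (-n)) = 0"
      using n by (intro riesz_proj_eqI[OF p]) (auto simp: fourier_coeff_tpow Linf_subset_Lp[OF p0(1)])
    then have "tpow (-n) \<in> S'" using S.zero by (auto simp: S'_def Linf_subset_Lp[OF p0(1)])
    from k(3)[OF this] show ?thesis by (simp add: fourier_coeff_eq mult.commute)
  qed
  then have "tilde k \<in> Hp q" using k(1) by (simp add: Hp_def)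
  moreover have "tilde k \<noteq> 0" using k(2) tilde_tilde[of k] by (metis cint_zero mult_zero_left tilde_hom(6))
  moreover have "cint (s * tilde (tilde k)) = 0" if "s \<in> S" for s
  proof -
    have "s \<in> S'" using that S(2) riesz_proj_ident[OF p, of s] by (auto simp: S'_def Hp_Lp)
    from k(3)[OF this] show ?thesis by (simp add: mult.commute)
  qed
  ultimately show ?thesis using that by blast
qed

text \<open>An annihilator \<open>k\<close> of \<open>S\<close> with nonzero pairing with
  \<open>y\<close> reads off the coefficient of \<open>y\<close> continuously; so these coefficients
  converge along a convergent sequence, and with them the components in \<open>S\<close>.\<close>

lemma closed_Lp_subspace_add_line:
  assumes S: "closed_Lp_subspace p S" and y: "y \<in> Lp p"
  shows "closed_Lp_subspace p {s + z *\<^sub>C y | s z. s \<in> S}"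
proof (cases "y \<in> S")
  case True
  interpret S: closed_Lp_subspace p S by (rule S)
  have "{s + z *\<^sub>C y | s z. s \<in> S} = S"
  proof safe
    show "\<exists>s z. x = s + z *\<^sub>C y \<and> s \<in> S" if "x \<in> S" for x
      using that by (intro exI[of _ x] exI[of _ 0]) simp
  qed (use True S.add S.smult in auto)
  then show ?thesis using S by simp
next
  case False
  interpret S: closed_Lp_subspace p S by (rule S)
  have p0: "0 < p" "1 \<le> p" using S.p by auto
  define q where "q = p / (p - 1)"
  have q: "1/p + 1/q = 1" using S.p by (simp add: q_def field_simps)
  obtain k where k: "k \<in> Lp q" "cint (k * y) \<noteq> 0" "\<And>s. s \<in> S \<Longrightarrow> cint (k * s) = 0"
    using S.annihilator[OF q y False] by blast
  have k1: "k * x \<in> Lp 1" if "x \<in> Lp p" for x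
    using Lp_mult_1(1)[OF S.p q that k(1)] by (simp add: mult.commute)
  show ?thesis
  proof
    show "\<And>g w. (\<And>j::nat. g j \<in> {s + z *\<^sub>C y | s z. s \<in> S}) \<Longrightarrow> w \<in> Lp p \<Longrightarrow>
      (\<lambda>j. Lp_norm p (g j - w)) \<longlonglongrightarrow> 0 \<Longrightarrow> w \<in> {s + z *\<^sub>C y | s z. s \<in> S}"
    proof -
      fix g :: "nat \<Rightarrow> circle_fun" and w
      assume g: "\<And>j. g j \<in> {s + z *\<^sub>C y | s z. s \<in> S}" and w: "w \<in> Lp p" and l: "(\<lambda>j. Lp_norm p (g j - w)) \<longlonglongrightarrow> 0"
      obtain s z where sz: "\<And>j. s j \<in> S" "\<And>j. g j = s j + z j *\<^sub>C y" using g by simp metis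
      have sL: "s j \<in> Lp p" for j using sz S.subset by auto
      have gL: "g j \<in> Lp p" for j unfolding sz by (intro Lp_add Lp_smult sL y p0)
      have cg: "cint (k * g j) = z j * cint (k * y)" for j
        unfolding sz using k1[OF sL] k1[OF Lp_smult[OF p0(1) y]] k(3)[OF sz(1)]
        by (simp add: distrib_left cint_add cint_smult)
      have "(\<lambda>j. cint (k * g j) - cint (k * w)) \<longlonglongrightarrow> 0"
      proof (rule Lim_null_comparison[OF always_eventually], rule allI)
        fix j
        have d: "g j - w \<in> Lp p" by (intro Lp_diff gL w p0)
        have "cint (k * g j) - cint (k * w) = cint (k * (g j - w))"
          using k1[OF gL] k1[OF w] by (simp add: right_diff_distrib cint_diff)
        also have "norm \<dots> \<le> Lp_norm 1 ((g j - w) * k)" using norm_cint_le[OF k1[OF d]] by (simp add: mult.commute)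
        also have "\<dots> \<le> Lp_norm p (g j - w) * Lp_norm q k" by (rule Lp_mult_1(2)[OF S.p q d k(1)])
        finally show "norm (cint (k * g j) - cint (k * w)) \<le> Lp_norm p (g j - w) * Lp_norm q k" .
        show "(\<lambda>j. Lp_norm p (g j - w) * Lp_norm q k) \<longlonglongrightarrow> 0" using tendsto_mult_left_zero[OF l] .
      qed
      then have "(\<lambda>j. (z j * cint (k * y)) / cint (k * y)) \<longlonglongrightarrow> cint (k * w) / cint (k * y)"
        unfolding cg[symmetric] using k(2) by (intro tendsto_intros) (auto intro: LIM_zero_cancel)
      then have z: "z \<longlonglongrightarrow> cint (k * w) / cint (k * y)" using k(2) by simp
      define z0 where "z0 = cint (k * w) / cint (k * y)"
      have "w - z0 *\<^sub>C y \<in> S"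
      proof (rule S.closed[of s])
        show "w - z0 *\<^sub>C y \<in> Lp p" by (intro Lp_diff Lp_smult w y p0)
        show "(\<lambda>j. Lp_norm p (s j - (w - z0 *\<^sub>C y))) \<longlonglongrightarrow> 0"
        proof (rule Lim_null_comparison[OF always_eventually], rule allI)
          fix j
          have e: "s j - (w - z0 *\<^sub>C y) = (g j - w) + (z0 - z j) *\<^sub>C y"
            by (simp add: sz circle_fun.scale_left_diff_distrib algebra_simps)
          show "norm (Lp_norm p (s j - (w - z0 *\<^sub>C y))) \<le> Lp_norm p (g j - w) + norm (z0 - z j) * Lp_norm p y"
            unfolding e using Lp_norm_triangle[OF p0(2) Lp_diff[OF p0(1) gL w] Lp_smult[OF p0(1) y], of j "z0 - z j"] p0
            by (simp add: Lp_norm_smult)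
          have "(\<lambda>j. norm (z0 - z j)) \<longlonglongrightarrow> norm (z0 - z0)" using z unfolding z0_def[symmetric] by (intro tendsto_intros)
          then have "(\<lambda>j. norm (z0 - z j)) \<longlonglongrightarrow> 0" by simp
          from tendsto_add[OF l tendsto_mult_left_zero[OF this]]
          show "(\<lambda>j. Lp_norm p (g j - w) + norm (z0 - z j) * Lp_norm p y) \<longlonglongrightarrow> 0" by simp
        qed
      qed (use sz in auto)
      then show "w \<in> {s + z *\<^sub>C y | s z. s \<in> S}"
        by (intro CollectI exI[of _ "w - z0 *\<^sub>C y"] exI[of _ z0]) simp
    qed
    show "x + x' \<in> {s + z *\<^sub>C y | s z. s \<in> S}" if "x \<in> {s + z *\<^sub>C y | s z. s \<in> S}" "x' \<in> {s + z *\<^sub>C y | s z. s \<in> S}" for x x'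
    proof -
      obtain s z s' z' where "x = s + z *\<^sub>C y" "x' = s' + z' *\<^sub>C y" "s \<in> S" "s' \<in> S" using \<open>x \<in> _\<close> \<open>x' \<in> _\<close> by auto
      then show ?thesis
        by (intro CollectI exI[of _ "s + s'"] exI[of _ "z + z'"]) (auto simp: circle_fun.scale_left_distrib S.add)
    qed
    show "c *\<^sub>C x \<in> {s + z *\<^sub>C y | s z. s \<in> S}" if "x \<in> {s + z *\<^sub>C y | s z. s \<in> S}" for x c
    proof -
      obtain s z where "x = s + z *\<^sub>C y" "s \<in> S" using \<open>x \<in> _\<close> by auto
      then show ?thesis
        by (intro CollectI exI[of _ "c *\<^sub>C s"] exI[of _ "c * z"]) (auto simp: circle_fun.scale_right_distrib S.smult)
    qed
    show "0 \<in> {s + z *\<^sub>C y | s z. s \<in> S}"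
      using S.zero by (intro CollectI exI[of _ 0]) auto
  qed (use S.p S.subset y p0 in \<open>auto intro!: Lp_add Lp_smult\<close>)
qed

lemma closed_Lp_subspace_add_span:
  fixes e :: "nat \<Rightarrow> circle_fun"
  assumes "closed_Lp_subspace p S" "\<And>i. e i \<in> Lp p"
  shows "closed_Lp_subspace p {s + (\<Sum>i<n. z i *\<^sub>C e i) | s z. s \<in> S}"
proof (induction n)
  case 0
  have "{s + (\<Sum>i<0. z i *\<^sub>C e i) | s z. s \<in> S} = S" by simp
  then show ?case using assms(1) by simp
next
  case (Suc n)
  define T where "T = {s + (\<Sum>i<n. z i *\<^sub>C e i) | s z. s \<in> S}"
  have "{t + w *\<^sub>C e n | t w. t \<in> T} = {s + (\<Sum>i<Suc n. z i *\<^sub>C e i) | s z. s \<in> S}" (is "?L = ?R")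
  proof
    show "?L \<subseteq> ?R"
    proof
      fix x assume "x \<in> ?L"
      then obtain s z w where x: "x = s + (\<Sum>i<n. z i *\<^sub>C e i) + w *\<^sub>C e n" "s \<in> S" by (auto simp: T_def)
      have "x = s + (\<Sum>i<Suc n. (z(n := w)) i *\<^sub>C e i)" unfolding x by (simp add: add.assoc)
      then show "x \<in> ?R" using x(2) by blast
    qed
    show "?R \<subseteq> ?L"
    proof
      fix x assume "x \<in> ?R"
      then obtain s z where "x = s + (\<Sum>i<n. z i *\<^sub>C e i) + z n *\<^sub>C e n" "s \<in> S" by (auto simp: add.assoc)
      then show "x \<in> ?L" unfolding T_def by blast
    qed
  qed
  then show ?case
    using closed_Lp_subspace_add_line[of p T "e n"] Suc assms(2) unfolding T_def by simp
qed

section \<open>Completeness, Baire category and bounded inverses\<close>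

lemma Hp_complete:
  assumes p: "1 < p" and F: "\<And>n::nat. F n \<in> Hp p"
    and C: "\<And>e. e > 0 \<Longrightarrow> \<exists>N. \<forall>m\<ge>N. \<forall>n\<ge>N. Lp_norm p (F m - F n) < e"
  obtains f where "f \<in> Hp p" "(\<lambda>n. Lp_norm p (F n - f)) \<longlonglongrightarrow> 0"
proof -
  obtain f where f: "f \<in> Lp p" "(\<lambda>n. Lp_norm p (F n - f)) \<longlonglongrightarrow> 0"
    using Lp_complete[OF p Hp_Lp[OF F] C] by blast
  then show ?thesis using that Hp_closed[OF p F f] by blast
qed

lemma Hp_Metric_space:
  assumes p: "1 < p"
  shows "Metric_space (Hp p) (\<lambda>f g. Lp_norm p (f - g))" "Metric_space.mcomplete (Hp p) (\<lambda>f g. Lp_norm p (f - g))"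
proof -
  have p0: "0 < p" "1 \<le> p" using p by auto
  show M: "Metric_space (Hp p) (\<lambda>f g. Lp_norm p (f - g))"
  proof
    show "Lp_norm p (x - y) = 0 \<longleftrightarrow> x = y" if "x \<in> Hp p" "y \<in> Hp p" for x y
      using Lp_norm_eq_0[OF p0(1), of "x - y"] that p by (auto simp: Hp_Lp Lp_diff)
  qed (auto simp: Lp_norm_diff_commute Hp_Lp intro: Lp_norm_triangle_diff[OF p0(2)])
  interpret Metric_space "Hp p" "\<lambda>f g. Lp_norm p (f - g)" by (rule M)
  show "mcomplete" unfolding mcomplete_def
  proof (intro allI impI)
    fix \<sigma> assume \<sigma>: "MCauchy \<sigma>"
    then have H: "\<sigma> n \<in> Hp p" for n by (auto simp: MCauchy_def)
    have C: "\<exists>N. \<forall>m\<ge>N. \<forall>n\<ge>N. Lp_norm p (\<sigma> m - \<sigma> n) < e" if e: "e > 0" for e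
    proof -
      have "\<forall>e>0. \<exists>N. \<forall>n n'. N \<le> n \<longrightarrow> N \<le> n' \<longrightarrow> Lp_norm p (\<sigma> n - \<sigma> n') < e"
        using \<sigma> by (simp add: MCauchy_def)
      from this[rule_format, OF e] show ?thesis by metis
    qed
    obtain f where f: "f \<in> Hp p" "(\<lambda>n. Lp_norm p (\<sigma> n - f)) \<longlonglongrightarrow> 0"
      by (rule Hp_complete[OF p H C])
    have "limitin mtopology \<sigma> f sequentially"
      using f H order_tendstoD(2)[OF f(2)] unfolding limitin_metric by (auto elim!: eventually_mono)
    then show "\<exists>x. limitin mtopology \<sigma> x sequentially" by blast
  qed
qed

lemma Hp_minus: "1 < p \<Longrightarrow> f \<in> Hp p \<Longrightarrow> - f \<in> Hp p"
  unfolding minus_eq_smult by (rule Hp_smult)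

text \<open>Here \<open>N\<close> is an arbitrary real function; the absolute values make the
  constant nonnegative in any case.\<close>

lemma bounded_operator_onD:
  assumes "bounded_operator_on X N A"
  shows "f \<in> X \<Longrightarrow> A f \<in> X" "f \<in> X \<Longrightarrow> g \<in> X \<Longrightarrow> A (f + g) = A f + A g" "f \<in> X \<Longrightarrow> A (z *\<^sub>C f) = z *\<^sub>C A f"
    and "\<exists>K\<ge>0. \<forall>f\<in>X. N (A f) \<le> K * \<bar>N f\<bar>"
proof -
  obtain K where K: "\<forall>f\<in>X. N (A f) \<le> K * N f" using assms by (auto simp: bounded_operator_on_def)
  have "N (A f) \<le> \<bar>K\<bar> * \<bar>N f\<bar>" if "f \<in> X" for f
    using K that abs_ge_self[of "K * N f"] by (auto simp: abs_mult intro: order_trans)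
  then show "\<exists>K\<ge>0. \<forall>f\<in>X. N (A f) \<le> K * \<bar>N f\<bar>" by (intro exI[of _ "\<bar>K\<bar>"]) auto
qed (use assms in \<open>auto simp: bounded_operator_on_def\<close>)

text \<open>The sets where the inverse is bounded by \<open>n\<close> cover the space, so by Baire
  the closure of one of them contains a ball. Centring and scaling give approximate solutions with
  norm control at any accuracy; successive approximation makes them exact.\<close>

theorem Hp_bounded_inverse:
  assumes p: "1 < p" and A: "bounded_operator_on (Hp p) (Lp_norm p) A" and bij: "bij_betw A (Hp p) (Hp p)"
  shows "invertible_on (Hp p) (Lp_norm p) A"
proof -
  have p0: "0 < p" "1 \<le> p" using p by auto
  define B where "B = inv_into (Hp p) A"
  have BH: "B y \<in> Hp p" if "y \<in> Hp p" for y
    unfolding B_def using bij that by (metis bij_betw_def inv_into_into)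
  have AB: "A (B y) = y" if "y \<in> Hp p" for y
    unfolding B_def using bij that by (metis bij_betw_inv_into_right)
  have BA: "B (A x) = x" if "x \<in> Hp p" for x
    unfolding B_def using bij that by (metis bij_betw_inv_into_left)
  note A_Hp = bounded_operator_onD(1)[OF A] and A_add = bounded_operator_onD(2)[OF A]
    and A_smult = bounded_operator_onD(3)[OF A]
  have B_add: "B (x + y) = B x + B y" if "x \<in> Hp p" "y \<in> Hp p" for x y
    using BA[of "B x + B y"] that by (simp add: A_add BH AB Hp_add p)
  have B_smult: "B (z *\<^sub>C x) = z *\<^sub>C B x" if "x \<in> Hp p" for z x
    using BA[of "z *\<^sub>C B x"] that by (simp add: A_smult BH AB Hp_smult p)
  have B_diff: "B (x - y) = B x - B y" if "x \<in> Hp p" "y \<in> Hp p" for x y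
    using B_add[of x "- y"] B_smult[of y "-1"] that Hp_minus[OF p that(2)] by (simp add: minus_eq_smult[symmetric])
  obtain K where K: "0 \<le> K" "\<And>f. f \<in> Hp p \<Longrightarrow> Lp_norm p (A f) \<le> K * Lp_norm p f"
    using bounded_operator_onD(4)[OF A] by auto
  interpret M: Metric_space "Hp p" "\<lambda>f g. Lp_norm p (f - g)" by (rule Hp_Metric_space(1)[OF p])
  define E where "E n = {y \<in> Hp p. Lp_norm p (B y) \<le> real n}" for n :: nat
  have E_sub: "E n \<subseteq> Hp p" for n by (auto simp: E_def)
  have cover: "(\<Union>n. M.mtopology closure_of E n) = Hp p"
  proof
    show "Hp p \<subseteq> (\<Union>n. M.mtopology closure_of E n)"
    proof
      fix y assume y: "y \<in> Hp p"
      obtain n where "Lp_norm p (B y) \<le> real n" using real_arch_simple by blast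
      then have "y \<in> E n" using y by (simp add: E_def)
      then show "y \<in> (\<Union>n. M.mtopology closure_of E n)"
        using closure_of_subset[of "E n" M.mtopology] E_sub by auto
    qed
  qed (use closure_of_subset_topspace[of M.mtopology] in auto)
  have "\<exists>n. M.mtopology interior_of (M.mtopology closure_of E n) \<noteq> {}"
  proof (rule ccontr)
    assume "\<not> ?thesis"
    then have "M.mtopology interior_of \<Union>(range (\<lambda>n. M.mtopology closure_of E n)) = {}"
      by (intro M.metric_Baire_category_alt Hp_Metric_space(2)[OF p]) auto
    then have "M.mtopology interior_of Hp p = {}" using cover by simp
    then show False using interior_of_topspace[of M.mtopology] Hp_zero[of p] by auto
  qed
  then obtain n y0 r where r: "0 < r" "y0 \<in> Hp p" "M.mball y0 r \<subseteq> M.mtopology closure_of E n"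
    by (auto simp: M.metric_interior_of)
  have near: "\<exists>u\<in>E n. Lp_norm p (y0 + z - u) < e" if "z \<in> Hp p" "Lp_norm p z < r" "0 < e" for z e
  proof -
    have "y0 + z \<in> M.mball y0 r" using that r p by (auto simp: Hp_add)
    then have "y0 + z \<in> M.mtopology closure_of E n" using r by blast
    then show ?thesis using that unfolding M.metric_closure_of by force
  qed
  have near0: "\<exists>u\<in>Hp p. Lp_norm p (B u) \<le> real n \<and> Lp_norm p (z - u) < e"
    if z: "z \<in> Hp p" "Lp_norm p z < r" and e: "0 < e" for z e
  proof -
    obtain u where u: "u \<in> E n" "Lp_norm p (y0 + z - u) < e" using near[OF z e] by blast
    have z': "- z \<in> Hp p" "Lp_norm p (- z) < r" using z Hp_smult[OF p z(1), of "-1"] by (auto simp: minus_eq_smult[symmetric])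
    obtain v where v: "v \<in> E n" "Lp_norm p (y0 + - z - v) < e" using near[OF z' e] by blast
    have uv: "u \<in> Hp p" "v \<in> Hp p" "Lp_norm p (B u) \<le> real n" "Lp_norm p (B v) \<le> real n" using u v by (auto simp: E_def)
    \<comment> \<open>\<open>u\<close> is close to y0 + z and \<open>v\<close> to y0 - z, so half
      their difference is close to \<open>z\<close>; this moves the ball to the origin.\<close>
    define w where "w = (1/2) *\<^sub>C (u - v)"
    have w: "w \<in> Hp p" unfolding w_def using p uv by (intro Hp_smult Hp_diff)
    have "B w = (1/2) *\<^sub>C (B u - B v)" unfolding w_def using uv p by (simp add: B_smult B_diff Hp_diff)
    then have "Lp_norm p (B w) \<le> (1/2) * (Lp_norm p (B u) + Lp_norm p (B v))"
      using Lp_norm_triangle[OF p0(2), of "B u" "- B v"] uv BH p0 by (simp add: Lp_norm_smult Hp_Lp)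
    then have 1: "Lp_norm p (B w) \<le> real n" using uv by simp
    have "z - w = (1/2) *\<^sub>C ((y0 + z - u) - (y0 + - z - v))"
    proof -
      have "z = (1/2) *\<^sub>C (z + z)" unfolding circle_fun.scale_right_distrib circle_fun.scale_left_distrib[symmetric] by simp
      then have "z - w = (1/2) *\<^sub>C (z + z) - (1/2) *\<^sub>C (u - v)" by (simp add: w_def)
      also have "\<dots> = (1/2) *\<^sub>C ((y0 + z - u) - (y0 + - z - v))"
        unfolding circle_fun.scale_right_diff_distrib[symmetric] by (simp add: algebra_simps)
      finally show ?thesis .
    qed
    then have "Lp_norm p (z - w) = (1/2) * Lp_norm p ((y0 + z - u) - (y0 + - z - v))"
      using p0 by (simp only: Lp_norm_smult) simp
    moreover have "y0 + z - u \<in> Lp p" "y0 + - z - v \<in> Lp p" using r z z' uv p by (auto intro!: Hp_Lp Hp_add Hp_diff)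
    then have "Lp_norm p ((y0 + z - u) - (y0 + - z - v)) \<le> Lp_norm p (y0 + z - u) + Lp_norm p (y0 + - z - v)"
      using Lp_norm_triangle[OF p0(2), of "y0 + z - u" "- (y0 + - z - v)"] by (simp only: Lp_norm_minus Lp_minus diff_conv_add_uminus)
    ultimately have "Lp_norm p (z - w) < e" using u v by linarith
    then show ?thesis using w 1 by blast
  qed
  \<comment> \<open>A nonzero \<open>z\<close> is scaled to norm r/2, inside the ball; scaling back
    multiplies the bound \<open>n\<close> by twice the norm of \<open>z\<close> over
    \<open>r\<close>.\<close>
  define L where "L = 2 * real n / r"
  have L: "0 \<le> L" using r by (simp add: L_def)
  have scaled: "\<exists>u\<in>Hp p. Lp_norm p (B u) \<le> L * Lp_norm p z \<and> Lp_norm p (z - u) \<le> e"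
    if z: "z \<in> Hp p" and e: "0 < e" for z e
  proof (cases "Lp_norm p z = 0")
    case True
    then have "z = 0" using Lp_norm_eq_0[OF p0(1) Hp_Lp[OF z]] by simp
    moreover have "B 0 = 0" using B_smult[OF Hp_zero, of 0] by simp
    ultimately show ?thesis using e by (intro bexI[of _ 0]) auto
  next
    case False
    define c where "c = 2 * Lp_norm p z / r"
    have c: "0 < c" using False r Lp_norm_nonneg[of p z] by (simp add: c_def less_le)
    define z' where "z' = of_real (1/c) *\<^sub>C z"
    have z': "z' \<in> Hp p" unfolding z'_def by (intro Hp_smult p z)
    have zz: "z = of_real c *\<^sub>C z'" using c by (simp add: z'_def)
    have nc: "norm (complex_of_real (1/c)) = 1/c" unfolding norm_of_real using c by simp
    have "Lp_norm p z' = 1/c * Lp_norm p z" unfolding z'_def Lp_norm_smult[OF p0(1)] nc ..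
    also have "\<dots> = r / 2" using False by (simp add: c_def)
    finally have "Lp_norm p z' = r / 2" .
    then have "Lp_norm p z' < r" using r by simp
    then obtain u where u: "u \<in> Hp p" "Lp_norm p (B u) \<le> real n" "Lp_norm p (z' - u) < e / c"
      using near0[OF z', of "e / c"] e c by auto
    have "Lp_norm p (B (of_real c *\<^sub>C u)) = c * Lp_norm p (B u)"
      using u c p0 by (simp add: B_smult Lp_norm_smult)
    also have "\<dots> \<le> c * real n" using u c by (intro mult_left_mono) auto
    also have "\<dots> = L * Lp_norm p z" by (simp add: c_def L_def)
    finally have 1: "Lp_norm p (B (of_real c *\<^sub>C u)) \<le> L * Lp_norm p z" .
    have "z - of_real c *\<^sub>C u = of_real c *\<^sub>C (z' - u)" by (subst zz) (simp add: circle_fun.scale_right_diff_distrib)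
    then have "Lp_norm p (z - of_real c *\<^sub>C u) = c * Lp_norm p (z' - u)" using c p0 by (simp add: Lp_norm_smult)
    also have "\<dots> \<le> c * (e / c)" using u c by (intro mult_left_mono) auto
    also have "\<dots> = e" using c by simp
    finally show ?thesis using 1 Hp_smult[OF p u(1)] by blast
  qed
  have bound: "Lp_norm p (B y) \<le> 2 * L * Lp_norm p y" if y: "y \<in> Hp p" for y
  proof (cases "Lp_norm p y = 0")
    case True
    then have "y = 0" using Lp_norm_eq_0[OF p0(1) Hp_Lp[OF y]] by simp
    moreover have "B 0 = 0" using B_smult[OF Hp_zero, of 0] by simp
    ultimately show ?thesis by simp
  next
    case False
    define N where "N = Lp_norm p y"
    have N: "0 < N" using False Lp_norm_nonneg[of p y] by (simp add: N_def less_le)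
    define U where "U z e = (SOME u. u \<in> Hp p \<and> Lp_norm p (B u) \<le> L * Lp_norm p z \<and> Lp_norm p (z - u) \<le> e)" for z e
    have U: "U z e \<in> Hp p" "Lp_norm p (B (U z e)) \<le> L * Lp_norm p z" "Lp_norm p (z - U z e) \<le> e"
      if "z \<in> Hp p" "0 < e" for z e
    proof -
      have "\<exists>u. u \<in> Hp p \<and> Lp_norm p (B u) \<le> L * Lp_norm p z \<and> Lp_norm p (z - u) \<le> e" using scaled[OF that] by blast
      from someI_ex[OF this] show "U z e \<in> Hp p" "Lp_norm p (B (U z e)) \<le> L * Lp_norm p z" "Lp_norm p (z - U z e) \<le> e"
        unfolding U_def by auto
    qed
    \<comment> \<open>\<open>Z k\<close> is the remainder of \<open>y\<close> after \<open>k\<close>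
      corrections, of norm at most \<open>N * (1/2)^k\<close>. The images of the corrections under
      \<open>B\<close> then have norms at most \<open>L * N * (1/2)^k\<close>, with sum at most
      \<open>2 * L * N\<close>.\<close>
    define Z where "Z = rec_nat y (\<lambda>k z. z - U z (N * (1/2)^Suc k))"
    have Z0: "Z 0 = y" and ZS: "Z (Suc k) = Z k - U (Z k) (N * (1/2)^Suc k)" for k by (simp_all add: Z_def)
    have eN: "0 < N * (1/2)^Suc k" for k using N by simp
    have ZH: "Z k \<in> Hp p" for k
      by (induction k) (use y U(1) eN p in \<open>auto simp: Z0 ZS simp del: power_Suc intro!: Hp_diff\<close>)
    have ZN: "Lp_norm p (Z k) \<le> N * (1/2)^k" for k
    proof (cases k)
      case (Suc j)
      show ?thesis unfolding Suc ZS by (rule U(3)[OF ZH eN])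
    qed (simp add: Z0 N_def)
    define s where "s m = B (y - Z m)" for m
    have yZ: "y - Z m \<in> Hp p" for m by (intro Hp_diff p y ZH)
    have sH: "s m \<in> Hp p" for m unfolding s_def by (intro BH yZ)
    have step: "Lp_norm p (s (Suc m) - s m) \<le> L * N * (1/2)^m" for m
    proof -
      have "s (Suc m) - s m = B ((y - Z (Suc m)) - (y - Z m))" unfolding s_def by (rule B_diff[symmetric]; rule yZ)
      also have "(y - Z (Suc m)) - (y - Z m) = U (Z m) (N * (1/2)^Suc m)" by (simp add: ZS)
      finally have "Lp_norm p (s (Suc m) - s m) \<le> L * Lp_norm p (Z m)" using U(2)[OF ZH eN] by simp
      also have "\<dots> \<le> L * (N * (1/2)^m)" by (intro mult_left_mono ZN L)
      finally show ?thesis by (simp add: mult.assoc)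
    qed
    have tele: "Lp_norm p (s (m + k) - s m) \<le> L * N * (\<Sum>i<k. (1/2)^(m + i))" for m k
    proof (induction k)
      case (Suc k)
      have "Lp_norm p (s (m + Suc k) - s m) \<le> Lp_norm p (s (Suc (m + k)) - s (m + k)) + Lp_norm p (s (m + k) - s m)"
        using sH by (simp, intro Lp_norm_triangle_diff[OF p0(2)] Hp_Lp) auto
      also have "\<dots> \<le> L * N * (1/2)^(m + k) + L * N * (\<Sum>i<k. (1/2)^(m + i))"
        by (intro add_mono step Suc)
      finally show ?case by (simp add: distrib_left)
    qed simp
    have geo: "(\<Sum>i<k. (1/2)^(m + i)) \<le> 2 * (1/2::real)^m" for m k
    proof -
      have "(\<Sum>i<k. (1/2)^(m + i)) = (1/2::real)^m * (\<Sum>i<k. (1/2)^i)" by (simp add: power_add sum_distrib_left)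
      also have "(\<Sum>i<k. (1/2::real)^i) = 2 * (1 - (1/2)^k)" by (subst sum_gp_strict) (simp add: field_simps)
      also have "(1/2::real)^m * (2 * (1 - (1/2)^k)) \<le> (1/2)^m * 2" by (intro mult_left_mono) auto
      finally show ?thesis by simp
    qed
    have tele': "Lp_norm p (s (m + k) - s m) \<le> L * N * 2 * (1/2)^m" for m k
    proof -
      have "L * N * (\<Sum>i<k. (1/2)^(m + i)) \<le> L * N * (2 * (1/2)^m)" using L N by (intro mult_left_mono geo) auto
      then show ?thesis using tele[of m k] by simp
    qed
    have "\<exists>M. \<forall>i\<ge>M. \<forall>j\<ge>M. Lp_norm p (s i - s j) < e" if e: "0 < e" for e
    proof -
      have "0 < e / (4 * (L * N + 1))" using e L N by (simp add: add_nonneg_pos)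
      then obtain M where M: "(1/2::real)^M < e / (4 * (L * N + 1))" using real_arch_pow_inv[of _ "1/2"] by auto
      have LN: "0 \<le> L * N" using L N by simp
      have "L * N * 2 * (1/2)^M < e / 2"
      proof -
        have "L * N * 2 * (1/2)^M \<le> (L * N + 1) * 2 * (1/2)^M" by (intro mult_right_mono) auto
        also have "\<dots> < e / 2" using M LN by (simp add: field_simps)
        finally show ?thesis .
      qed
      then have near: "Lp_norm p (s i - s M) < e / 2" if "i \<ge> M" for i
        using tele'[of M "i - M"] that by simp
      have "Lp_norm p (s i - s j) < e" if "i \<ge> M" "j \<ge> M" for i j
      proof -
        have "Lp_norm p (s i - s j) \<le> Lp_norm p (s i - s M) + Lp_norm p (s M - s j)"
          by (intro Lp_norm_triangle_diff p0 Hp_Lp sH)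
        then show ?thesis using near[OF that(1)] near[OF that(2)] by (simp add: Lp_norm_diff_commute[of p "s M"])
      qed
      then show ?thesis by blast
    qed
    then obtain x where x: "x \<in> Hp p" "(\<lambda>m. Lp_norm p (s m - x)) \<longlonglongrightarrow> 0"
      by (rule Hp_complete[OF p sH])
    have "A x = y"
    proof -
      have "(\<lambda>m. K * Lp_norm p (s m - x) + N * (1/2)^m) \<longlonglongrightarrow> K * 0 + N * 0"
        by (intro tendsto_intros x) auto
      moreover have "Lp_norm p (A x - y) \<le> K * Lp_norm p (s m - x) + N * (1/2)^m" for m
      proof -
        have "A (s m) = y - Z m" unfolding s_def by (rule AB[OF yZ])
        then have e: "A x - y = A (x - s m) - Z m"
          using A_add[of "x - s m" "s m"] x sH p by (simp add: Hp_diff algebra_simps)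
        have H: "x - s m \<in> Hp p" using x sH p by (intro Hp_diff)
        have "Lp_norm p (A (x - s m) - Z m) \<le> Lp_norm p (A (x - s m)) + Lp_norm p (Z m)"
          using Lp_norm_triangle[OF p0(2) Hp_Lp[OF A_Hp[OF H]], of "- Z m"] Hp_Lp[OF ZH] by simp
        also have "\<dots> \<le> K * Lp_norm p (s m - x) + N * (1/2)^m"
          using K(2)[OF H] ZN[of m] by (simp add: Lp_norm_diff_commute[of p x])
        finally show ?thesis unfolding e .
      qed
      ultimately have "Lp_norm p (A x - y) \<le> K * 0 + N * 0" by (intro LIMSEQ_le_const) auto
      then have "Lp_norm p (A x - y) = 0" using Lp_norm_nonneg[of p "A x - y"] by linarith
      then show ?thesis using Lp_norm_eq_0[OF p0(1), of "A x - y"] A_Hp x y p by (simp add: Hp_Lp Hp_diff)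
    qed
    then have Bx: "B y = x" using BA x by blast
    have s0: "s 0 = 0" using B_smult[OF Hp_zero, of 0] by (simp add: s_def Z0)
    have "(\<lambda>m. Lp_norm p (s m)) \<longlonglongrightarrow> Lp_norm p x"
      using x by (intro Lp_norm_tendsto p0 Hp_Lp sH)
    moreover have "Lp_norm p (s m) \<le> 2 * L * N" for m
      using tele'[of 0 m] s0 by simp
    ultimately have "Lp_norm p x \<le> 2 * L * N" by (intro LIMSEQ_le_const2) auto
    then show ?thesis by (simp add: Bx N_def)
  qed
  have "bounded_operator_on (Hp p) (Lp_norm p) B"
    unfolding bounded_operator_on_def using BH B_add B_smult bound by blast
  then show ?thesis unfolding invertible_on_def using A AB BA by blast
qed

section \<open>Invertible functions\<close>

lemmas tpow_mult = tpow_add[symmetric]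

lemma tpow_mult_left: "tpow i * (tpow j * x) = tpow (i + j) * x"
  by (simp add: tpow_add mult.assoc)

lemma cf_unit_iff:
  assumes [measurable]: "f \<in> borel_measurable circle"
  shows "cf f * inverse (cf f) = 1 \<longleftrightarrow> (AE t in circle. f t \<noteq> 0)"
proof -
  have "cf f * inverse (cf f) = 1 \<longleftrightarrow> (AE t in circle. f t * inverse (f t) = 1)"
    by (simp add: cf_simps one_circle_fun_def cf_eq_iff)
  also have "\<dots> \<longleftrightarrow> (AE t in circle. f t \<noteq> 0)"
    by (intro arg_cong2[where f = eventually]) (auto simp: fun_eq_iff)
  finally show ?thesis .
qed

text \<open>A product equal to 1 forces \<open>x\<close> to be nonzero almost everywhere, where the
  pointwise inverse is a true inverse.\<close>

lemma unit_of_mult: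
  assumes "x * y = (1 :: circle_fun)"
  shows "x * inverse x = 1"
proof -
  obtain f g where [measurable]: "f \<in> borel_measurable circle" "g \<in> borel_measurable circle"
    and xy: "x = cf f" "y = cf g" by (cases x; cases y) auto
  have "AE t in circle. f t * g t = 1"
    using assms unfolding xy by (simp add: cf_simps one_circle_fun_def cf_eq_iff)
  then have "AE t in circle. f t \<noteq> 0" by eventually_elim auto
  then show ?thesis unfolding xy by (simp add: cf_unit_iff)
qed

lemma inverse_eq_of_mult: "x * y = (1 :: circle_fun) \<Longrightarrow> inverse x = y"
  using unit_of_mult[of x y] by (metis mult.assoc mult.commute mult_1_left)

lemma GLinf_unit:
  assumes "a \<in> GLinf"
  shows "a \<in> Linf" "inverse a \<in> Linf" "a * inverse a = 1"
  using assms inverse_eq_of_mult unit_of_mult by (auto simp: GLinf_def)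

lemma unit_tilde:
  assumes "x * inverse x = 1"
  shows "tilde x * inverse (tilde x) = 1"
proof -
  have "tilde (x * inverse x) = tilde 1" by (simp only: assms)
  then show ?thesis by (simp only: tilde_hom)
qed

lemma AE_circle_neq: "AE t in circle. t \<noteq> c"
proof -
  have [measurable]: "Measurable.pred circle (\<lambda>t. t \<noteq> c)" by measurable
  have "countable {x. cis x = c}"
  proof (cases "\<exists>y. cis y = c")
    case True
    then obtain y where y: "cis y = c" by blast
    have "{x. cis x = c} \<subseteq> range (\<lambda>n::int. y + 2 * pi * of_int n)"
    proof
      fix x assume "x \<in> {x. cis x = c}"
      then have "cis x = cis y" using y by simp
      then have "sin x = sin y \<and> cos x = cos y" by (simp add: complex_eq_iff)
      then obtain n where n: "x = y + 2 * pi * of_int n" unfolding sin_cos_eq_iff by (auto elim!: Ints_cases)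
      then show "x \<in> range (\<lambda>n::int. y + 2 * pi * of_int n)" by blast
    qed
    then show ?thesis by (rule countable_subset) simp
  qed simp
  then have "emeasure lborel {x. cis x = c} = 0" by (rule emeasure_lborel_countable)
  moreover have "{x. cis x = c} \<in> sets lborel" using \<open>countable _\<close> by (simp add: countable_imp_null_set_lborel null_setsD2)
  ultimately have "AE x in lborel. x \<notin> {x. cis x = c}" by (intro AE_not_in) (simp add: null_sets_def)
  then show ?thesis by (subst AE_circle_iff) (auto elim!: eventually_mono)
qed

text \<open>Each of 1 + t and 1 - t vanishes at a single point, a null set. So both can be cancelled
  among measurable functions, although their inverses are unbounded.\<close>

lemma one_plus_minus_unit:
  "(1 + tpow 1) * inverse (1 + tpow 1) = 1" "(1 - tpow 1) * inverse (1 - tpow 1) = 1"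
proof -
  have e: "1 + tpow 1 = cf (\<lambda>t. 1 + t)" "1 - tpow 1 = cf (\<lambda>t. 1 - t)"
    by (simp_all add: tpow_cf one_circle_fun_def cf_simps)
  show "(1 + tpow 1) * inverse (1 + tpow 1) = 1"
    unfolding e using AE_circle_neq[of "-1"] by (subst cf_unit_iff) (auto elim!: eventually_mono simp: add_eq_0_iff)
  show "(1 - tpow 1) * inverse (1 - tpow 1) = 1"
    unfolding e using AE_circle_neq[of 1] by (subst cf_unit_iff) (auto elim!: eventually_mono)
qed

lemma unit_cancel: "x * inverse x = (1 :: circle_fun) \<Longrightarrow> x * y = x * z \<Longrightarrow> y = z"
  by (metis mult.assoc mult.commute mult_1_left)

section \<open>Toeplitz plus Hankel operators\<close>

lemma flip_eq: "flip x = tpow (- 1) * tilde x"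
  by (simp add: flip_def inverse_tvar)

lemma flip_flip [simp]: "flip (flip x) = x"
  by (simp add: flip_eq mult.assoc[symmetric] tpow_mult)

lemma flip_add: "flip (x + y) = flip x + flip y"
  by (simp add: flip_eq distrib_left)

lemma flip_diff: "flip (x - y) = flip x - flip y"
  by (simp add: flip_eq right_diff_distrib)

lemma flip_smult: "flip (z *\<^sub>C x) = z *\<^sub>C flip x"
  by (simp add: flip_eq)

lemma flip_mult: "flip (x * y) = tilde x * flip y"
  by (simp add: flip_eq mult_ac)

lemma flip_zero [simp]: "flip 0 = 0"
  by (simp add: flip_eq)

lemma flip_Lp: "0 < p \<Longrightarrow> x \<in> Lp p \<Longrightarrow> flip x \<in> Lp p"
  by (simp add: flip_eq)

lemma Lp_norm_flip [simp]: "Lp_norm p (flip x) = Lp_norm p x"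
  by (simp add: flip_eq)

lemma fourier_coeff_flip [simp]: "fourier_coeff (flip x) n = fourier_coeff x (- n - 1)"
  by (simp add: flip_eq)

text \<open>\<open>flip\<close> sends the index n to - n - 1 and so exchanges nonnegative and
  negative indices without overlap; the kernel of the projection is the flipped Hardy space.\<close>

lemma riesz_proj_eq_0_iff:
  assumes p: "1 < p" and x: "x \<in> Lp p"
  shows "riesz_proj p x = 0 \<longleftrightarrow> (\<exists>h\<in>Hp p. x = flip h)"
proof
  assume 0: "riesz_proj p x = 0"
  have "fourier_coeff x n = 0" if "n \<ge> 0" for n
    using riesz_proj_coeff[OF p x that] 0 by simp
  then have "flip x \<in> Hp p" using x p by (auto simp: Hp_def flip_Lp)
  then show "\<exists>h\<in>Hp p. x = flip h" by (metis flip_flip)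
next
  assume "\<exists>h\<in>Hp p. x = flip h"
  then obtain h where h: "h \<in> Hp p" "x = flip h" by blast
  then show "riesz_proj p x = 0"
    by (intro riesz_proj_eqI[OF p x]) (auto simp: Hp_coeff)
qed

definition symb :: "circle_fun \<Rightarrow> circle_fun \<Rightarrow> circle_fun \<Rightarrow> circle_fun" where
  "symb a b f = a * f + b * flip f"

lemma symb_Lp: "0 < p \<Longrightarrow> a \<in> Linf \<Longrightarrow> b \<in> Linf \<Longrightarrow> f \<in> Lp p \<Longrightarrow> symb a b f \<in> Lp p"
  by (simp add: symb_def Lp_add Linf_Lp flip_Lp)

lemma symb_add: "symb a b (f + g) = symb a b f + symb a b g"
  by (simp add: symb_def flip_add algebra_simps)

lemma symb_diff: "symb a b (f - g) = symb a b f - symb a b g"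
  by (simp add: symb_def flip_diff algebra_simps)

lemma symb_smult: "symb a b (z *\<^sub>C f) = z *\<^sub>C symb a b f"
  by (simp add: symb_def flip_smult circle_fun.scale_right_distrib)

definition toep_hank :: "real \<Rightarrow> circle_fun \<Rightarrow> circle_fun \<Rightarrow> circle_fun \<Rightarrow> circle_fun" where
  "toep_hank p a b f = riesz_proj p (symb a b f)"

lemma toeplitz_plus_hankel:
  assumes "1 < p" "a \<in> Linf" "b \<in> Linf" "f \<in> Hp p"
  shows "toeplitz p a f + hankel p b f = toep_hank p a b f"
  using assms riesz_proj_add[OF assms(1), of "a * f" "b * flip f"]
  by (simp add: toeplitz_def hankel_def toep_hank_def symb_def Linf_Lp flip_Lp Hp_Lp)

section \<open>The operator on the Hardy space and its transpose\<close>

locale toeplitz_hankel =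
  fixes p :: real and a b :: circle_fun
  assumes p: "1 < p" and a: "a \<in> Linf" and b: "b \<in> Linf"
begin

lemma p0: "0 < p" "1 \<le> p"
  using p by auto

abbreviation "X \<equiv> symb a b"
abbreviation "A \<equiv> toep_hank p a b"

lemma X_Lp: "f \<in> Hp p \<Longrightarrow> X f \<in> Lp p"
  by (simp add: symb_Lp p0 a b Hp_Lp)

lemma A_Hp: "f \<in> Hp p \<Longrightarrow> A f \<in> Hp p"
  unfolding toep_hank_def by (intro riesz_proj_Hp p X_Lp)

lemma A_add: "f \<in> Hp p \<Longrightarrow> g \<in> Hp p \<Longrightarrow> A (f + g) = A f + A g"
  unfolding toep_hank_def symb_add by (intro riesz_proj_add p X_Lp)

lemma A_diff: "f \<in> Hp p \<Longrightarrow> g \<in> Hp p \<Longrightarrow> A (f - g) = A f - A g"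
  unfolding toep_hank_def symb_diff by (intro riesz_proj_diff p X_Lp)

lemma A_smult: "f \<in> Hp p \<Longrightarrow> A (z *\<^sub>C f) = z *\<^sub>C A f"
  unfolding toep_hank_def symb_smult by (intro riesz_proj_smult p X_Lp)

lemma A_zero [simp]: "A 0 = 0"
  using A_smult[OF Hp_zero, of 0] by simp

lemma A_sum: "(\<And>i. i \<in> I \<Longrightarrow> f i \<in> Hp p) \<Longrightarrow> A (sum f I) = (\<Sum>i\<in>I. A (f i))"
  by (induction I rule: infinite_finite_induct) (auto simp: A_add Hp_sum p)

lemma A_bounded:
  obtains K where "0 \<le> K" "\<And>f. f \<in> Hp p \<Longrightarrow> Lp_norm p (A f) \<le> K * Lp_norm p f"
proof -
  obtain C where C: "0 \<le> C" "\<And>x. x \<in> Lp p \<Longrightarrow> Lp_norm p (riesz_proj p x) \<le> C * Lp_norm p x"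
    using riesz_proj_bounded[OF p] by blast
  obtain K where K: "0 \<le> K" "\<And>x. x \<in> Lp p \<Longrightarrow> a * x \<in> Lp p \<and> Lp_norm p (a * x) \<le> K * Lp_norm p x"
    using Linf_mult_Lp[OF a p0(1)] by metis
  obtain L where L: "0 \<le> L" "\<And>x. x \<in> Lp p \<Longrightarrow> b * x \<in> Lp p \<and> Lp_norm p (b * x) \<le> L * Lp_norm p x"
    using Linf_mult_Lp[OF b p0(1)] by metis
  have "Lp_norm p (A f) \<le> C * (K + L) * Lp_norm p f" if f: "f \<in> Hp p" for f
  proof -
    have "Lp_norm p (X f) \<le> Lp_norm p (a * f) + Lp_norm p (b * flip f)"
      unfolding symb_def using K(2)[of f] L(2)[of "flip f"] f
      by (intro Lp_norm_triangle p0) (auto simp: Hp_Lp flip_Lp p0)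
    also have "\<dots> \<le> K * Lp_norm p f + L * Lp_norm p f"
      using K(2)[of f] L(2)[of "flip f"] f by (auto simp: Hp_Lp flip_Lp p0)
    finally have "C * Lp_norm p (X f) \<le> C * (K * Lp_norm p f + L * Lp_norm p f)"
      using C(1) by (intro mult_left_mono)
    then show ?thesis using C(2)[OF X_Lp[OF f]] by (simp add: toep_hank_def algebra_simps)
  qed
  then show ?thesis using that[of "C * (K + L)"] C K L by simp
qed

lemma A_eq_0_iff: "f \<in> Hp p \<Longrightarrow> A f = 0 \<longleftrightarrow> (\<exists>h\<in>Hp p. X f = flip h)"
  unfolding toep_hank_def by (intro riesz_proj_eq_0_iff p X_Lp)

text \<open>The transpose of \<open>A\<close> with respect to the pairing \<open>cint (f * tilde g)\<close> has the symbols
  \<open>tilde a\<close> and \<open>b\<close>.\<close>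

lemma pairing:
  assumes q: "1/p + 1/q = 1" and f: "f \<in> Hp p" and g: "g \<in> Hp q"
  shows "cint (A f * tilde g) = cint (tilde f * symb (tilde a) b g)"
proof -
  have q1: "1 < q" by (rule conjugate_exponent[OF p q])
  have gt: "tilde g \<in> Lp q" using g by (simp add: Hp_Lp)
  have XL: "X f \<in> Lp p" and AL: "A f \<in> Lp p" using f by (auto intro: X_Lp A_Hp Hp_Lp)
  have m1: "x * y \<in> Lp 1" if "x \<in> Lp p" "y \<in> Lp q" for x y by (rule Lp_mult_1(1)[OF p q that])
  have "riesz_proj p (X f - A f) = 0"
    using riesz_proj_diff[OF p XL AL] riesz_proj_ident[OF p A_Hp[OF f]] by (simp add: toep_hank_def)
  then obtain h where h: "h \<in> Hp p" "X f - A f = flip h"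
    using riesz_proj_eq_0_iff[OF p Lp_diff[OF p0(1) XL AL]] by blast
  \<comment> \<open>What the projection removes from \<open>X f\<close> pairs with \<open>g\<close>
    to the coefficient of index -1 of the analytic product \<open>h * g\<close>.\<close>
  have "cint (flip h * tilde g) = fourier_coeff (tilde (h * g)) 1"
    by (simp add: fourier_coeff_eq flip_eq mult.assoc)
  also have "\<dots> = 0" using Hp_mult_coeff_neg[OF p q h(1) g, of "-1"] by (simp only: fourier_coeff_tilde)
  finally have "cint (X f * tilde g - A f * tilde g) = 0" unfolding h(2)[symmetric] by (simp only: left_diff_distrib)
  then have "cint (A f * tilde g) = cint (X f * tilde g)"
    using m1[OF XL gt] m1[OF AL gt] by (simp add: cint_diff)
  also have "X f * tilde g = tilde (tilde f * (tilde a * g)) + tilde f * (b * flip g)"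
    by (simp add: symb_def flip_eq algebra_simps)
  also have "cint \<dots> = cint (tilde f * (tilde a * g)) + cint (tilde f * (b * flip g))"
  proof (subst cint_add)
    have "tilde f \<in> Lp p" "tilde a * g \<in> Lp q" "b * flip g \<in> Lp q"
      using f g q1 a b by (auto simp: Hp_Lp flip_Lp intro!: Linf_Lp Linf_tilde)
    then show "tilde (tilde f * (tilde a * g)) \<in> Lp 1" "tilde f * (b * flip g) \<in> Lp 1"
      unfolding tilde_in_Lp by (auto intro: m1)
  qed (simp only: cint_tilde)
  also have "\<dots> = cint (tilde f * symb (tilde a) b g)"
  proof (subst cint_add[symmetric])
    have "tilde f \<in> Lp p" "tilde a * g \<in> Lp q" "b * flip g \<in> Lp q"
      using f g q1 a b by (auto simp: Hp_Lp flip_Lp intro!: Linf_Lp Linf_tilde)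
    then show "tilde f * (tilde a * g) \<in> Lp 1" "tilde f * (b * flip g) \<in> Lp 1"
      by (auto intro: m1)
  qed (simp add: symb_def distrib_left)
  finally show ?thesis .
qed

text \<open>A proper closed range has an annihilator \<open>g\<close>. Its pairings with the images
  of the monomials are the nonnegative coefficients of \<open>symb (tilde a) b g\<close>, so
  \<open>g\<close> lies in the kernel of the transpose.\<close>

lemma surj_of_adjoint_inj:
  assumes q: "1/p + 1/q = 1" and closed: "closed_Lp_subspace p (A ` Hp p)"
    and inj: "\<And>g h. g \<in> Hp q \<Longrightarrow> h \<in> Hp q \<Longrightarrow> symb (tilde a) b g = flip h \<Longrightarrow> g = 0"
  shows "A ` Hp p = Hp p"
proof (rule ccontr)
  assume "A ` Hp p \<noteq> Hp p"
  then obtain f where f: "f \<in> Hp p" "f \<notin> A ` Hp p" using A_Hp by blast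
  have q1: "1 < q" by (rule conjugate_exponent[OF p q])
  obtain g where g: "g \<in> Hp q" "g \<noteq> 0" "\<And>s. s \<in> A ` Hp p \<Longrightarrow> cint (s * tilde g) = 0"
    using Hp_annihilator[OF q closed _ f] A_Hp by blast
  define Y where "Y = symb (tilde a) b g"
  have Y: "Y \<in> Lp q" unfolding Y_def using q1 g a b by (intro symb_Lp Linf_tilde Hp_Lp) auto
  have "fourier_coeff Y k = 0" if k: "0 \<le> k" for k
    using pairing[OF q Hp_tpow[OF p k] g(1)] g(3)[of "A (tpow k)"] Hp_tpow[OF p k]
    by (simp add: Y_def fourier_coeff_eq)
  then have "riesz_proj q Y = 0" by (intro riesz_proj_eqI[OF q1 Y]) auto
  then obtain h where h: "h \<in> Hp q" "Y = flip h" using riesz_proj_eq_0_iff[OF q1 Y] by blast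
  then show False using inj[OF g(1) h(1)] g(2) by (simp add: Y_def)
qed

end

section \<open>Even Laurent polynomials\<close>

text \<open>The summand for j = 0 is \<open>2 * y 0\<close>. With this convention the coefficients
  of \<rho> times an even polynomial are exactly the rows of the matrix in the theorem, including
  its first column.\<close>

definition even_poly :: "nat \<Rightarrow> (nat \<Rightarrow> complex) \<Rightarrow> circle_fun" where
  "even_poly N y = (\<Sum>j<N. y j *\<^sub>C (tpow (int j) + tpow (- int j)))"

lemma even_poly_add: "even_poly N (\<lambda>j. y j + z j) = even_poly N y + even_poly N z"
  by (simp add: even_poly_def circle_fun.scale_left_distrib sum.distrib)

lemma even_poly_smult: "even_poly N (\<lambda>j. c * y j) = c *\<^sub>C even_poly N y"
  by (simp add: even_poly_def smult_sum)

lemma even_poly_zero [simp]: "even_poly N (\<lambda>j. 0) = 0"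
  by (simp add: even_poly_def)

lemma even_poly_sum: "even_poly N (\<lambda>j. \<Sum>k\<in>I. f k j) = (\<Sum>k\<in>I. even_poly N (f k))"
  by (induction I rule: infinite_finite_induct) (simp_all add: even_poly_add)

lemma tilde_even_poly [simp]: "tilde (even_poly N y) = even_poly N y"
  by (simp add: even_poly_def add.commute)

lemma even_poly_single: "j < N \<Longrightarrow> even_poly N (\<lambda>i. if i = j then c else 0) = c *\<^sub>C (tpow (int j) + tpow (- int j))"
proof -
  assume j: "j < N"
  have "even_poly N (\<lambda>i. if i = j then c else 0) = (\<Sum>i<N. if i = j then c *\<^sub>C (tpow (int i) + tpow (- int i)) else 0)"
    unfolding even_poly_def by (intro sum.cong) auto
  then show ?thesis using j by simp
qed

lemma fourier_coeff_mult_even_poly: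
  assumes "x \<in> Lp 1"
  shows "fourier_coeff (x * even_poly N y) i = (\<Sum>j<N. y j * (fourier_coeff x (i - int j) + fourier_coeff x (i + int j)))"
proof -
  have "x * even_poly N y = (\<Sum>j<N. y j *\<^sub>C (tpow (int j) * x + tpow (- int j) * x))"
    unfolding even_poly_def sum_distrib_left by (intro sum.cong) (auto simp: algebra_simps)
  moreover have "y j *\<^sub>C (tpow (int j) * x + tpow (- int j) * x) \<in> Lp 1" for j
    using assms by (intro Lp_smult Lp_add) auto
  ultimately show ?thesis using assms
    by (simp add: fourier_coeff_sum fourier_coeff_add)
qed

lemma even_poly_eq_0:
  assumes "even_poly N y = 0" "j < N"
  shows "y j = 0"
proof -
  have one: "fourier_coeff 1 k = (if k = 0 then 1 else 0)" for k by (rule fourier_coeff_1)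
  have "0 = fourier_coeff (1 * even_poly N y) (int j)" using assms by simp
  also have "\<dots> = (\<Sum>i<N. y i * (fourier_coeff 1 (int j - int i) + fourier_coeff 1 (int j + int i)))"
    by (rule fourier_coeff_mult_even_poly) simp
  also have "\<dots> = (\<Sum>i<N. if i = j then y j * (1 + (if j = 0 then 1 else 0)) else 0)"
    unfolding one by (intro sum.cong) auto
  also have "\<dots> = y j * (1 + (if j = 0 then 1 else 0))" using assms(2) by simp
  finally show ?thesis by (auto split: if_splits)
qed

text \<open>(t - 1/t) (t^(k+1) + t^(-k-1)) is the difference of the odd expressions for k + 2 and
  for k, hence the induction in steps of two.\<close>

lemma odd_eq_even_poly:
  assumes "k \<le> N"
  shows "\<exists>y. (tpow 1 - tpow (- 1)) * even_poly N y = tpow (int k) - tpow (- int k)"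
  using assms
proof (induction k rule: induct_nat_012)
  case 0
  show ?case by (rule exI[of _ "\<lambda>_. 0"]) simp
next
  case 1
  have "(1/2) *\<^sub>C (tpow 0 + tpow 0) = 1"
    unfolding circle_fun.scale_right_distrib circle_fun.scale_left_distrib[symmetric] by simp
  then show ?case using 1 even_poly_single[of 0 N "1/2"]
    by (intro exI[of _ "\<lambda>i. if i = 0 then 1/2 else 0"]) simp
next
  case (ge2 k)
  then obtain y where y: "(tpow 1 - tpow (- 1)) * even_poly N y = tpow (int k) - tpow (- int k)" by auto
  have "(tpow 1 - tpow (- 1)) * even_poly N (\<lambda>j. y j + (if j = Suc k then 1 else 0)) =
      tpow (int k) - tpow (- int k) + (tpow 1 - tpow (- 1)) * (tpow (int (Suc k)) + tpow (- int (Suc k)))"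
    using ge2 by (simp add: even_poly_add distrib_left y even_poly_single)
  also have "\<dots> = tpow (int (Suc (Suc k))) - tpow (- int (Suc (Suc k)))"
    by (simp add: algebra_simps tpow_mult) (rule arg_cong[of _ _ tpow], simp)
  finally show ?case by blast
qed

text \<open>Antisymmetry turns the lower bound of the support into an upper bound, so
  \<open>x\<close> is an odd Laurent polynomial. For \<open>m \<le> 0\<close> nothing is left, in
  accordance with \<open>nat m = 0\<close>.\<close>

lemma antisymmetric_eq_even_poly:
  assumes x: "x \<in> Lp 1" and anti: "tilde x = - x" and supp: "\<And>k. k < - m \<Longrightarrow> fourier_coeff x k = 0"
  shows "\<exists>y. x = (tpow 1 - tpow (- 1)) * even_poly (nat m) y"
proof -
  define N where "N = nat m"
  define c where "c k = fourier_coeff x k" for k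
  have c_neg: "c (- k) = - c k" for k
    using arg_cong[OF anti, of "\<lambda>x. fourier_coeff x k"] by (simp add: c_def)
  have c0: "c 0 = 0" using c_neg[of 0] by simp
  have mN: "m \<le> int N" by (simp add: N_def)
  have c_big: "c k = 0" if "\<bar>k\<bar> > int N" for k
  proof (cases "k > 0")
    case True
    then show ?thesis using supp[of "- k"] c_neg[of k] that mN by (simp add: c_def)
  next
    case False
    then show ?thesis using supp[of k] that mN by (simp add: c_def)
  qed
  have delta: "(\<Sum>k\<in>{1..N}. c (int k) * (if i = int k then 1 else 0)) = (if 1 \<le> i \<and> i \<le> int N then c i else 0)" for i
  proof (cases "1 \<le> i \<and> i \<le> int N")
    case True
    have "(\<Sum>k\<in>{1..N}. c (int k) * (if i = int k then 1 else 0)) = (\<Sum>k\<in>{1..N}. if k = nat i then c i else 0)"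
      using True by (intro sum.cong) auto
    moreover have "nat i \<in> {1..N}" using True by auto
    ultimately show ?thesis using True by simp
  qed (auto intro!: sum.neutral)
  have L: "c (int k) *\<^sub>C (tpow (int k) - tpow (- int k)) \<in> Lp 1" for k
    by (intro Lp_smult Lp_diff Linf_subset_Lp tpow_Linf) auto
  have xs: "x = (\<Sum>k\<in>{1..N}. c (int k) *\<^sub>C (tpow (int k) - tpow (- int k)))"
  proof (rule fourier_unique_eq[OF x Lp_sum])
    fix i
    have "fourier_coeff (\<Sum>k\<in>{1..N}. c (int k) *\<^sub>C (tpow (int k) - tpow (- int k))) i
       = (\<Sum>k\<in>{1..N}. c (int k) * ((if i = int k then 1 else 0) - (if - i = int k then 1 else 0)))"
      using L by (subst fourier_coeff_sum) (auto intro!: sum.cong simp: fourier_coeff_diff Linf_subset_Lp fourier_coeff_tpow)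
    also have "\<dots> = (if 1 \<le> i \<and> i \<le> int N then c i else 0) - (if 1 \<le> - i \<and> - i \<le> int N then c (- i) else 0)"
      unfolding right_diff_distrib sum_subtractf delta ..
    also have "\<dots> = c i"
      using c_big[of i] c0 c_neg[of i] by (cases "i = 0"; cases "\<bar>i\<bar> > int N"; cases "i > 0") auto
    finally show "fourier_coeff x i = fourier_coeff (\<Sum>k\<in>{1..N}. c (int k) *\<^sub>C (tpow (int k) - tpow (- int k))) i"
      by (simp add: c_def)
  qed (use L in auto)
  obtain y where y: "\<And>k. k \<le> N \<Longrightarrow> (tpow 1 - tpow (- 1)) * even_poly N (y k) = tpow (int k) - tpow (- int k)"
    using odd_eq_even_poly[of _ N] by metis
  have "(\<Sum>k\<in>{1..N}. c (int k) *\<^sub>C (tpow (int k) - tpow (- int k)))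
      = (\<Sum>k\<in>{1..N}. (tpow 1 - tpow (- 1)) * even_poly N (\<lambda>j. c (int k) * y k j))"
    by (intro sum.cong) (auto simp: even_poly_smult y)
  also have "\<dots> = (tpow 1 - tpow (- 1)) * even_poly N (\<lambda>j. \<Sum>k\<in>{1..N}. c (int k) * y k j)"
    by (simp add: even_poly_sum sum_distrib_left)
  finally have "x = (tpow 1 - tpow (- 1)) * even_poly N (\<lambda>j. \<Sum>k\<in>{1..N}. c (int k) * y k j)"
    using xs by simp
  then show ?thesis unfolding N_def by blast
qed

section \<open>The kernel equations\<close>

lemma mult_cancel_left_unit: "x * xi = 1 \<Longrightarrow> x * (xi * y) = (y :: circle_fun)"
  by (simp add: mult.assoc[symmetric])

text \<open>Here and in the next identities, inverses and reflections are independent variables tied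
  only by product equations; what remains is commutative algebra and adding exponents of t.\<close>

lemma symb_relation_identity:
  assumes "b * bi = 1"
  shows "b * c * d * tpow (2*n + 2*m) * cti * dti * f + b * d * tpow (2*m) * dti * g
     = b * d * tpow (2*m) * dti * bi * (b * c * tpow (2*n) * cti * f + b * g)"
  by (simp add: algebra_simps tpow_mult tpow_mult_left assms mult_cancel_left_unit[OF assms])

lemma kernel_antisymmetric_identity:
  assumes "d * di = 1"
  shows "(1 - tpow 1) * (di * (d * tpow (2*m) * dti * (tpow (- 1) * ht))) = - (tpow (2*m) * ((1 - tpow (- 1)) * (dti * ht)))"
  by (simp add: algebra_simps tpow_mult tpow_mult_left assms mult_cancel_left_unit[OF assms])

lemma kernel_symmetric_identity:
  assumes "b * bi = 1" "c * ci = 1" "ct * cti = 1" "d * di = 1" "dt * dti = 1"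
    and "b * c * d * tpow (2*n + 2*m) * cti * dti * f + b * d * tpow (2*m) * dti * (tpow (- 1) * ft)
      = (1 + tpow 1) * d * tpow (m - 1) * w"
  shows "tpow n * ((1 + tpow 1) * c * f) + tpow (- n) * ((1 + tpow (- 1)) * ct * ft)
     = tpow (- m - n) * (1 + tpow 1) * (1 + tpow (- 1)) * ct * dt * bi * w"
proof -
  note u = assms(1-5) assms(1-5)[THEN mult_cancel_left_unit]
  \<comment> \<open>\<open>k\<close> removes \<open>b\<close>, \<open>d\<close> and the inverse
    reflections, and reduces the first term to the power t^n. As (1 + t)/t = 1 + 1/t, the second
    term becomes the reflection of the first.\<close>
  define k where "k = (1 + tpow 1) * tpow (- n - 2*m) * ct * bi * di * dt"
  have "tpow n * ((1 + tpow 1) * c * f) + tpow (- n) * ((1 + tpow (- 1)) * ct * ft)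
    = k * (b * c * d * tpow (2*n + 2*m) * cti * dti * f + b * d * tpow (2*m) * dti * (tpow (- 1) * ft))"
    unfolding k_def by (simp add: algebra_simps tpow_mult tpow_mult_left u)
  also have "\<dots> = k * ((1 + tpow 1) * d * tpow (m - 1) * w)" by (simp only: assms(6))
  also have "\<dots> = tpow (- m - n) * (1 + tpow 1) * (1 + tpow (- 1)) * ct * dt * bi * w"
    unfolding k_def by (simp add: algebra_simps tpow_mult tpow_mult_left u)
  finally show ?thesis .
qed

lemma kernel_negative_identity:
  assumes "c * ci = 1"
  shows "b * c * tpow (2*n) * cti * (tpow (- n - 1) * ((1 - tpow 1) * ci))
    + b * (tpow (- 1) * (tpow (n + 1) * ((1 - tpow (- 1)) * cti))) = 0"
  by (simp add: algebra_simps tpow_mult tpow_mult_left assms mult_cancel_left_unit[OF assms])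

lemma rho_tpow: "rho b n m cp dp = tpow (- m - n) * (1 + tpow 1) * (1 + tpow (- 1)) * tilde cp * tilde dp * inverse b"
  by (simp add: rho_def tvar_powi inverse_tvar tpow_1)

text \<open>\<open>M\<close> equations in \<open>N\<close> unknowns: the rectangular form serves
  before n = m is known.\<close>

definition homogeneous_solution :: "circle_fun \<Rightarrow> nat \<Rightarrow> nat \<Rightarrow> (nat \<Rightarrow> complex) \<Rightarrow> bool" where
  "homogeneous_solution r M N y \<longleftrightarrow>
     (\<forall>i<M. (\<Sum>j<N. y j * (fourier_coeff r (int i - int j) + fourier_coeff r (int i + int j))) = 0)"

text \<open>\<open>c\<close> and \<open>d\<close> are eliminated: \<open>a\<close>,
  \<open>tilde a\<close> and \<open>tilde b\<close> are expressed through \<open>b\<close> and the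
  factors. This form is preserved both by passing to the transpose and by shifting the indices to
  zero.\<close>

locale factorized =
  fixes p q :: real and a b :: circle_fun and n m :: int and cp dp :: circle_fun
  assumes p: "1 < p" and q: "1/p + 1/q = 1"
    and a: "a \<in> Linf" and b: "b \<in> Linf" and bi: "inverse b \<in> Linf"
    and b_unit: "b * inverse b = 1" and c_unit: "cp * inverse cp = 1" and d_unit: "dp * inverse dp = 1"
    and a_eq: "a = b * cp * tpow (2*n) * inverse (tilde cp)"
    and at_eq: "tilde a = b * dp * tpow (2*m) * inverse (tilde dp)"
    and bt_eq: "tilde b = b * cp * dp * tpow (2*n + 2*m) * inverse (tilde cp) * inverse (tilde dp)"
    and c_Hp: "(1 + tpow 1) * cp \<in> Hp q" and ci_Hp: "(1 - tpow 1) * inverse cp \<in> Hp p"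
    and d_Hp: "(1 + tpow 1) * dp \<in> Hp p" and di_Hp: "(1 - tpow 1) * inverse dp \<in> Hp q"
begin

lemma q1: "1 < q"
  by (rule conjugate_exponent[OF p q])

lemma qp: "1/q + 1/p = 1"
  using q by simp

lemma adjoint: "factorized q p (tilde a) b m n dp cp"
proof
  show "tilde b = b * dp * cp * tpow (2*m + 2*n) * inverse (tilde dp) * inverse (tilde cp)"
    using bt_eq by (simp add: mult_ac add.commute)
  show "tilde (tilde a) = b * cp * tpow (2*n) * inverse (tilde cp)"
    using a_eq by simp
qed (fact q1 qp b bi b_unit c_unit d_unit at_eq c_Hp ci_Hp d_Hp di_Hp Linf_tilde[OF a])+

sublocale toeplitz_hankel p a b
  by unfold_locales (use p a b in auto)

lemma ct_unit: "tilde cp * inverse (tilde cp) = 1" and dt_unit: "tilde dp * inverse (tilde dp) = 1"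
  by (rule unit_tilde[OF c_unit], rule unit_tilde[OF d_unit])

abbreviation "\<rho> \<equiv> rho b n m cp dp"

lemma rho_adjoint: "rho b m n dp cp = \<rho>"
proof -
  have "- n - m = - m - n" by simp
  then show ?thesis unfolding rho_tpow by (simp only: mult_ac)
qed

text \<open>Since 1 + t = t (1 + 1/t), both weights of \<rho> can be written as reflected ones, one
  for each factor; the product pairs the exponents \<open>p\<close> and \<open>q\<close>.\<close>

lemma rho_L1: "\<rho> \<in> Lp 1"
proof -
  have "tilde ((1 + tpow 1) * dp) \<in> Lp p" "tilde ((1 + tpow 1) * cp) \<in> Lp q"
    using d_Hp c_Hp by (simp_all only: tilde_in_Lp Hp_Lp)
  then have 1: "tilde ((1 + tpow 1) * dp) * tilde ((1 + tpow 1) * cp) \<in> Lp 1"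
    by (rule Lp_mult_1(1)[OF p q])
  have e: "\<rho> = (tpow (1 - m - n) * inverse b) * (tilde ((1 + tpow 1) * dp) * tilde ((1 + tpow 1) * cp))"
    unfolding rho_tpow by (simp add: algebra_simps tpow_mult tpow_mult_left)
  have "tpow (1 - m - n) * inverse b \<in> Linf" by (intro Linf_mult tpow_Linf bi)
  then show ?thesis unfolding e by (rule Linf_Lp[OF _ _ 1]) simp
qed

lemma flip_X: "flip (X f) = tilde b * f + tilde a * flip f"
  by (simp add: symb_def flip_add flip_mult)

lemma flip_X_eq: "flip (X f) = tilde a * inverse b * X f"
proof -
  have "flip (X f) = b * cp * dp * tpow (2*n + 2*m) * inverse (tilde cp) * inverse (tilde dp) * f
      + b * dp * tpow (2*m) * inverse (tilde dp) * flip f"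
    unfolding flip_X by (simp only: at_eq bt_eq)
  also have "\<dots> = b * dp * tpow (2*m) * inverse (tilde dp) * inverse b * (b * cp * tpow (2*n) * inverse (tilde cp) * f + b * flip f)"
    by (rule symb_relation_identity[OF b_unit])
  also have "\<dots> = tilde a * inverse b * X f"
    by (simp only: at_eq[symmetric] a_eq[symmetric] symb_def)
  finally show ?thesis .
qed

text \<open>The function \<open>u = (1 - t) h / d\<^sub>+\<close> belongs to the Hardy space of exponent 1 and satisfies
  \<open>u = - t\<^sup>2\<^sup>m tilde u\<close>; so \<open>t\<^sup>-\<^sup>m u\<close> is an antisymmetric Laurent polynomial.\<close>

lemma self_flip_eq:
  assumes h: "h \<in> Hp p" and e: "h = tilde a * inverse b * flip h"
  shows "\<exists>y. h = (1 + tpow 1) * dp * tpow (m - 1) * even_poly (nat m) y"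
proof -
  define u where "u = (1 - tpow 1) * (inverse dp * h)"
  have u': "u = ((1 - tpow 1) * inverse dp) * h" by (simp add: u_def mult.assoc)
  have uL: "u \<in> Lp 1" unfolding u' using Lp_mult_1(1)[OF q1 qp Hp_Lp[OF di_Hp] Hp_Lp[OF h]] .
  have u_neg: "fourier_coeff u k = 0" if "k < 0" for k
    unfolding u' using Hp_mult_coeff_neg[OF q1 qp di_Hp h that] .
  have "h = dp * tpow (2*m) * inverse (tilde dp) * (tpow (- 1) * tilde h)"
  proof -
    have "tilde a * inverse b * flip h = (b * inverse b) * (dp * tpow (2*m) * inverse (tilde dp) * (tpow (- 1) * tilde h))"
      by (simp only: at_eq flip_eq mult_ac)
    then show ?thesis using e b_unit by simp
  qed
  then have "u = (1 - tpow 1) * (inverse dp * (dp * tpow (2*m) * inverse (tilde dp) * (tpow (- 1) * tilde h)))"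
    unfolding u_def by (simp only:)
  also have "\<dots> = - (tpow (2*m) * ((1 - tpow (- 1)) * (inverse (tilde dp) * tilde h)))"
    by (rule kernel_antisymmetric_identity[OF d_unit])
  also have "\<dots> = - (tpow (2*m) * tilde u)" by (simp add: u_def)
  finally have ue: "u = - (tpow (2*m) * tilde u)" .
  define x where "x = tpow (- m) * u"
  have "tilde x = tpow m * tilde u" by (simp add: x_def)
  moreover have "x = - (tpow m * tilde u)" unfolding x_def by (subst ue) (simp add: tpow_mult_left)
  ultimately have "tilde x = - x" by simp
  moreover have "x \<in> Lp 1" using uL by (simp add: x_def)
  moreover have "fourier_coeff x k = 0" if "k < - m" for k using u_neg that by (simp add: x_def)
  ultimately obtain y where y: "x = (tpow 1 - tpow (- 1)) * even_poly (nat m) y"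
    using antisymmetric_eq_even_poly by blast
  define w where "w = even_poly (nat m) y"
  have "(1 - tpow 1) * (tpow (- m) * (inverse dp * h)) = (tpow 1 - tpow (- 1)) * w"
    using y unfolding x_def u_def w_def by (simp add: mult_ac)
  also have "\<dots> = (1 - tpow 1) * (- ((1 + tpow 1) * (tpow (- 1) * w)))"
    by (simp add: algebra_simps tpow_mult tpow_mult_left)
  finally have c: "tpow (- m) * (inverse dp * h) = - ((1 + tpow 1) * (tpow (- 1) * w))"
    by (rule unit_cancel[OF one_plus_minus_unit(2)])
  have "h = dp * tpow m * (tpow (- m) * (inverse dp * h))"
  proof -
    have "dp * tpow m * (tpow (- m) * (inverse dp * h)) = (dp * inverse dp) * ((tpow m * tpow (- m)) * h)"
      by (simp only: mult_ac)
    then show ?thesis by (simp add: d_unit tpow_mult)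
  qed
  also have "\<dots> = (1 + tpow 1) * dp * tpow (m - 1) * ((- 1) *\<^sub>C w)"
    unfolding c minus_eq_smult[symmetric] by (simp add: algebra_simps tpow_mult tpow_mult_left)
  also have "(- 1) *\<^sub>C w = even_poly (nat m) (\<lambda>j. (- 1) * y j)" unfolding w_def by (rule even_poly_smult[symmetric])
  finally show ?thesis by blast
qed

lemma symmetric_equation:
  assumes "flip (X f) = (1 + tpow 1) * dp * tpow (m - 1) * w"
  shows "tpow n * ((1 + tpow 1) * cp * f) + tilde (tpow n * ((1 + tpow 1) * cp * f)) = \<rho> * w"
proof -
  have "b * cp * dp * tpow (2*n + 2*m) * inverse (tilde cp) * inverse (tilde dp) * f
      + b * dp * tpow (2*m) * inverse (tilde dp) * (tpow (- 1) * tilde f) = (1 + tpow 1) * dp * tpow (m - 1) * w"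
  proof -
    have "flip (X f) = tilde b * f + tilde a * (tpow (- 1) * tilde f)"
      using flip_X[of f] by (simp only: flip_eq[of f])
    then show ?thesis using assms by (simp only: at_eq[symmetric] bt_eq[symmetric])
  qed
  from kernel_symmetric_identity[OF b_unit c_unit ct_unit d_unit dt_unit this] show ?thesis
    by (simp add: rho_tpow)
qed

lemma c_mult_Hp:
  assumes f: "f \<in> Hp p"
  shows "(1 + tpow 1) * cp * f \<in> Lp 1" "k < 0 \<Longrightarrow> fourier_coeff ((1 + tpow 1) * cp * f) k = 0"
    "fourier_coeff ((1 + tpow 1) * cp * f) k = (\<Sum>j\<in>{0..k}. fourier_coeff f j * fourier_coeff ((1 + tpow 1) * cp) (k - j))"
  using Lp_mult_1(1)[OF q1 qp Hp_Lp[OF c_Hp] Hp_Lp[OF f]] Hp_mult_coeff_neg[OF q1 qp c_Hp f, of k]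
    Hp_mult_coeff[OF p q f c_Hp, of k] by (simp_all only: mult.commute[of f])

text \<open>With v = (1 + t) c_+ f analytic, t^n v and its reflection have no coefficients at
  indices 0 to n - 1, so the right side \<rho> w satisfies the homogeneous system. Once w = 0, t^n v
  cancels its own reflection, although their supports meet at most at index 0.\<close>

lemma kernel_trivial:
  assumes n: "0 \<le> n" and mat: "\<And>y. homogeneous_solution \<rho> (nat n) (nat m) y \<Longrightarrow> \<forall>j<nat m. y j = 0"
    and f: "f \<in> Hp p" and h: "h \<in> Hp p" and e: "X f = flip h"
  shows "f = 0"
proof -
  have h': "flip (X f) = h" using e by simp
  have "h = tilde a * inverse b * flip h" using flip_X_eq[of f] e by simp
  then obtain y where y: "h = (1 + tpow 1) * dp * tpow (m - 1) * even_poly (nat m) y"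
    using self_flip_eq[OF h] by blast
  define v where "v = (1 + tpow 1) * cp * f"
  have vL: "v \<in> Lp 1" and v_neg: "\<And>k. k < 0 \<Longrightarrow> fourier_coeff v k = 0"
    unfolding v_def using c_mult_Hp[OF f] by auto
  have eq: "tpow n * v + tilde (tpow n * v) = \<rho> * even_poly (nat m) y"
    unfolding v_def using symmetric_equation[of f] h' y by simp
  have co: "fourier_coeff (\<rho> * even_poly (nat m) y) k = fourier_coeff v (k - n) + fourier_coeff v (- k - n)" for k
    unfolding eq[symmetric] using vL by (subst fourier_coeff_add) auto
  have "homogeneous_solution \<rho> (nat n) (nat m) y"
    unfolding homogeneous_solution_def
  proof (intro allI impI)
    fix i assume "i < nat n"
    then show "(\<Sum>j<nat m. y j * (fourier_coeff \<rho> (int i - int j) + fourier_coeff \<rho> (int i + int j))) = 0"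
      using co[of "int i"] v_neg by (simp add: fourier_coeff_mult_even_poly[OF rho_L1])
  qed
  then have "\<forall>j<nat m. y j = 0" by (rule mat)
  then have "even_poly (nat m) y = 0" unfolding even_poly_def by (intro sum.neutral) auto
  then have co0: "fourier_coeff v (k - n) + fourier_coeff v (- k - n) = 0" for k using co[of k] by simp
  have "fourier_coeff v k = 0" for k
  proof (cases "k < 0")
    case False
    \<comment> \<open>The reflected coefficient has index - k - 2n, which is negative unless k = n =
      0; in that case the equation is twice the constant coefficient.\<close>
    show ?thesis
    proof (cases "k = 0 \<and> n = 0")
      case True
      then show ?thesis using co0[of 0] by simp
    next
      case nz: False
      then have "fourier_coeff v (- (k + n) - n) = 0" using False n by (intro v_neg) auto
      then show ?thesis using co0[of "k + n"] by simp
    qed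
  qed (rule v_neg)
  then have "v = 0" using fourier_unique[OF vL] by blast
  then have "(1 + tpow 1) * (cp * f) = (1 + tpow 1) * (cp * 0)" by (simp add: v_def mult.assoc)
  then show "f = 0" by (metis unit_cancel one_plus_minus_unit(1) c_unit)
qed

text \<open>On t^(-n-1) (1 - t) / c_+ the two parts of \<open>X\<close> cancel already before
  projection; the exponent is nonnegative precisely for n < 0.\<close>

lemma kernel_negative_index:
  assumes n: "n < 0"
  obtains f where "f \<in> Hp p" "f \<noteq> 0" "X f = 0"
proof -
  define f where "f = tpow (- n - 1) * ((1 - tpow 1) * inverse cp)"
  have f: "f \<in> Hp p" unfolding f_def using n by (intro Hp_tpow_mult p ci_Hp) auto
  have "X f = 0"
    using kernel_negative_identity[OF c_unit, of b n "inverse (tilde cp)"]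
    by (simp only: symb_def f_def flip_eq a_eq[symmetric]) (simp add: add.commute)
  moreover have "f \<noteq> 0"
  proof
    assume "f = 0"
    then have "0 = tpow (n + 1) * f * cp" by simp
    also have "\<dots> = (tpow (n + 1) * tpow (- n - 1)) * ((1 - tpow 1) * (cp * inverse cp))" unfolding f_def by (simp only: mult_ac)
    also have "\<dots> = 1 - tpow 1" by (simp add: c_unit tpow_mult)
    finally have "1 - tpow 1 = 0" ..
    then have "(1 - tpow 1) * inverse (1 - tpow 1) = 0" by simp
    then show False using one_plus_minus_unit(2) by simp
  qed
  ultimately show ?thesis using that f by blast
qed

text \<open>The constant term of \<open>(1 + t) c\<^sub>+\<close> does not vanish, because the product with \<open>(1 - t) / c\<^sub>+\<close> is
  \<open>1 - t\<^sup>2\<close>.\<close>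

lemma c_constant_term: "fourier_coeff ((1 + tpow 1) * cp) 0 \<noteq> 0"
proof -
  have "((1 - tpow 1) * inverse cp) * ((1 + tpow 1) * cp) = 1 - tpow 2"
  proof -
    have "((1 - tpow 1) * inverse cp) * ((1 + tpow 1) * cp) = (cp * inverse cp) * ((1 - tpow 1) * (1 + tpow 1))" by (simp only: mult_ac)
    then show ?thesis by (simp add: c_unit algebra_simps tpow_mult)
  qed
  then have "fourier_coeff (1 - tpow 2) 0 = fourier_coeff ((1 - tpow 1) * inverse cp) 0 * fourier_coeff ((1 + tpow 1) * cp) 0"
    using Hp_mult_coeff[OF p q ci_Hp c_Hp, of 0] by simp
  moreover have "fourier_coeff (1 - tpow 2) 0 = 1"
    by (subst fourier_coeff_diff) (auto simp: Linf_subset_Lp fourier_coeff_1 fourier_coeff_tpow)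
  ultimately show ?thesis by auto
qed

end

section \<open>Linear systems\<close>

lemma mult_mat_vec_index:
  "i < N \<Longrightarrow> (Matrix.mat N N c *\<^sub>v Matrix.vec N y) $ i = (\<Sum>j<N. c (i, j) * y j)"
  by (simp add: scalar_prod_def atLeast0LessThan)

lemma invertible_mat_iff_trivial_kernel:
  fixes c :: "nat \<times> nat \<Rightarrow> complex"
  shows "invertible_mat (Matrix.mat N N c) \<longleftrightarrow> (\<forall>y. (\<forall>i<N. (\<Sum>j<N. c (i, j) * y j) = 0) \<longrightarrow> (\<forall>j<N. y j = 0))"
proof -
  define M where "M = Matrix.mat N N c"
  have M: "M \<in> carrier_mat N N" by (simp add: M_def)
  have zero_iff: "M *\<^sub>v Matrix.vec N y = 0\<^sub>v N \<longleftrightarrow> (\<forall>i<N. (\<Sum>j<N. c (i, j) * y j) = 0)" for y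
    using mult_mat_vec_index[of _ N c y] by (auto simp: M_def vec_eq_iff)
  show ?thesis unfolding M_def[symmetric]
  proof
    assume "invertible_mat M"
    then obtain B where B: "inverts_mat B M" "inverts_mat M B" by (auto simp: invertible_mat_def)
    have "dim_col (B * M) = dim_row B" using B(1) by (metis inverts_mat_def index_one_mat(3))
    moreover have "dim_col (M * B) = dim_row M" using B(2) by (metis inverts_mat_def index_one_mat(3))
    ultimately have Bc: "B \<in> carrier_mat N N" and BM: "B * M = 1\<^sub>m N"
      using M B by (auto simp: inverts_mat_def)
    show "\<forall>y. (\<forall>i<N. (\<Sum>j<N. c (i, j) * y j) = 0) \<longrightarrow> (\<forall>j<N. y j = 0)"
    proof (intro allI impI)
      fix y j assume y: "\<forall>i<N. (\<Sum>j<N. c (i, j) * y j) = 0" and j: "j < N"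
      have "Matrix.vec N y = (B * M) *\<^sub>v Matrix.vec N y" by (simp add: BM)
      also have "\<dots> = B *\<^sub>v (M *\<^sub>v Matrix.vec N y)" by (rule assoc_mult_mat_vec[OF Bc M]) simp
      also have "M *\<^sub>v Matrix.vec N y = 0\<^sub>v N" using y zero_iff by blast
      also have "B *\<^sub>v 0\<^sub>v N = 0\<^sub>v N" using Bc by (intro eq_vecI) (auto simp: scalar_prod_def)
      finally have "Matrix.vec N y $ j = 0" using j by simp
      then show "y j = 0" using j by simp
    qed
  next
    assume tr: "\<forall>y. (\<forall>i<N. (\<Sum>j<N. c (i, j) * y j) = 0) \<longrightarrow> (\<forall>j<N. y j = 0)"
    have "det M \<noteq> 0"
    proof
      assume "det M = 0"
      then obtain v where v: "v \<in> carrier_vec N" "v \<noteq> 0\<^sub>v N" "M *\<^sub>v v = 0\<^sub>v N"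
        using det_0_iff_vec_prod_zero_field[OF M] by blast
      have "v = Matrix.vec N (\<lambda>i. v $ i)" using v(1) by (intro eq_vecI) auto
      with v(3) zero_iff[of "\<lambda>i. v $ i"] have "\<forall>i<N. (\<Sum>j<N. c (i, j) * v $ j) = 0" by simp
      then have "\<forall>j<N. v $ j = 0" using tr by blast
      then have "v = 0\<^sub>v N" using v(1) by (intro eq_vecI) auto
      then show False using v(2) by simp
    qed
    from det_non_zero_imp_unit[OF M this, of "()"] obtain B where
      "B \<in> carrier_mat N N" "B * M = 1\<^sub>m N" "M * B = 1\<^sub>m N"
      by (auto simp: Units_def ring_mat_def)
    then show "invertible_mat M" using M by (auto simp: invertible_mat_def inverts_mat_def)
  qed
qed

text \<open>The system is padded with zero rows to a square matrix. Row \<open>M\<close> is zero, so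
  the transpose kills a unit vector and the determinant vanishes.\<close>

lemma underdetermined_system:
  fixes c :: "nat \<Rightarrow> nat \<Rightarrow> complex"
  assumes "M < N"
  obtains y where "\<exists>j<N. y j \<noteq> 0" "\<And>i. i < M \<Longrightarrow> (\<Sum>j<N. c i j * y j) = 0"
proof -
  define d where "d ij = (if fst ij < M then c (fst ij) (snd ij) else 0)" for ij
  define A where "A = Matrix.mat N N d"
  have A: "A \<in> carrier_mat N N" by (simp add: A_def)
  have "transpose_mat A *\<^sub>v unit_vec N M = 0\<^sub>v N"
    using assms by (intro eq_vecI) (auto simp: A_def scalar_prod_def d_def unit_vec_def intro!: sum.neutral)
  moreover have "unit_vec N M \<noteq> (0\<^sub>v N :: complex vec)" using assms
    by (metis index_unit_vec(1) index_zero_vec(1) zero_neq_one)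
  ultimately have "det (transpose_mat A) = 0"
    using det_0_iff_vec_prod_zero_field[of "transpose_mat A" N] A by (auto intro!: exI[of _ "unit_vec N M"])
  then have "det A = 0" using det_transpose[OF A] by simp
  then obtain v where v: "v \<in> carrier_vec N" "v \<noteq> 0\<^sub>v N" "A *\<^sub>v v = 0\<^sub>v N"
    using det_0_iff_vec_prod_zero_field[OF A] by blast
  have ve: "v = Matrix.vec N (\<lambda>i. v $ i)" using v(1) by (intro eq_vecI) auto
  have "(\<Sum>j<N. c i j * v $ j) = 0" if i: "i < M" for i
  proof -
    have "(A *\<^sub>v Matrix.vec N (\<lambda>i. v $ i)) $ i = (\<Sum>j<N. d (i, j) * v $ j)"
      unfolding A_def using i assms by (intro mult_mat_vec_index) auto
    then show ?thesis using ve v(3) i assms by (simp add: d_def)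
  qed
  moreover have "\<exists>j<N. v $ j \<noteq> 0"
  proof (rule ccontr)
    assume "\<not> ?thesis"
    then have "v = 0\<^sub>v N" using v(1) by (intro eq_vecI) auto
    then show False using v(2) by simp
  qed
  ultimately show ?thesis using that by blast
qed

lemma invertible_toeplitz_hankel_mat_iff:
  "invertible_mat (toeplitz_hankel_mat N r) \<longleftrightarrow> (\<forall>y. homogeneous_solution r N N y \<longrightarrow> (\<forall>j<N. y j = 0))"
  unfolding toeplitz_hankel_mat_def invertible_mat_iff_trivial_kernel homogeneous_solution_def
  by (simp add: mult.commute)

section \<open>Reduction to indices zero\<close>

context factorized
begin

text \<open>The powers divide t^(2n) out of a/b and t^(2m) out of tilde a / b, while the factors
  stay the same.\<close>

lemma shifted: "factorized p q (a * tpow (m - n)) (b * tpow (m + n)) 0 0 cp dp"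
proof
  show "a * tpow (m - n) \<in> Linf" "b * tpow (m + n) \<in> Linf" "inverse (b * tpow (m + n)) \<in> Linf"
    by (auto simp: inverse_mult_cf inverse_tpow intro!: Linf_mult a b bi)
  have "b * tpow (m + n) * inverse (b * tpow (m + n)) = (b * inverse b) * (tpow (m + n) * tpow (- (m + n)))"
    by (simp only: inverse_mult_cf inverse_tpow mult_ac)
  then show "b * tpow (m + n) * inverse (b * tpow (m + n)) = 1" by (simp only: b_unit tpow_mult) simp
  show "a * tpow (m - n) = b * tpow (m + n) * cp * tpow (2 * 0) * inverse (tilde cp)"
  proof -
    have "tpow (2*n) * tpow (m - n) = tpow (m + n)" by (simp add: tpow_mult add.commute)
    then have "b * cp * inverse (tilde cp) * (tpow (2*n) * tpow (m - n)) = b * cp * inverse (tilde cp) * tpow (m + n)" by simp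
    then show ?thesis by (subst a_eq) (simp add: mult_ac)
  qed
  show "tilde (a * tpow (m - n)) = b * tpow (m + n) * dp * tpow (2 * 0) * inverse (tilde dp)"
  proof -
    have "tpow (2*m) * tpow (n - m) = tpow (m + n)" by (simp add: tpow_mult add.commute)
    then have "b * dp * inverse (tilde dp) * (tpow (2*m) * tpow (n - m)) = b * dp * inverse (tilde dp) * tpow (m + n)" by simp
    then show ?thesis by (simp add: at_eq) (simp add: mult_ac)
  qed
  show "tilde (b * tpow (m + n)) = b * tpow (m + n) * cp * dp * tpow (2 * 0 + 2 * 0) * inverse (tilde cp) * inverse (tilde dp)"
  proof -
    have "tpow (2*n + 2*m) * tpow (- m - n) = tpow (m + n)" by (simp add: tpow_mult add.commute)
    then have "b * cp * dp * inverse (tilde cp) * inverse (tilde dp) * (tpow (2*n + 2*m) * tpow (- m - n))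
      = b * cp * dp * inverse (tilde cp) * inverse (tilde dp) * tpow (m + n)" by simp
    then show ?thesis by (simp add: bt_eq) (simp add: mult_ac)
  qed
qed (fact p q c_unit d_unit c_Hp ci_Hp d_Hp di_Hp)+

lemma rho_shifted: "rho (b * tpow (m + n)) 0 0 cp dp = \<rho>"
proof -
  have "- (m + n) = - m - n" by simp
  then show ?thesis unfolding rho_tpow inverse_mult_cf inverse_tpow
    by (simp only: diff_0_right minus_zero tpow_0 mult_1_left mult_ac)
qed

text \<open>Solving \<open>S f\<^sub>0 = P (t\<^sup>m J h)\<close> for the operator \<open>S\<close> with indices zero gives a function whose first
  \<open>n\<close> coefficients vanish, by the linear system; dividing it by \<open>t\<^sup>n\<close> gives a kernel function of \<open>A\<close>.\<close>

lemma kernel_of_homogeneous_solution: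
  assumes n: "0 \<le> n"
    and surj: "\<And>g. g \<in> Hp p \<Longrightarrow> \<exists>f\<in>Hp p. toep_hank p (a * tpow (m - n)) (b * tpow (m + n)) f = g"
    and y: "homogeneous_solution \<rho> (nat n) (nat m) y" "\<exists>j<nat m. y j \<noteq> 0"
  shows "\<exists>f\<in>Hp p. f \<noteq> 0 \<and> A f = 0"
proof -
  interpret S: factorized p q "a * tpow (m - n)" "b * tpow (m + n)" 0 0 cp dp by (rule shifted)
  define w where "w = even_poly (nat m) y"
  define h where "h = (1 + tpow 1) * dp * tpow (m - 1) * w"
  have hH: "h \<in> Hp p"
  proof -
    \<comment> \<open>All exponents m - 1 - j with j < m are nonnegative, so \<open>h\<close> is
      analytic.\<close>
    have e: "h = (\<Sum>j<nat m. y j *\<^sub>C (tpow (m - 1 + int j) * ((1 + tpow 1) * dp) + tpow (m - 1 - int j) * ((1 + tpow 1) * dp)))"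
      unfolding h_def w_def even_poly_def sum_distrib_left
      by (intro sum.cong) (auto simp: algebra_simps tpow_mult tpow_mult_left)
    show ?thesis unfolding e by (intro Hp_sum Hp_smult Hp_add Hp_tpow_mult d_Hp p) auto
  qed
  have w0: "w \<noteq> 0" using even_poly_eq_0 y(2) unfolding w_def by blast
  have h0: "h \<noteq> 0"
  proof
    assume "h = 0"
    then have "(1 + tpow 1) * (dp * (tpow (m - 1) * w)) = (1 + tpow 1) * (dp * (tpow (m - 1) * 0))" by (simp add: h_def mult.assoc)
    then have "tpow (m - 1) * w = tpow (m - 1) * 0" by (metis unit_cancel one_plus_minus_unit(1) d_unit)
    then have "tpow (1 - m) * (tpow (m - 1) * w) = 0" by simp
    then show False using w0 by (simp add: tpow_mult_left)
  qed
  define Y where "Y = tpow m * flip h"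
  have YL: "Y \<in> Lp p" using hH by (simp add: Y_def flip_Lp Hp_Lp p0)
  obtain f0 where f0: "f0 \<in> Hp p" "S.A f0 = riesz_proj p Y"
    using surj[OF riesz_proj_Hp[OF p YL]] by blast
  have "riesz_proj p (S.X f0 - Y) = 0"
    using f0 riesz_proj_diff[OF p S.X_Lp[OF f0(1)] YL] by (simp add: toep_hank_def)
  then obtain k where k: "k \<in> Hp p" "S.X f0 - Y = flip k"
    using riesz_proj_eq_0_iff[OF p Lp_diff[OF p0(1) S.X_Lp[OF f0(1)] YL]] by blast
  \<comment> \<open>\<open>S.X f0\<close> and \<open>Y\<close> both obey the flip relation with
    \<open>d0\<close>, hence so does their difference. At index zero \<open>self_flip_eq\<close>
    leaves only \<open>k = 0\<close>, and the equation solved modulo the kernel of the projection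
    holds exactly.\<close>
  define d0 where "d0 = tilde (a * tpow (m - n)) * inverse (b * tpow (m + n))"
  have d0: "d0 = dp * inverse (tilde dp)"
  proof -
    have "d0 = (b * tpow (m + n) * inverse (b * tpow (m + n))) * (dp * inverse (tilde dp))"
      unfolding d0_def S.at_eq by (simp add: mult_ac)
    then show ?thesis by (simp only: S.b_unit mult_1_left)
  qed
  have fY: "flip Y = tpow (- m) * h" by (simp add: Y_def flip_mult)
  have fY': "flip Y = d0 * Y"
  proof -
    have tw: "tilde w = w" by (simp add: w_def)
    have "d0 * Y = (dp * (1 + tpow 1) * w * tpow (- 1)) * (tilde dp * inverse (tilde dp))"
      unfolding d0 Y_def h_def flip_eq by (simp add: tw algebra_simps tpow_mult tpow_mult_left)
    also have "\<dots> = tpow (- m) * h" unfolding dt_unit h_def by (simp add: algebra_simps tpow_mult tpow_mult_left)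
    finally show ?thesis using fY by simp
  qed
  have "k = flip (S.X f0) - flip Y" using k(2) by (metis flip_diff flip_flip)
  also have "\<dots> = d0 * (S.X f0 - Y)" using S.flip_X_eq[of f0] fY' by (simp add: d0_def right_diff_distrib)
  finally have "k = tilde (a * tpow (m - n)) * inverse (b * tpow (m + n)) * flip k" using k(2) by (simp add: d0_def)
  then have "k = 0" using S.self_flip_eq[OF k(1)] by (auto simp: even_poly_def)
  then have XY: "S.X f0 = Y" using k(2) by simp
  define v where "v = (1 + tpow 1) * cp * f0"
  have vL: "v \<in> Lp 1" and v_neg: "\<And>k. k < 0 \<Longrightarrow> fourier_coeff v k = 0"
    and v_conv: "\<And>k. fourier_coeff v k = (\<Sum>j\<in>{0..k}. fourier_coeff f0 j * fourier_coeff ((1 + tpow 1) * cp) (k - j))"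
    unfolding v_def using c_mult_Hp[OF f0(1)] by auto
  have "flip (S.X f0) = (1 + tpow 1) * dp * tpow (0 - 1) * w"
    unfolding XY fY h_def by (simp add: algebra_simps tpow_mult tpow_mult_left)
  from S.symmetric_equation[OF this] have eq: "v + tilde v = \<rho> * w"
    unfolding rho_shifted v_def by simp
  have v0: "fourier_coeff v k = 0" if "k < n" for k
  proof (cases "k < 0")
    case False
    have "fourier_coeff v k + fourier_coeff v (- k) = fourier_coeff (\<rho> * w) k"
      unfolding eq[symmetric] using vL by (subst fourier_coeff_add) auto
    also have "\<dots> = (\<Sum>j<nat m. y j * (fourier_coeff \<rho> (k - int j) + fourier_coeff \<rho> (k + int j)))"
      unfolding w_def by (rule fourier_coeff_mult_even_poly[OF rho_L1])
    also have "\<dots> = 0"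
    proof -
      have "nat k < nat n" "int (nat k) = k" using that False by auto
      then show ?thesis using y(1)[unfolded homogeneous_solution_def, rule_format, of "nat k"] by simp
    qed
    finally have "fourier_coeff v k + fourier_coeff v (- k) = 0" .
    then show ?thesis using v_neg[of "- k"] False by (cases "k = 0") auto
  qed (rule v_neg)
  \<comment> \<open>The convolution for \<open>v\<close> is triangular with the nonzero constant
    term of (1 + t) c_+ on the diagonal; so vanishing passes from the coefficients of
    \<open>v\<close> to those of \<open>f0\<close>.\<close>
  have f0n: "fourier_coeff f0 (int k) = 0" if "int k < n" for k
    using that
  proof (induction k rule: less_induct)
    case (less k)
    have z: "fourier_coeff f0 j = 0" if "j \<in> {0..int k} - {int k}" for j
      using less.IH[of "nat j"] that less.prems by auto
    have "0 = fourier_coeff v (int k)" using v0 less.prems by simp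
    also have "\<dots> = (\<Sum>j\<in>{int k}. fourier_coeff f0 j * fourier_coeff ((1 + tpow 1) * cp) (int k - j))"
      unfolding v_conv by (rule sum.mono_neutral_right) (use z in auto)
    finally show ?case using c_constant_term by simp
  qed
  have f0z: "fourier_coeff f0 k = 0" if "k < n" for k
  proof (cases "k < 0")
    case False
    then show ?thesis using f0n[of "nat k"] that by simp
  qed (rule Hp_coeff[OF f0(1)])
  define f where "f = tpow (- n) * f0"
  have f: "f \<in> Hp p" using f0(1) f0z by (auto simp: f_def Hp_def p0)
  have "X f = tpow (- m) * S.X f0"
    unfolding symb_def f_def flip_mult by (simp add: algebra_simps tpow_mult tpow_mult_left)
  also have "\<dots> = flip h" by (simp add: XY Y_def tpow_mult_left)
  finally have Xf: "X f = flip h" .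
  have "f \<noteq> 0"
  proof
    assume "f = 0"
    then have "flip h = 0" using Xf by (simp add: symb_def)
    then have "flip (flip h) = 0" by simp
    then show False using h0 by simp
  qed
  then show ?thesis using f Xf hH A_eq_0_iff[OF f] by blast
qed

text \<open>The operator factors as \<open>A f = P (t\<^sup>-\<^sup>m S (t\<^sup>n f))\<close>, where \<open>S\<close> has indices zero. If \<open>A\<close> is
  invertible, then \<open>S\<close> has closed range and hence is bijective, and its restriction to \<open>t\<^sup>n H\<^sup>p\<close> has
  a range complemented by the polynomials of degree below \<open>m\<close>, so \<open>n = m\<close>.\<close>

lemma invertible_imp:
  assumes bdd: "0 \<le> K" "\<And>f. f \<in> Hp p \<Longrightarrow> Lp_norm p f \<le> K * Lp_norm p (A f)"
    and surj: "\<And>g. g \<in> Hp p \<Longrightarrow> \<exists>f\<in>Hp p. A f = g"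
  shows "0 \<le> n" "n = m" "homogeneous_solution \<rho> (nat n) (nat m) y \<Longrightarrow> j < nat m \<Longrightarrow> y j = 0"
proof -
  have inj: "f = 0" if "f \<in> Hp p" "A f = 0" for f
    using bdd(2)[OF that(1)] that Lp_norm_nonneg[of p f] Lp_norm_eq_0[OF p0(1) Hp_Lp[OF that(1)]] by simp
  show n: "0 \<le> n"
  proof (rule ccontr)
    assume "\<not> 0 \<le> n"
    then obtain f where "f \<in> Hp p" "f \<noteq> 0" "X f = 0" using kernel_negative_index by force
    then show False using inj[of f] riesz_proj_ident[OF p Hp_zero] by (simp add: toep_hank_def)
  qed
  have m: "0 \<le> m"
  proof (rule ccontr)
    assume "\<not> 0 \<le> m"
    interpret Adj: factorized q p "tilde a" b m n dp cp by (rule adjoint)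
    \<comment> \<open>A kernel function of the transpose pairs to 0 with the range of
      \<open>A\<close>, which contains every monomial t^k with k \<ge> 0.\<close>
    obtain g where g: "g \<in> Hp q" "g \<noteq> 0" "Adj.X g = 0" using Adj.kernel_negative_index \<open>\<not> 0 \<le> m\<close> by force
    have "fourier_coeff g k = 0" if k: "0 \<le> k" for k
    proof -
      obtain f where f: "f \<in> Hp p" "A f = tpow k" using surj[OF Hp_tpow[OF p k]] by blast
      have "cint (tpow k * tilde g) = 0" using pairing[OF q f(1) g(1)] g(3) f(2) by simp
      then have "fourier_coeff (tilde g) (- k) = 0" by (simp add: fourier_coeff_eq)
      then show ?thesis by simp
    qed
    then have "fourier_coeff g k = 0" for k using Hp_coeff[OF g(1), of k] by (cases "0 \<le> k") auto
    then show False using g(2) fourier_unique[OF Lp_le_1(1)[OF q1 Hp_Lp[OF g(1)]]] by blast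
  qed
  interpret S: factorized p q "a * tpow (m - n)" "b * tpow (m + n)" 0 0 cp dp by (rule shifted)
  have XS: "S.X (tpow n * f) = tpow m * X f" for f
    unfolding symb_def flip_mult by (simp add: algebra_simps tpow_mult tpow_mult_left)
  \<comment> \<open>For m \<ge> 0 the inner projection discards only coefficients that the shift
    down by \<open>m\<close> sends to negative indices anyway.\<close>
  have shift: "riesz_proj p (tpow (- m) * riesz_proj p (tpow m * x)) = riesz_proj p x" if x: "x \<in> Lp p" for x
  proof -
    have mx: "tpow m * x \<in> Lp p" using x by (simp add: p0)
    have L: "tpow (- m) * riesz_proj p (tpow m * x) \<in> Lp p"
      using Hp_Lp[OF riesz_proj_Hp[OF p mx]] by (simp add: p0)
    show ?thesis
      using m riesz_proj_Hp[OF p x]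
      by (intro riesz_proj_eqI[OF p L]) (simp_all add: riesz_proj_coeff[OF p mx] riesz_proj_coeff[OF p x])
  qed
  have nH: "tpow n * f \<in> Hp p" if "f \<in> Hp p" for f by (rule Hp_tpow_mult[OF p n that])
  have AS: "A f = riesz_proj p (tpow (- m) * S.A (tpow n * f))" if f: "f \<in> Hp p" for f
    using shift[OF X_Lp[OF f]] by (simp add: toep_hank_def XS)
  have inj_S: "f = 0" if "f \<in> Hp p" "S.A f = 0" for f
    using S.A_eq_0_iff[OF that(1)] that(2) S.kernel_trivial[OF _ _ that(1)] by auto
  obtain L where L: "0 \<le> L" "\<And>f. f \<in> Hp p \<Longrightarrow> Lp_norm p (S.A f) \<le> L * Lp_norm p f"
    using S.A_bounded by blast
  obtain C where C: "0 \<le> C" "\<And>x. x \<in> Lp p \<Longrightarrow> Lp_norm p (riesz_proj p x) \<le> C * Lp_norm p x"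
    using riesz_proj_bounded[OF p] by blast
  define R where "R = (\<lambda>f. S.A (tpow n * f)) ` Hp p"
  have R: "closed_Lp_subspace p R"
  proof
    show "R \<subseteq> Lp p" unfolding R_def using nH S.A_Hp Hp_Lp by auto
    show "0 \<in> R" unfolding R_def by (rule image_eqI[of _ _ 0]) auto
    show "x + y \<in> R" if xy: "x \<in> R" "y \<in> R" for x y
    proof -
      obtain f g where "f \<in> Hp p" "g \<in> Hp p" "x = S.A (tpow n * f)" "y = S.A (tpow n * g)" using xy by (auto simp: R_def)
      then show ?thesis unfolding R_def
        by (intro image_eqI[of _ _ "f + g"]) (auto simp: distrib_left S.A_add nH Hp_add p)
    qed
    show "z *\<^sub>C x \<in> R" if x: "x \<in> R" for x z
    proof -
      obtain f where "f \<in> Hp p" "x = S.A (tpow n * f)" using x by (auto simp: R_def)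
      then show ?thesis unfolding R_def
        by (intro image_eqI[of _ _ "z *\<^sub>C f"]) (auto simp: S.A_smult nH Hp_smult p)
    qed
    \<comment> \<open>If S(t^n f_k) converges, so does A f_k = P(t^(-m) S(t^n f_k)), and the lower
      bound for \<open>A\<close> makes f_k converge.\<close>
    show "y \<in> R" if g: "\<And>k::nat. g k \<in> R" and y: "y \<in> Lp p" and l: "(\<lambda>k. Lp_norm p (g k - y)) \<longlonglongrightarrow> 0" for g y
    proof -
      obtain f where f: "\<And>k. f k \<in> Hp p" "\<And>k. g k = S.A (tpow n * f k)" using g unfolding R_def image_iff by metis
      have gH: "g k \<in> Hp p" for k unfolding f(2) by (intro S.A_Hp nH f)
      have "riesz_proj p (tpow (- m) * y) \<in> Hp p" using y by (intro riesz_proj_Hp p) (simp add: p0)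
      then obtain x where x: "x \<in> Hp p" "A x = riesz_proj p (tpow (- m) * y)" using surj by blast
      have fx: "Lp_norm p (f k - x) \<le> K * (C * Lp_norm p (g k - y))" for k
      proof -
        have "A (f k - x) = riesz_proj p (tpow (- m) * g k) - riesz_proj p (tpow (- m) * y)"
          using f x by (simp add: A_diff AS[OF f(1)])
        also have "\<dots> = riesz_proj p (tpow (- m) * (g k - y))"
          using y Hp_Lp[OF gH] by (simp add: right_diff_distrib riesz_proj_diff p p0)
        also have "Lp_norm p \<dots> \<le> C * Lp_norm p (tpow (- m) * (g k - y))"
          using y Hp_Lp[OF gH] by (intro C) (simp add: p0 Lp_diff)
        finally have "Lp_norm p (A (f k - x)) \<le> C * Lp_norm p (g k - y)" by simp
        then have "K * Lp_norm p (A (f k - x)) \<le> K * (C * Lp_norm p (g k - y))" using bdd(1) by (intro mult_left_mono)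
        then show ?thesis using bdd(2)[of "f k - x"] f x by (simp add: Hp_diff p)
      qed
      have "y = S.A (tpow n * x)"
      proof -
        have d: "Lp_norm p (S.A (tpow n * x) - y) \<le> L * (K * (C * Lp_norm p (g k - y))) + Lp_norm p (g k - y)" for k
        proof -
          have e: "S.A (tpow n * x) - y = S.A (tpow n * (x - f k)) + (g k - y)"
            using f x by (simp add: right_diff_distrib S.A_diff nH)
          have xf: "x - f k \<in> Hp p" using f x by (intro Hp_diff p) auto
          have "Lp_norm p (S.A (tpow n * (x - f k)) + (g k - y)) \<le> Lp_norm p (S.A (tpow n * (x - f k))) + Lp_norm p (g k - y)"
            using Hp_Lp[OF S.A_Hp[OF nH[OF xf]]] y Hp_Lp[OF gH] by (intro Lp_norm_triangle p0 Lp_diff)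
          moreover have "Lp_norm p (S.A (tpow n * (x - f k))) \<le> L * Lp_norm p (f k - x)"
            using L(2)[OF nH[OF xf]] by (simp add: Lp_norm_diff_commute[of p x])
          moreover have "L * Lp_norm p (f k - x) \<le> L * (K * (C * Lp_norm p (g k - y)))" using fx L(1) by (intro mult_left_mono)
          ultimately show ?thesis unfolding e by linarith
        qed
        have "(\<lambda>k. L * (K * (C * Lp_norm p (g k - y))) + Lp_norm p (g k - y)) \<longlonglongrightarrow> L * (K * (C * 0)) + 0"
          by (intro tendsto_intros l)
        then have "Lp_norm p (S.A (tpow n * x) - y) \<le> L * (K * (C * 0)) + 0" by (intro LIMSEQ_le_const) (use d in auto)
        then have "Lp_norm p (S.A (tpow n * x) - y) = 0" using Lp_norm_nonneg[of p "S.A (tpow n * x) - y"] by linarith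
        then show ?thesis
          using Lp_norm_eq_0[OF p0(1) Lp_diff[OF p0(1) Hp_Lp[OF S.A_Hp[OF nH[OF x(1)]]] y]] by simp
      qed
      then show ?thesis using x by (auto simp: R_def)
    qed
  qed (fact p)
  \<comment> \<open>The Hardy space is t^n times itself plus the span of n monomials; so the range
    of \<open>S\<close> is \<open>R\<close> plus a finite-dimensional space, again closed.\<close>
  have "{s + (\<Sum>i<nat n. z i *\<^sub>C S.A (tpow (int i))) | s z. s \<in> R} = S.A ` Hp p"
  proof
    show "{s + (\<Sum>i<nat n. z i *\<^sub>C S.A (tpow (int i))) | s z. s \<in> R} \<subseteq> S.A ` Hp p"
    proof
      fix u assume "u \<in> {s + (\<Sum>i<nat n. z i *\<^sub>C S.A (tpow (int i))) | s z. s \<in> R}"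
      then obtain f z where f: "f \<in> Hp p" and u: "u = S.A (tpow n * f) + (\<Sum>i<nat n. z i *\<^sub>C S.A (tpow (int i)))" by (auto simp: R_def)
      have "u = S.A (tpow n * f + (\<Sum>i<nat n. z i *\<^sub>C tpow (int i)))"
        unfolding u using f p by (simp add: S.A_add S.A_sum S.A_smult nH Hp_sum Hp_smult Hp_tpow)
      moreover have "tpow n * f + (\<Sum>i<nat n. z i *\<^sub>C tpow (int i)) \<in> Hp p"
        using f p by (intro Hp_add Hp_sum Hp_smult Hp_tpow nH) auto
      ultimately show "u \<in> S.A ` Hp p" by blast
    qed
    show "S.A ` Hp p \<subseteq> {s + (\<Sum>i<nat n. z i *\<^sub>C S.A (tpow (int i))) | s z. s \<in> R}"
    proof
      fix u assume "u \<in> S.A ` Hp p"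
      then obtain f where f: "f \<in> Hp p" and u: "u = S.A f" by blast
      define z where "z i = fourier_coeff f (int i)" for i :: nat
      define P where "P = (\<Sum>i<nat n. z i *\<^sub>C tpow (int i))"
      have P: "P \<in> Hp p" unfolding P_def using p by (intro Hp_sum Hp_smult Hp_tpow) auto
      have cP: "fourier_coeff P k = (if 0 \<le> k \<and> k < n then fourier_coeff f k else 0)" for k
      proof -
        have "fourier_coeff P k = (\<Sum>i<nat n. z i * (if k = int i then 1 else 0))"
        proof -
          have "z i *\<^sub>C tpow (int i) \<in> Lp 1" for i by (intro Lp_smult Linf_subset_Lp tpow_Linf) auto
          then show ?thesis unfolding P_def by (simp add: fourier_coeff_sum fourier_coeff_tpow)
        qed
        also have "\<dots> = (\<Sum>i<nat n. if i = nat k then (if 0 \<le> k then fourier_coeff f k else 0) else 0)"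
          by (intro sum.cong) (auto simp: z_def)
        finally show ?thesis by auto
      qed
      define g where "g = tpow (- n) * (f - P)"
      have fP: "f - P \<in> Hp p" by (intro Hp_diff p f P)
      have "fourier_coeff (f - P) k = 0" if "k < n" for k
        using Lp_le_1(1)[OF p Hp_Lp[OF f]] Lp_le_1(1)[OF p Hp_Lp[OF P]] that Hp_coeff[OF f, of k] cP[of k]
        by (cases "k < 0") (auto simp: fourier_coeff_diff)
      then have g: "g \<in> Hp p" using Hp_Lp[OF fP] by (auto simp: g_def Hp_def p0)
      have "f = tpow n * g + P" by (simp add: g_def tpow_mult_left)
      then have "u = S.A (tpow n * g) + (\<Sum>i<nat n. z i *\<^sub>C S.A (tpow (int i)))"
        unfolding u P_def using g p by (simp add: S.A_add S.A_sum S.A_smult nH Hp_sum Hp_smult Hp_tpow)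
      then show "u \<in> {s + (\<Sum>i<nat n. z i *\<^sub>C S.A (tpow (int i))) | s z. s \<in> R}"
        using g unfolding R_def by blast
    qed
  qed
  moreover have "S.A (tpow (int i)) \<in> Lp p" for i by (intro Hp_Lp S.A_Hp Hp_tpow p) auto
  ultimately have closed: "closed_Lp_subspace p (S.A ` Hp p)"
    using closed_Lp_subspace_add_span[OF R, of "\<lambda>i. S.A (tpow (int i))" "nat n"] by simp
  interpret SAdj: factorized q p "tilde (a * tpow (m - n))" "b * tpow (m + n)" 0 0 dp cp by (rule S.adjoint)
  have surj_S: "S.A ` Hp p = Hp p"
    using q closed by (rule S.surj_of_adjoint_inj) (use SAdj.kernel_trivial in auto)
  have no_kernel: "\<not> (homogeneous_solution \<rho> (nat n) (nat m) y \<and> (\<exists>j<nat m. y j \<noteq> 0))" for y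
  proof
    assume y: "homogeneous_solution \<rho> (nat n) (nat m) y \<and> (\<exists>j<nat m. y j \<noteq> 0)"
    have "\<exists>f\<in>Hp p. S.A f = g" if "g \<in> Hp p" for g using surj_S that by (metis image_iff)
    then obtain f where "f \<in> Hp p" "f \<noteq> 0" "A f = 0"
      using kernel_of_homogeneous_solution[OF n] y by blast
    then show False using inj by blast
  qed
  show "homogeneous_solution \<rho> (nat n) (nat m) y \<Longrightarrow> j < nat m \<Longrightarrow> y j = 0"
    using no_kernel[of y] by blast
  have "m \<le> n"
  proof (rule ccontr)
    assume "\<not> m \<le> n"
    then have "nat n < nat m" using n by simp
    then obtain y where "\<exists>j<nat m. y j \<noteq> 0"
      "\<And>i. i < nat n \<Longrightarrow> (\<Sum>j<nat m. (fourier_coeff \<rho> (int i - int j) + fourier_coeff \<rho> (int i + int j)) * y j) = 0"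
      using underdetermined_system[of "nat n" "nat m" "\<lambda>i j. fourier_coeff \<rho> (int i - int j) + fourier_coeff \<rho> (int i + int j)"] by blast
    then show False using no_kernel[of y] by (simp add: homogeneous_solution_def mult.commute)
  qed
  moreover have "n \<le> m"
  proof (rule ccontr)
    assume "\<not> n \<le> m"
    then have lt: "nat m < nat n" using m by simp
    have "\<exists>f\<in>Hp p. A f = riesz_proj p (tpow (- m) * S.A (tpow (int i)))" for i
      by (intro surj riesz_proj_Hp p) (use Hp_Lp[OF S.A_Hp[OF Hp_tpow[OF p]]] in \<open>simp add: p0\<close>)
    then obtain f where f: "\<And>i. f i \<in> Hp p" "\<And>i. A (f i) = riesz_proj p (tpow (- m) * S.A (tpow (int i)))" by metis
    \<comment> \<open>Subtracting \<open>tpow n * f i\<close> leaves \<open>S.A (r i)\<close> with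
      coefficients only below \<open>m\<close>. With n > m such functions some combination has image
      0, but \<open>S\<close> is injective and the \<open>r i\<close> are independent in their first
      n coefficients.\<close>
    define r where "r i = tpow (int i) - tpow n * f i" for i :: nat
    have rH: "r i \<in> Hp p" for i unfolding r_def by (intro Hp_diff Hp_tpow nH f p) auto
    have r_big: "fourier_coeff (S.A (r i)) k = 0" if k: "m \<le> k" for i k
    proof -
      have L: "tpow (- m) * S.A (tpow (int i)) \<in> Lp p" "tpow (- m) * S.A (tpow n * f i) \<in> Lp p" "tpow (- m) * S.A (r i) \<in> Lp p"
        using Hp_Lp[OF S.A_Hp[OF Hp_tpow[OF p]]] Hp_Lp[OF S.A_Hp[OF nH[OF f(1)]]] Hp_Lp[OF S.A_Hp[OF rH]] by (simp_all add: p0)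
      have "tpow (- m) * S.A (r i) = tpow (- m) * S.A (tpow (int i)) - tpow (- m) * S.A (tpow n * f i)"
        unfolding r_def using Hp_tpow[OF p, of "int i"] nH[OF f(1)] by (simp add: S.A_diff right_diff_distrib)
      then have "riesz_proj p (tpow (- m) * S.A (r i)) = 0"
        using riesz_proj_diff[OF p L(1,2)] f(2)[of i] AS[OF f(1)] by simp
      then show ?thesis using riesz_proj_coeff[OF p L(3), of "k - m"] k by simp
    qed
    obtain l where l: "\<exists>i<nat n. l i \<noteq> 0" "\<And>k. k < nat m \<Longrightarrow> (\<Sum>i<nat n. fourier_coeff (S.A (r i)) (int k) * l i) = 0"
      using underdetermined_system[OF lt, of "\<lambda>k i. fourier_coeff (S.A (r i)) (int k)"] by blast
    define s where "s = (\<Sum>i<nat n. l i *\<^sub>C r i)"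
    have sH: "s \<in> Hp p" unfolding s_def by (intro Hp_sum Hp_smult rH p)
    have As: "S.A s = (\<Sum>i<nat n. l i *\<^sub>C S.A (r i))"
      unfolding s_def using rH p by (simp add: S.A_sum S.A_smult Hp_smult)
    have "fourier_coeff (S.A s) k = 0" for k
    proof -
      have "l i *\<^sub>C S.A (r i) \<in> Lp 1" for i
        using Lp_le_1(1)[OF p Hp_Lp[OF S.A_Hp[OF rH]]] by (intro Lp_smult) auto
      then have c: "fourier_coeff (S.A s) k = (\<Sum>i<nat n. l i * fourier_coeff (S.A (r i)) k)"
        unfolding As by (simp add: fourier_coeff_sum)
      consider "k < 0" | "0 \<le> k" "k < m" | "m \<le> k" by linarith
      then show ?thesis
      proof cases
        case 1
        then show ?thesis using Hp_coeff[OF S.A_Hp[OF sH]] by blast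
      next
        case 2
        then show ?thesis using l(2)[of "nat k"] by (simp add: c mult.commute)
      next
        case 3
        then show ?thesis by (simp add: c r_big)
      qed
    qed
    then have "S.A s = 0" using fourier_unique[OF Lp_le_1(1)[OF p Hp_Lp[OF S.A_Hp[OF sH]]]] by blast
    then have s0: "s = 0" by (rule inj_S[OF sH])
    have "l j = 0" if j: "j < nat n" for j
    proof -
      have cr: "fourier_coeff (r i) (int j) = (if i = j then 1 else 0)" for i
      proof -
        have "fourier_coeff (tpow n * f i) (int j) = 0" using j Hp_coeff[OF f(1), of "int j - n" i] by simp
        then show ?thesis unfolding r_def
          using Lp_le_1(1)[OF p Hp_Lp[OF nH[OF f(1)]]]
          by (subst fourier_coeff_diff) (auto simp: fourier_coeff_tpow Linf_subset_Lp)
      qed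
      have "l i *\<^sub>C r i \<in> Lp 1" for i
        using Lp_le_1(1)[OF p Hp_Lp[OF rH]] by (intro Lp_smult) auto
      then have "fourier_coeff s (int j) = (\<Sum>i<nat n. l i * (if i = j then 1 else 0))"
        unfolding s_def by (simp add: fourier_coeff_sum cr)
      also have "\<dots> = (\<Sum>i<nat n. if i = j then l i else 0)" by (intro sum.cong) auto
      also have "\<dots> = l j" using j by simp
      finally show ?thesis using s0 by simp
    qed
    then show False using l(1) by blast
  qed
  ultimately show "n = m" by simp
qed

end

section \<open>Invertibility\<close>

text \<open>Nothing is assumed about zeros of the factors; they are units because they divide the
  units a/b and tilde a / b.\<close>

lemma basic_factorization_factorized:
  assumes p: "1 < p" "1/p + 1/q = 1" and bf: "basic_factorization p q a b c d n m cp dp"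
  shows "factorized p q a b n m cp dp"
proof -
  have ab: "a \<in> GLinf" "b \<in> GLinf" and eqs: "a * tilde a = b * tilde b"
    "c = a / b" "c = tilde b / tilde a" "d = tilde a / b"
    "c = cp * tvar powi (2*n) * tilde (inverse cp)" "d = dp * tvar powi (2*m) * tilde (inverse dp)"
    and H: "(1 + tvar) * cp \<in> Hp q" "(1 - tvar) * inverse cp \<in> Hp p" "(1 + tvar) * dp \<in> Hp p" "(1 - tvar) * inverse dp \<in> Hp q"
    using bf unfolding basic_factorization_def by auto
  note au = GLinf_unit[OF ab(1)] and bu = GLinf_unit[OF ab(2)]
  have c: "a * inverse b = cp * tpow (2*n) * inverse (tilde cp)"
    using eqs(2,5) by (simp add: divide_cf tvar_powi)
  have d: "tilde a * inverse b = dp * tpow (2*m) * inverse (tilde dp)"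
    using eqs(4,6) by (simp add: divide_cf tvar_powi)
  have bt: "tilde b * inverse (tilde a) = cp * tpow (2*n) * inverse (tilde cp)"
    using eqs(3,5) by (simp add: divide_cf tvar_powi)
  have "cp * (tpow (2*n) * inverse (tilde cp) * (b * inverse a)) = (a * inverse b) * (b * inverse a)"
    unfolding c by (simp only: mult_ac)
  also have "\<dots> = (a * inverse a) * (b * inverse b)" by (simp only: mult_ac)
  finally have cu: "cp * inverse cp = 1" using au bu by (intro unit_of_mult) auto
  have "dp * (tpow (2*m) * inverse (tilde dp) * (b * inverse (tilde a))) = (tilde a * inverse b) * (b * inverse (tilde a))"
    unfolding d by (simp only: mult_ac)
  also have "\<dots> = (tilde a * inverse (tilde a)) * (b * inverse b)" by (simp only: mult_ac)
  finally have du: "dp * inverse dp = 1" using unit_tilde[OF au(3)] bu by (intro unit_of_mult) auto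
  show ?thesis
  proof
    have "a = (b * inverse b) * a" by (simp add: bu)
    also have "\<dots> = b * (a * inverse b)" by (simp only: mult_ac)
    finally show "a = b * cp * tpow (2*n) * inverse (tilde cp)" unfolding c by (simp only: mult_ac)
    have "tilde a = (b * inverse b) * tilde a" by (simp add: bu)
    also have "\<dots> = b * (tilde a * inverse b)" by (simp only: mult_ac)
    finally show at: "tilde a = b * dp * tpow (2*m) * inverse (tilde dp)" unfolding d by (simp only: mult_ac)
    have "tilde b = (tilde a * inverse (tilde a)) * tilde b" by (simp add: unit_tilde[OF au(3)])
    also have "\<dots> = tilde a * (tilde b * inverse (tilde a))" by (simp only: mult_ac)
    also have "\<dots> = b * dp * tpow (2*m) * inverse (tilde dp) * (cp * tpow (2*n) * inverse (tilde cp))"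
      unfolding bt by (simp only: at)
    also have "\<dots> = b * cp * dp * (tpow (2*n) * tpow (2*m)) * inverse (tilde cp) * inverse (tilde dp)"
      by (simp only: mult_ac)
    finally show "tilde b = b * cp * dp * tpow (2*n + 2*m) * inverse (tilde cp) * inverse (tilde dp)"
      by (simp only: tpow_mult)
  qed (use p au bu cu du H in \<open>simp_all add: tpow_1\<close>)
qed

theorem corollary4p3:
  fixes p q :: real and a b c d cp dp :: circle_fun and n m :: int
  assumes "1 < p" and "1 / p + 1 / q = 1"
    and "basic_factorization p q a b c d n m cp dp"
    and "fredholm_on (Hp p) (Lp_norm p) (\<lambda>f. toeplitz p a f + hankel p b f)"
  shows "rho b n m cp dp \<in> Lp 1 \<and>
    (invertible_on (Hp p) (Lp_norm p) (\<lambda>f. toeplitz p a f + hankel p b f) \<longleftrightarrow>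
      (n = 0 \<and> m = 0) \<or>
      (n = m \<and> n > 0 \<and> invertible_mat (toeplitz_hankel_mat (nat n) (rho b n m cp dp))))"
proof -
  interpret F: factorized p q a b n m cp dp
    by (rule basic_factorization_factorized[OF assms(1-3)])
  interpret Adj: factorized q p "tilde a" b m n dp cp by (rule F.adjoint)
  define T where "T = (\<lambda>f. toeplitz p a f + hankel p b f)"
  have T: "T f = F.A f" if "f \<in> Hp p" for f
    unfolding T_def using toeplitz_plus_hankel[OF F.p F.a F.b that] .
  have T_img: "T ` Hp p = F.A ` Hp p" by (rule image_cong) (simp_all add: T)
  \<comment> \<open>For n = m = 0 this condition is vacuous, which unites the two cases of the
    theorem.\<close>
  let ?cond = "\<forall>y. homogeneous_solution F.\<rho> (nat n) (nat m) y \<longrightarrow> (\<forall>j<nat m. y j = 0)"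
  have "invertible_on (Hp p) (Lp_norm p) T \<longleftrightarrow> n = m \<and> 0 \<le> n \<and> ?cond"
  proof
    assume "invertible_on (Hp p) (Lp_norm p) T"
    then obtain B where B: "bounded_operator_on (Hp p) (Lp_norm p) B" "\<And>f. f \<in> Hp p \<Longrightarrow> B (T f) = f \<and> T (B f) = f"
      unfolding invertible_on_def by blast
    obtain K where K: "0 \<le> K" "\<And>f. f \<in> Hp p \<Longrightarrow> Lp_norm p (B f) \<le> K * \<bar>Lp_norm p f\<bar>"
      using bounded_operator_onD(4)[OF B(1)] by blast
    have 1: "Lp_norm p f \<le> K * Lp_norm p (F.A f)" if "f \<in> Hp p" for f
      using K(2)[OF F.A_Hp[OF that]] B(2)[OF that] T[OF that] by simp
    have 2: "\<exists>f\<in>Hp p. F.A f = g" if "g \<in> Hp p" for g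
      using B(2)[OF that] T bounded_operator_onD(1)[OF B(1) that] by metis
    show "n = m \<and> 0 \<le> n \<and> ?cond"
      using F.invertible_imp[OF K(1) 1 2] by blast
  next
    assume nm: "n = m \<and> 0 \<le> n \<and> ?cond"
    have inj: "f = 0" if "f \<in> Hp p" "F.A f = 0" for f
      using F.A_eq_0_iff[OF that(1)] that(2) F.kernel_trivial[OF _ _ that(1)] nm by blast
    \<comment> \<open>The Fredholm hypothesis gives closedness within the Hardy space, which is
      itself closed in L^p.\<close>
    have closed: "closed_Lp_subspace p (F.A ` Hp p)"
    proof
      show "y \<in> F.A ` Hp p" if g: "\<And>k::nat. g k \<in> F.A ` Hp p" and y: "y \<in> Lp p" and l: "(\<lambda>k. Lp_norm p (g k - y)) \<longlonglongrightarrow> 0" for g y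
      proof -
        have "g k \<in> Hp p" for k using g[of k] F.A_Hp by auto
        then have "y \<in> Hp p" using Hp_closed[OF F.p _ y l] by blast
        moreover have "\<forall>g y. (\<forall>k::nat. g k \<in> T ` Hp p) \<and> y \<in> Hp p \<and> (\<lambda>k. Lp_norm p (g k - y)) \<longlonglongrightarrow> 0 \<longrightarrow> y \<in> T ` Hp p"
          using assms(4) unfolding fredholm_on_def T_def by blast
        ultimately show ?thesis using g l unfolding T_img by blast
      qed
      show "x + y \<in> F.A ` Hp p" if xy: "x \<in> F.A ` Hp p" "y \<in> F.A ` Hp p" for x y
      proof -
        obtain f g where "f \<in> Hp p" "g \<in> Hp p" "x = F.A f" "y = F.A g" using xy by blast
        then show ?thesis by (intro image_eqI[of _ _ "f + g"]) (simp_all add: F.A_add Hp_add F.p)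
      qed
      show "z *\<^sub>C x \<in> F.A ` Hp p" if x: "x \<in> F.A ` Hp p" for x z
      proof -
        obtain f where "f \<in> Hp p" "x = F.A f" using x by blast
        then show ?thesis by (intro image_eqI[of _ _ "z *\<^sub>C f"]) (simp_all add: F.A_smult Hp_smult F.p)
      qed
      show "0 \<in> F.A ` Hp p" by (rule image_eqI[of _ _ 0]) auto
    qed (use F.p F.A_Hp Hp_Lp in auto)
    have "F.A ` Hp p = Hp p"
    proof (rule F.surj_of_adjoint_inj[OF F.q closed])
      \<comment> \<open>For n = m the transpose has the same \<rho> and the same square system, so
        its kernel is trivial by the same condition.\<close>
      fix g h assume "g \<in> Hp q" "h \<in> Hp q" "symb (tilde a) b g = flip h"
      then show "g = 0" using Adj.kernel_trivial nm unfolding F.rho_adjoint by blast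
    qed
    moreover have "inj_on F.A (Hp p)"
    proof (rule inj_onI)
      fix f g assume fg: "f \<in> Hp p" "g \<in> Hp p" "F.A f = F.A g"
      then have "F.A (f - g) = 0" by (simp add: F.A_diff)
      then have "f - g = 0" by (rule inj[OF Hp_diff[OF F.p fg(1,2)]])
      then show "f = g" by simp
    qed
    ultimately have "bij_betw F.A (Hp p) (Hp p)" by (simp add: bij_betw_def)
    then have "bij_betw T (Hp p) (Hp p)" by (subst bij_betw_cong[OF T])
    moreover have "bounded_operator_on (Hp p) (Lp_norm p) T"
      using assms(4) unfolding fredholm_on_def T_def by blast
    ultimately show "invertible_on (Hp p) (Lp_norm p) T" by (intro Hp_bounded_inverse F.p)
  qed
  moreover have "(n = m \<and> 0 \<le> n \<and> ?cond) \<longleftrightarrow> (n = 0 \<and> m = 0) \<or>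
      (n = m \<and> n > 0 \<and> invertible_mat (toeplitz_hankel_mat (nat n) F.\<rho>))"
    unfolding invertible_toeplitz_hankel_mat_iff by (cases "n = 0") auto
  ultimately show ?thesis using F.rho_L1 unfolding T_def by simp
qed

end
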